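(* The set $\{M\in\mathbb{N}: S(R_M)<s(|R_M|)\}$ has positive lower asymptotic density, i.e. $\liminf_{N\to\infty}\frac{1}{N}\#\{M\le N: S(R_M)<s(|R_M|)\}>0$.
   Context: For a positive integer $n$ and a subset $U\subseteq\mathbb{Z}_n$ of size $k\ge 2$, write its elements as integers $0\le u_1<\dots<u_k<n$, put $s_i=u_{i+1}-u_i$ ($1\le i\le k-1$), $s_k=u_1+n-u_k$, and $S(U)=\sum_{i=1}^k s_i^2$. For $U\subseteq\mathbb{Z}_M$, $s(k)$ denotes the average of $S(U)$ over all $k$-element subsets $U$ of $\mathbb{Z}_M$. $R_M=\{a^2:a\in\mathbb{Z}_M\}$ is the set of quadratic residues modulo $M$ (including $0$). *)

theory Defs
  imports "HOL-Analysis.Analysis"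
begin

text \<open>
  Subsets of \<open>\<int>\<^sub>n\<close> are represented by their sets of least nonnegative representatives, i.e. by
  subsets of \<open>{0..<n}\<close>. Indices start at 0, so \<open>cyclic_gap n U i\<close> is the spacing \<open>s\<^sub>i\<^sub>+\<^sub>1\<close>.
\<close>

definition cyclic_gap :: "nat \<Rightarrow> nat set \<Rightarrow> nat \<Rightarrow> int" where
  "cyclic_gap n U i =
     (let u = (\<lambda>j. int (sorted_list_of_set U ! j)); k = card U
      in if i < k - 1 then u (i + 1) - u i else u 0 + int n - u (k - 1))"

definition gap_square_sum :: "nat \<Rightarrow> nat set \<Rightarrow> int" where
  "gap_square_sum n U = (\<Sum>i<card U. (cyclic_gap n U i)\<^sup>2)"

definition avg_gap_square_sum :: "nat \<Rightarrow> nat \<Rightarrow> real" where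
  "avg_gap_square_sum n k =
     (\<Sum>U\<in>{U. U \<subseteq> {0..<n} \<and> card U = k}. real_of_int (gap_square_sum n U)) /
     real (card {U. U \<subseteq> {0..<n} \<and> card U = k})"

definition quad_residues :: "nat \<Rightarrow> nat set" where
  "quad_residues M = (\<lambda>a. a\<^sup>2 mod M) ` {0..<M}"

text \<open>The value at \<open>N = 0\<close> is irrelevant to the lower limit.\<close>

definition lower_density :: "nat set \<Rightarrow> ereal" where
  "lower_density A = liminf (\<lambda>N. ereal (real (card {M \<in> A. 1 \<le> M \<and> M \<le> N}) / real N))"

end

theory Submission
  imports Defs "HOL-Number_Theory.Number_Theory" "HOL-Computational_Algebra.Squarefree"
    "HOL-Real_Asymp.Real_Asymp"
begin

hide_const (open) UnivPoly.coeff UnivPoly.monom Module.smult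

text \<open>
  Let \<open>Z(L)\<close> be the number of \<open>x\<close> modulo \<open>M\<close> such that \<open>x + 1, \<dots>, x + L\<close> are all non-squares. Then
  \<open>S(R\<^sub>M) = 2 \<Sum>\<^sub>L Z(L) - M\<close>, and a double count gives \<open>s(k) = 2 M (M + 1) / (k + 1) - M\<close>, so the claim for
  \<open>M\<close> is \<open>\<Sum>\<^sub>L Z(L) < M (M + 1) / (k + 1)\<close> with \<open>k = |R\<^sub>M|\<close>.

  Put \<open>\<Lambda> = ln N\<close> and take \<open>M = q t \<le> N\<close> with \<open>3 \<le> q \<le> \<Lambda>\<^bsup>1/20\<^esup>\<close> and \<open>t\<close> squarefree whose number of prime
  factors is of order \<open>ln \<Lambda>\<close>, all of them larger than a high power of \<open>\<Lambda>\<close>. Modulo the primes of \<open>t\<close> squares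
  behave like independent coin tosses: the correlations are controlled by Weil's bound, proved by Stepanov's
  method. So \<open>R\<^sub>M\<close> is a random thinning, with probability \<open>\<alpha> = 2\<^bsup>-\<omega>(t)\<^esup>\<close>, of the periodic set \<open>R\<^sub>q\<close> of
  density \<open>e / q\<close>. A periodic set is more regular than a random one: averaging over the period gives
  \<open>\<Sum>\<^sub>L Z(L) / M \<approx> q / (e \<alpha>) - (q - e) / (2 e)\<close>, whereas a random set would give \<open>q / (e \<alpha>)\<close>. This gain
  survives because all errors are negative powers of \<open>\<Lambda>\<close>.

  For long windows the correlation estimates are useless. If \<open>x + 1, \<dots>, x + H\<close> are non-squares and \<open>b\<close> is a
  prime, then dividing by \<open>b\<close> yields windows of length about \<open>H / b\<close> free of \<open>b\<^sup>-\<^sup>1 R\<^sub>M\<close> near all the points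
  \<open>(x + k M) / b\<close>. For different \<open>b\<close> these are almost independent by a large sieve argument, hence long empty
  windows are so rare that their contribution to \<open>\<Sum>\<^sub>L Z(L)\<close> is negligible.

  Finally the family has positive lower density: writing \<open>t = a P\<close> with \<open>P\<close> the largest prime factor, the
  number of \<open>M\<close> is of order \<open>N / \<Lambda>\<close> times \<open>\<Sum> 1 / (q a)\<close>; here \<open>\<Sum> 1 / q\<close> is of order \<open>ln \<Lambda>\<close>, while \<open>\<Sum> 1 / a\<close>,
  over squarefree \<open>a\<close> without prime factors up to a power of \<open>\<Lambda>\<close>, is of order \<open>\<Lambda> / ln \<Lambda>\<close>.
\<close>

section \<open>Gaps and empty windows\<close>

definition free_windows :: "nat \<Rightarrow> nat set \<Rightarrow> nat \<Rightarrow> nat" where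
  "free_windows n U L = card {x\<in>{0..<n}. \<forall>i\<in>{1..L}. (x + i) mod n \<notin> U}"

definition free_run :: "nat \<Rightarrow> nat set \<Rightarrow> nat \<Rightarrow> nat" where
  "free_run n U x = card {L\<in>{..<n}. \<forall>i\<in>{1..L}. (x + i) mod n \<notin> U}"

lemma sum_free_windows_eq_sum_free_run:
  "(\<Sum>L<n. free_windows n U L) = (\<Sum>x\<in>{0..<n}. free_run n U x)"
  unfolding free_windows_def free_run_def by (rule sum_multicount_gen) auto

lemma free_run_add_period: "free_run n U (x + n) = free_run n U x"
proof -
  have "(x + n + i) mod n = (x + i) mod n" for i by (metis add.assoc add.commute mod_add_self2)
  then show ?thesis by (simp add: free_run_def)
qed

lemma free_run_eqI:
  assumes "0 < d" "d \<le> n" "(x + d) mod n \<in> U" "\<And>i. 1 \<le> i \<Longrightarrow> i < d \<Longrightarrow> (x + i) mod n \<notin> U"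
  shows "free_run n U x = d"
proof -
  have "{L\<in>{..<n}. \<forall>i\<in>{1..L}. (x + i) mod n \<notin> U} = {..<d}"
  proof (intro equalityI subsetI)
    fix L assume L: "L \<in> {L\<in>{..<n}. \<forall>i\<in>{1..L}. (x + i) mod n \<notin> U}"
    then have "d \<notin> {1..L}" using assms(3) by blast
    then show "L \<in> {..<d}" using assms(1) by auto
  qed (use assms in auto)
  then show ?thesis by (simp add: free_run_def)
qed

definition cyclic_nth :: "nat \<Rightarrow> nat set \<Rightarrow> nat \<Rightarrow> nat" where
  "cyclic_nth n U i =
     (if i < card U then sorted_list_of_set U ! i else sorted_list_of_set U ! 0 + n)"

context
  fixes n :: nat and U :: "nat set"
  assumes U: "U \<subseteq> {0..<n}" "U \<noteq> {}"
begin

lemma card_pos: "card U > 0"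
  using U by (simp add: card_gt_0_iff finite_subset)

lemma range_cyclic_nth: "cyclic_nth n U ` {..<card U} = U"
proof -
  have "cyclic_nth n U ` {..<card U} = set (sorted_list_of_set U)"
    by (auto simp: cyclic_nth_def in_set_conv_nth image_iff)
  also have "\<dots> = U" using U by (simp add: finite_subset)
  finally show ?thesis .
qed

lemma cyclic_nth_card: "cyclic_nth n U (card U) = cyclic_nth n U 0 + n"
  using card_pos by (simp add: cyclic_nth_def)

lemma cyclic_nth_in: "i < card U \<Longrightarrow> cyclic_nth n U i \<in> U"
  using range_cyclic_nth by auto

lemma cyclic_nth_less: "i < card U \<Longrightarrow> cyclic_nth n U i < n"
  using cyclic_nth_in[of i] U by auto

lemma strict_mono_on_cyclic_nth: "strict_mono_on {..card U} (cyclic_nth n U)"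
proof (rule strict_mono_onI)
  fix i j assume ij: "i \<in> {..card U}" "j \<in> {..card U}" "i < j"
  show "cyclic_nth n U i < cyclic_nth n U j"
  proof (cases "j < card U")
    case True
    then show ?thesis
      using ij U finite_subset[OF U(1)] by (simp add: cyclic_nth_def sorted_wrt_nth_less)
  next
    case False
    then have "j = card U" using ij by simp
    then show ?thesis using cyclic_nth_less[of i] cyclic_nth_card ij by simp
  qed
qed

lemma cyclic_nth_less_Suc: "i < card U \<Longrightarrow> cyclic_nth n U i < cyclic_nth n U (Suc i)"
  using strict_mono_on_cyclic_nth by (rule strict_mono_onD) auto

lemma cyclic_nth_mod_in: "i \<le> card U \<Longrightarrow> cyclic_nth n U i mod n \<in> U"
  using cyclic_nth_in[of i] cyclic_nth_less[of i] cyclic_nth_in[of 0] cyclic_nth_less[of 0]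
    cyclic_nth_card card_pos by (cases "i = card U") auto

lemma between_cyclic_nth_notin:
  assumes i: "i < card U" and v: "cyclic_nth n U i < v" "v < cyclic_nth n U (Suc i)"
  shows "v mod n \<notin> U"
proof
  assume "v mod n \<in> U"
  then obtain j where j: "j < card U" "cyclic_nth n U j = v mod n" using range_cyclic_nth by force
  have less_iff: "cyclic_nth n U a < cyclic_nth n U b \<longleftrightarrow> a < b" if "a \<le> card U" "b \<le> card U" for a b
    using strict_mono_on_less[OF strict_mono_on_cyclic_nth] that by simp
  show False
  proof (cases "v < n")
    case True
    then have "i < j" "j < Suc i" using less_iff[of i j] less_iff[of j "Suc i"] i j v by auto
    then show False by simp
  next
    case False
    have "cyclic_nth n U (Suc i) \<le> cyclic_nth n U 0 + n"
      using less_iff[of "card U" "Suc i"] i cyclic_nth_card by linarith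
    then have "v < cyclic_nth n U 0 + n" using v by linarith
    moreover have "v mod n = v - n"
      using False calculation cyclic_nth_less[OF card_pos] by (simp add: le_mod_geq)
    ultimately have "cyclic_nth n U j < cyclic_nth n U 0" using False j by linarith
    then show False using less_iff[of j 0] j by simp
  qed
qed

lemma free_run_between_cyclic_nth:
  assumes i: "i < card U" and x: "x \<in> {cyclic_nth n U i..<cyclic_nth n U (Suc i)}"
  shows "free_run n U x = cyclic_nth n U (Suc i) - x"
proof (rule free_run_eqI)
  show "0 < cyclic_nth n U (Suc i) - x" using x by simp
  show "cyclic_nth n U (Suc i) - x \<le> n"
  proof (cases "Suc i < card U")
    case True
    then show ?thesis using cyclic_nth_less[of "Suc i"] by simp
  next
    case False
    then have "Suc i = card U" using i by simp
    then have "cyclic_nth n U (Suc i) = cyclic_nth n U 0 + n" by (simp only: cyclic_nth_card)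
    moreover have "cyclic_nth n U 0 \<le> cyclic_nth n U i"
      using i by (intro strict_mono_on_leD[OF strict_mono_on_cyclic_nth]) auto
    ultimately show ?thesis using x by auto
  qed
  show "(x + (cyclic_nth n U (Suc i) - x)) mod n \<in> U" using x cyclic_nth_mod_in[of "Suc i"] i by simp
  show "(x + j) mod n \<notin> U" if "1 \<le> j" "j < cyclic_nth n U (Suc i) - x" for j
    using that x by (intro between_cyclic_nth_notin[OF i]) auto
qed

lemma cyclic_gap_eq_cyclic_nth:
  assumes "i < card U"
  shows "cyclic_gap n U i = int (cyclic_nth n U (Suc i)) - int (cyclic_nth n U i)"
proof (cases "Suc i < card U")
  case True
  then show ?thesis using less_diff_conv[of i "card U" 1] by (simp add: cyclic_gap_def cyclic_nth_def Let_def)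
next
  case False
  then have "i = card U - 1" using assms by simp
  then show ?thesis using card_pos by (simp add: cyclic_gap_def cyclic_nth_def)
qed

lemma sum_cyclic_gap: "(\<Sum>i<card U. cyclic_gap n U i) = int n"
  using sum_lessThan_telescope[of "\<lambda>i. int (cyclic_nth n U i)" "card U"]
  by (simp add: cyclic_gap_eq_cyclic_nth cyclic_nth_card)

end

lemma sum_consecutive_intervals:
  fixes u :: "nat \<Rightarrow> nat" and f :: "nat \<Rightarrow> 'a :: comm_monoid_add"
  assumes "\<And>i. i < m \<Longrightarrow> u i \<le> u (Suc i)"
  shows "(\<Sum>i<m. \<Sum>x\<in>{u i..<u (Suc i)}. f x) = (\<Sum>x\<in>{u 0..<u m}. f x)"
  using assms
proof (induction m)
  case (Suc m)
  have "u 0 \<le> u i" if "i \<le> m" for i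
    using that by (induction i) (use Suc.prems in \<open>auto intro: order_trans\<close>)
  then have "u 0 \<le> u m" by simp
  then show ?case using Suc by (simp add: sum.atLeastLessThan_concat)
qed simp

lemma sum_nat_period:
  fixes f :: "nat \<Rightarrow> 'a :: comm_monoid_add"
  assumes "\<And>x. f (x + n) = f x"
  shows "(\<Sum>x\<in>{a..<a + n}. f x) = (\<Sum>x\<in>{0..<n}. f x)"
proof (induction a)
  case (Suc a)
  have "(\<Sum>x\<in>{Suc a..<Suc a + n}. f x) = (\<Sum>x\<in>{a..<a + n}. f x)"
  proof (cases "n = 0")
    case False
    then show ?thesis
      using assms[of a] sum.atLeast_Suc_lessThan[of a "a + n" f] by (simp add: add.commute)
  qed simp
  then show ?case using Suc by simp
qed simp

lemma two_times_sum_countdown: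
  fixes a b :: nat
  assumes "a \<le> b"
  shows "2 * (\<Sum>x\<in>{a..<b}. int b - int x) = (int b - int a)\<^sup>2 + (int b - int a)"
  using assms
proof (induction a rule: inc_induct)
  case (step a)
  have "(\<Sum>x\<in>{a..<b}. int b - int x) = (int b - int a) + (\<Sum>x\<in>{Suc a..<b}. int b - int x)"
    using step.hyps by (intro sum.atLeast_Suc_lessThan)
  then show ?case using step.IH by (simp add: power2_eq_square algebra_simps)
qed simp

lemma gap_square_sum_eq_free_windows:
  assumes U: "U \<subseteq> {0..<n}" "U \<noteq> {}"
  shows "gap_square_sum n U = 2 * int (\<Sum>L<n. free_windows n U L) - int n"
proof -
  let ?u = "cyclic_nth n U"
  have "(\<Sum>L<n. free_windows n U L) = (\<Sum>x\<in>{?u 0..<?u (card U)}. free_run n U x)"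
    by (simp add: sum_free_windows_eq_sum_free_run sum_nat_period free_run_add_period cyclic_nth_card[OF U])
  also have "\<dots> = (\<Sum>i<card U. \<Sum>x\<in>{?u i..<?u (Suc i)}. free_run n U x)"
    by (intro sum_consecutive_intervals[symmetric] less_imp_le cyclic_nth_less_Suc[OF U])
  also have "\<dots> = (\<Sum>i<card U. \<Sum>x\<in>{?u i..<?u (Suc i)}. ?u (Suc i) - x)"
    using free_run_between_cyclic_nth[OF U] by simp
  finally have "2 * int (\<Sum>L<n. free_windows n U L) = (\<Sum>i<card U. 2 * (\<Sum>x\<in>{?u i..<?u (Suc i)}. int (?u (Suc i)) - int x))"
    by (simp add: sum_distrib_left of_nat_diff)
  also have "\<dots> = (\<Sum>i<card U. (cyclic_gap n U i)\<^sup>2 + cyclic_gap n U i)"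
    using cyclic_nth_less_Suc[OF U]
    by (intro sum.cong refl)
      (simp only: two_times_sum_countdown cyclic_gap_eq_cyclic_nth[OF U] less_imp_le lessThan_iff)
  also have "\<dots> = gap_square_sum n U + int n"
    by (simp add: sum.distrib sum_cyclic_gap[OF U] gap_square_sum_def)
  finally show ?thesis by simp
qed

lemma card_subsets_free_window:
  assumes L: "L \<le> n" and x: "x \<in> {0..<n}"
  shows "card {U\<in>{U. U \<subseteq> {0..<n} \<and> card U = k}. \<forall>i\<in>{1..L}. (x + i) mod n \<notin> U} = (n - L) choose k"
proof -
  define W where "W = (\<lambda>i. (x + i) mod n) ` {1..L}"
  have "inj_on (\<lambda>i. (x + i) mod n) {1..L}"
  proof (rule inj_onI)
    fix i j assume ij: "i \<in> {1..L}" "j \<in> {1..L}" "(x + i) mod n = (x + j) mod n"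
    then have "[i - 1 = j - 1] (mod n)"
      using cong_add_lcancel_nat[of "x + 1" "i - 1" "j - 1" n] by (simp add: cong_def)
    then have "i - 1 = j - 1" using ij L by (intro cong_less_imp_eq_nat[of _ n]) auto
    then show "i = j" using ij by auto
  qed
  then have "card W = L" by (simp add: W_def card_image)
  moreover have "W \<subseteq> {0..<n}" using x by (auto simp: W_def)
  ultimately have "card ({0..<n} - W) = n - L" by (simp add: card_Diff_subset finite_subset)
  moreover have "{U\<in>{U. U \<subseteq> {0..<n} \<and> card U = k}. \<forall>i\<in>{1..L}. (x + i) mod n \<notin> U} = {U. U \<subseteq> {0..<n} - W \<and> card U = k}"
    by (auto simp: W_def)
  ultimately show ?thesis by (simp add: n_subsets)
qed

lemma sum_free_windows_over_subsets:
  assumes "L \<le> n"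
  shows "(\<Sum>U\<in>{U. U \<subseteq> {0..<n} \<and> card U = k}. free_windows n U L) = n * ((n - L) choose k)"
proof -
  have "finite {U. U \<subseteq> {0..<n} \<and> card U = k}" by (rule finite_subset[of _ "Pow {0..<n}"]) auto
  then have "(\<Sum>U\<in>{U. U \<subseteq> {0..<n} \<and> card U = k}. free_windows n U L) = ((n - L) choose k) * card {0..<n}"
    unfolding free_windows_def using card_subsets_free_window[OF assms]
    by (intro sum_multicount) auto
  then show ?thesis by simp
qed

lemma sum_choose_countdown:
  assumes "1 \<le> k"
  shows "(\<Sum>L<n. (n - L) choose k) = Suc n choose Suc k"
proof -
  have "(\<Sum>L<n. (n - L) choose k) = (\<Sum>j\<in>{1..n}. j choose k)"
    by (rule sum.reindex_bij_witness[of _ "\<lambda>j. n - j" "\<lambda>L. n - L"]) auto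
  also have "\<dots> = (\<Sum>j\<le>n. j choose k)" using assms by (intro sum.mono_neutral_left) auto
  also have "\<dots> = Suc n choose Suc k" by (rule sum_choose_upper)
  finally show ?thesis .
qed

lemma avg_gap_square_sum_eq:
  assumes "1 \<le> k" "k \<le> n"
  shows "avg_gap_square_sum n k = 2 * real n * (real n + 1) / (real k + 1) - real n"
proof -
  let ?C = "{U. U \<subseteq> {0..<n} \<and> card U = k}"
  have card_C: "card ?C = n choose k" using n_subsets[of "{0..<n}" k] by simp
  have "(\<Sum>U\<in>?C. \<Sum>L<n. free_windows n U L) = (\<Sum>L<n. n * ((n - L) choose k))"
    by (subst sum.swap) (simp add: sum_free_windows_over_subsets)
  also have "\<dots> = n * (Suc n choose Suc k)"
    using assms(1) by (simp add: sum_distrib_left[symmetric] sum_choose_countdown del: binomial_Suc_Suc)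
  finally have windows: "(\<Sum>U\<in>?C. \<Sum>L<n. free_windows n U L) = n * (Suc n choose Suc k)" .
  have "(\<Sum>U\<in>?C. real_of_int (gap_square_sum n U)) = (\<Sum>U\<in>?C. 2 * real (\<Sum>L<n. free_windows n U L) - real n)"
  proof (intro sum.cong refl)
    fix U assume "U \<in> ?C"
    then have "U \<subseteq> {0..<n}" "U \<noteq> {}" using assms(1) by auto
    from gap_square_sum_eq_free_windows[OF this]
    show "real_of_int (gap_square_sum n U) = 2 * real (\<Sum>L<n. free_windows n U L) - real n" by simp
  qed
  also have "\<dots> = 2 * real (\<Sum>U\<in>?C. \<Sum>L<n. free_windows n U L) - real n * (n choose k)"
    by (simp add: sum_subtractf sum_distrib_left card_C)
  also have "\<dots> = 2 * real n * real (Suc n choose Suc k) - real n * (n choose k)"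
    unfolding windows by simp
  also have "real (Suc n choose Suc k) = (real n + 1) / (real k + 1) * real (n choose k)"
    using arg_cong[OF Suc_times_binomial_eq[of n k], of real]
    by (simp add: field_simps del: binomial_Suc_Suc)
  finally have "avg_gap_square_sum n k =
      (2 * real n * ((real n + 1) / (real k + 1) * real (n choose k)) - real n * (n choose k)) / (n choose k)"
    unfolding avg_gap_square_sum_def card_C by simp
  then show ?thesis using assms(2) by (simp add: diff_divide_distrib)
qed

lemma gap_square_sum_less_avg_iff:
  assumes "U \<subseteq> {0..<n}" "U \<noteq> {}"
  shows "real_of_int (gap_square_sum n U) < avg_gap_square_sum n (card U) \<longleftrightarrow>
     real (\<Sum>L<n. free_windows n U L) < real n * (real n + 1) / (real (card U) + 1)"
proof -
  have "1 \<le> card U" "card U \<le> n"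
    using card_pos[OF assms] card_mono[OF _ assms(1)] by auto
  then show ?thesis
    by (simp add: avg_gap_square_sum_eq gap_square_sum_eq_free_windows[OF assms] mult.assoc flip: times_divide_eq_right)
qed

section \<open>A large sieve for dilates\<close>

definition addchar :: "int \<Rightarrow> int \<Rightarrow> complex" where
  "addchar M t = cis (2 * pi * of_int t / of_int M)"

lemma addchar_add: "addchar M (s + t) = addchar M s * addchar M t"
  by (simp add: addchar_def cis_mult add_divide_distrib ring_distribs)

lemma addchar_0 [simp]: "addchar M 0 = 1"
  by (simp add: addchar_def)

lemma norm_addchar [simp]: "cmod (addchar M t) = 1"
  by (simp add: addchar_def)

lemma cnj_addchar: "cnj (addchar M t) = addchar M (-t)"
  by (simp add: addchar_def cis_cnj)

lemma addchar_eq_1_iff: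
  assumes "M > 0" shows "addchar M t = 1 \<longleftrightarrow> M dvd t"
proof
  assume "addchar M t = 1"
  then have "cos (2 * pi * of_int t / of_int M) = 1"
    by (simp add: addchar_def complex_eq_iff)
  then obtain n :: int where "2 * pi * of_int t / of_int M = of_int n * 2 * pi"
    by (auto simp: cos_one_2pi_int)
  then have "real_of_int t = of_int (n * M)" using assms by (simp add: field_simps)
  then show "M dvd t" by (metis dvd_triv_right of_int_eq_iff)
next
  assume "M dvd t"
  then obtain n where "t = M * n" by blast
  then have "addchar M t = cis (2 * pi * of_int n)" using assms by (simp add: addchar_def field_simps)
  then show "addchar M t = 1" by simp
qed

lemma addchar_cong:
  assumes "M > 0" "[s = t] (mod M)" shows "addchar M s = addchar M t"
proof -
  have "addchar M (s - t) = 1" using assms by (simp add: addchar_eq_1_iff cong_iff_dvd_diff)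
  then show ?thesis using addchar_add[of M "s - t" t] by simp
qed

lemma addchar_mult_nat: "addchar M (t * int n) = addchar M t ^ n"
  by (induction n) (simp_all add: addchar_add ring_distribs)

definition expsum :: "int \<Rightarrow> int set \<Rightarrow> int \<Rightarrow> complex" where
  "expsum M X t = (\<Sum>x\<in>X. addchar M (t * x))"

lemma expsum_0 [simp]: "expsum M X 0 = of_nat (card X)"
  by (simp add: expsum_def)

lemma expsum_cong: "M > 0 \<Longrightarrow> [s = t] (mod M) \<Longrightarrow> expsum M X s = expsum M X t"
  unfolding expsum_def by (intro sum.cong refl addchar_cong cong_mult) auto

lemma expsum_mod: "M > 0 \<Longrightarrow> expsum M X (t mod M) = expsum M X t"
  by (rule expsum_cong) simp_all

lemma norm_expsum_minus: "cmod (expsum M X (- t)) = cmod (expsum M X t)"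
proof -
  have "expsum M X (- t) = cnj (expsum M X t)" by (simp add: expsum_def cnj_addchar)
  then show ?thesis by simp
qed

lemma norm_expsum_le_card: "cmod (expsum M X t) \<le> card X"
  unfolding expsum_def by (rule order_trans[OF norm_sum]) simp

lemma expsum_interval: "expsum M {0..<int h} t = (\<Sum>s<h. addchar M t ^ s)"
  unfolding expsum_def
  by (rule sum.reindex_bij_witness[of _ int nat]) (auto simp: addchar_mult_nat[symmetric])

lemma expsum_complete_residues:
  assumes "M > 0"
  shows "expsum M {0..<M} t = (if M dvd t then of_int M else 0)"
proof -
  obtain n where n: "M = int n" "n > 0" using assms by (metis pos_int_cases)
  have "addchar M t ^ n = 1"
    using assms by (simp add: addchar_mult_nat[symmetric] addchar_eq_1_iff n)
  then show ?thesis
    using assms expsum_interval[of M n t] by (auto simp: n addchar_eq_1_iff sum_gp_strict)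
qed

lemma norm_expsum_complement:
  assumes "M > 0" "D \<subseteq> {0..<M}" "\<not> M dvd t"
  shows "cmod (expsum M ({0..<M} - D) t) = cmod (expsum M D t)"
proof -
  have "expsum M ({0..<M} - D) t = expsum M {0..<M} t - expsum M D t"
    unfolding expsum_def using assms(2) by (intro sum_diff) auto
  then show ?thesis using assms by (simp add: expsum_complete_residues)
qed

lemma expsum_parseval:
  assumes "M > 0" "X \<subseteq> {0..<M}"
  shows "(\<Sum>\<xi>\<in>{0..<M}. (cmod (expsum M X \<xi>))\<^sup>2) = real_of_int M * real (card X)"
proof -
  have fin: "finite X" using assms finite_subset by blast
  have "complex_of_real (\<Sum>\<xi>\<in>{0..<M}. (cmod (expsum M X \<xi>))\<^sup>2)
      = (\<Sum>\<xi>\<in>{0..<M}. expsum M X \<xi> * cnj (expsum M X \<xi>))"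
    by (simp only: of_real_sum complex_norm_square)
  also have "\<dots> = (\<Sum>\<xi>\<in>{0..<M}. \<Sum>x\<in>X. \<Sum>y\<in>X. addchar M ((x - y) * \<xi>))"
    by (simp add: expsum_def sum_product cnj_addchar addchar_add[symmetric] algebra_simps)
  also have "\<dots> = (\<Sum>x\<in>X. \<Sum>y\<in>X. expsum M {0..<M} (x - y))"
    unfolding expsum_def by (subst sum.swap, rule sum.cong[OF refl], rule sum.swap)
  also have "\<dots> = (\<Sum>x\<in>X. \<Sum>y\<in>X. if x = y then of_int M else 0)"
  proof (intro sum.cong refl)
    fix x y assume "x \<in> X" "y \<in> X"
    then have "0 \<le> x" "x < M" "0 \<le> y" "y < M" using assms(2) by auto
    then have "M dvd x - y \<longleftrightarrow> x = y"
      using cong_less_imp_eq_int[of x M y] by (auto simp: cong_iff_dvd_diff)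
    then show "expsum M {0..<M} (x - y) = (if x = y then of_int M else 0)"
      by (simp add: expsum_complete_residues[OF assms(1)])
  qed
  also have "\<dots> = complex_of_real (real_of_int M * real (card X))" using fin by simp
  finally show ?thesis by (simp only: of_real_eq_iff)
qed

lemma expsum_parseval_nonzero_le:
  assumes "M > 0" "X \<subseteq> {0..<M}"
  shows "(\<Sum>\<xi>\<in>{1..<M}. (cmod (expsum M X \<xi>))\<^sup>2) \<le> real_of_int M * real (card X)"
  unfolding expsum_parseval[OF assms, symmetric] by (intro sum_mono2) auto

lemma sin_ge_chord:
  assumes "0 \<le> x" "x \<le> pi / 2" shows "2 / pi * x \<le> sin x"
proof -
  have "convex_on {0..pi/2} (\<lambda>x. - sin x)"
    by (rule f''_ge0_imp_convex[where f' = "\<lambda>x. - cos x" and f'' = sin])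
       (auto intro!: derivative_eq_intros sin_ge_zero)
  moreover have "2 / pi * x \<le> 1" using assms by (simp add: field_simps)
  ultimately show ?thesis
    using convex_onD[of "{0..pi/2}" "\<lambda>x. - sin x" "2 / pi * x" 0 "pi/2"] assms by simp
qed

lemma norm_one_minus_cis: "cmod (1 - cis t) = 2 * \<bar>sin (t / 2)\<bar>"
proof -
  have "(cmod (1 - cis t))\<^sup>2 = (1 - cos t)\<^sup>2 + (sin t)\<^sup>2"
    by (simp add: cmod_def cis.code power2_eq_square)
  also have "\<dots> = 2 - 2 * cos (2 * (t / 2))"
    using sin_cos_squared_add[of t] by (simp add: power2_eq_square algebra_simps)
  also have "\<dots> = (2 * \<bar>sin (t / 2)\<bar>)\<^sup>2"
    unfolding cos_double_sin by (simp add: power_mult_distrib)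
  finally show ?thesis by (rule power2_eq_imp_eq) simp_all
qed

lemma norm_one_minus_addchar:
  assumes "M > 0" "2 * \<bar>\<xi>\<bar> \<le> M"
  shows "cmod (1 - addchar M \<xi>) \<ge> 4 * \<bar>real_of_int \<xi>\<bar> / M"
proof -
  define x where "x = pi * \<bar>real_of_int \<xi>\<bar> / M"
  have "2 * \<bar>real_of_int \<xi>\<bar> \<le> real_of_int M" using assms(2) by linarith
  then have "pi * (2 * \<bar>real_of_int \<xi>\<bar>) \<le> pi * real_of_int M" by (intro mult_left_mono) auto
  then have x: "0 \<le> x" "x \<le> pi / 2" using assms(1) by (simp_all add: x_def field_simps)
  have "4 * \<bar>real_of_int \<xi>\<bar> / M = 2 * (2 / pi * x)" using assms(1) by (simp add: x_def)
  also have "\<dots> \<le> 2 * \<bar>sin x\<bar>" using sin_ge_chord[OF x] by simp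
  also have "\<bar>sin x\<bar> = \<bar>sin (pi * real_of_int \<xi> / M)\<bar>"
    by (cases "\<xi> \<ge> 0") (simp_all add: x_def)
  also have "2 * \<dots> = cmod (1 - addchar M \<xi>)" by (simp add: addchar_def norm_one_minus_cis)
  finally show ?thesis .
qed

lemma norm_expsum_interval_le:
  assumes "M > 0" "2 * \<bar>\<xi>\<bar> \<le> M" "\<xi> \<noteq> 0"
  shows "cmod (expsum M {0..<int h} \<xi>) \<le> M / (2 * \<bar>real_of_int \<xi>\<bar>)"
proof -
  let ?w = "addchar M \<xi>"
  have lower: "cmod (1 - ?w) \<ge> 4 * \<bar>real_of_int \<xi>\<bar> / M" by (rule norm_one_minus_addchar[OF assms(1,2)])
  have pos: "4 * \<bar>real_of_int \<xi>\<bar> / M > 0" using assms by simp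
  then have "?w \<noteq> 1" using lower by force
  then have "cmod (expsum M {0..<int h} \<xi>) = cmod (1 - ?w ^ h) / cmod (1 - ?w)"
    by (simp add: expsum_interval sum_gp_strict norm_divide)
  also have "\<dots> \<le> 2 / (4 * \<bar>real_of_int \<xi>\<bar> / M)"
  proof (rule frac_le)
    show "cmod (1 - ?w ^ h) \<le> 2"
      using norm_triangle_ineq4[of 1 "?w ^ h"] by (simp add: norm_power)
  qed (use lower pos in auto)
  also have "\<dots> = M / (2 * \<bar>real_of_int \<xi>\<bar>)" using assms by (simp add: field_simps)
  finally show ?thesis .
qed

lemma card_prime_factors_le_log:
  fixes n :: nat
  assumes "n > 0"
  shows "real (card (prime_factors n)) \<le> log 2 n"
proof -
  have "2 ^ card (prime_factors n) = (\<Prod>p\<in>prime_factors n. 2)" by simp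
  also have "\<dots> \<le> (\<Prod>p\<in>prime_factors n. p ^ multiplicity p n)"
  proof (intro prod_mono conjI)
    fix p assume "p \<in> prime_factors n"
    then have "2 \<le> p" "multiplicity p n > 0" by (auto simp: prime_factors_multiplicity prime_ge_2_nat)
    then show "2 \<le> p ^ multiplicity p n" using self_le_power[of p "multiplicity p n"] by simp
  qed simp
  also have "\<dots> = n" using prod_prime_factors[of n] assms by simp
  finally have "(2::real) ^ card (prime_factors n) \<le> n"
    by (metis of_nat_le_iff of_nat_numeral of_nat_power)
  then have "log 2 (2 ^ card (prime_factors n)) \<le> log 2 n" by (intro log_mono) auto
  then show ?thesis by simp
qed

lemma card_primes_dvd_le_log:
  assumes "m \<noteq> 0" "\<bar>real_of_int m\<bar> \<le> X" "\<And>p. p \<in> A \<Longrightarrow> prime p \<and> int p dvd m"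
  shows "real (card A) \<le> log 2 X"
proof -
  have pos: "nat \<bar>m\<bar> > 0" using assms(1) by simp
  have "int p dvd \<bar>m\<bar> \<longleftrightarrow> p dvd nat \<bar>m\<bar>" for p by (metis abs_ge_zero int_dvd_int_iff int_nat_eq)
  then have "A \<subseteq> prime_factors (nat \<bar>m\<bar>)"
    using assms(3) pos by (force simp: prime_factors_dvd)
  then have "real (card A) \<le> card (prime_factors (nat \<bar>m\<bar>))" by (simp add: card_mono)
  also have "\<dots> \<le> log 2 (nat \<bar>m\<bar>)" by (rule card_prime_factors_le_log[OF pos])
  also have "\<dots> \<le> log 2 X" using assms(1,2) by (intro log_mono) auto
  finally show ?thesis .
qed

lemma sum_inverse_squares_le_2: "(\<Sum>w\<in>{1..n}. 1 / (real w)\<^sup>2) \<le> 2"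
proof (cases "n = 0")
  case False
  then have "n \<ge> 1" by simp
  then have "(\<Sum>w\<in>{1..n}. 1 / (real w)\<^sup>2) \<le> 2 - 1 / real n"
  proof (induction n rule: nat_induct_at_least)
    case (Suc n)
    then have n: "real n \<ge> 1" by simp
    have "1 / (real n + 1)\<^sup>2 \<le> 1 / (real n * (real n + 1))"
      using n by (intro divide_left_mono) (auto simp: power2_eq_square)
    also have "\<dots> = 1 / real n - 1 / (real n + 1)" using n by (simp add: field_simps)
    finally show ?case using Suc.IH by (simp add: add.commute)
  qed simp
  moreover have "0 \<le> 1 / real n" by simp
  ultimately show ?thesis by linarith
qed simp

definition inverse_square :: "int \<Rightarrow> real" where
  "inverse_square l = (if l = 0 then 1 else 1 / (real_of_int l)\<^sup>2)"

lemma sum_inverse_square_symmetric_le: "(\<Sum>l\<in>{-int B..int B}. inverse_square l) \<le> 5"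
proof -
  have "(\<Sum>l\<in>{-int B..int B}. inverse_square l) = 1 + 2 * (\<Sum>w\<in>{1..B}. 1 / (real w)\<^sup>2)"
  proof (induction B)
    case (Suc B)
    have "{-int (Suc B)..int (Suc B)} = insert (int (Suc B)) (insert (- int (Suc B)) {-int B..int B})" by auto
    then show ?case using Suc by (simp add: inverse_square_def power2_eq_square algebra_simps)
  qed (simp add: inverse_square_def)
  then show ?thesis using sum_inverse_squares_le_2[of B] by simp
qed

lemma symmetric_representative:
  assumes "(M::int) > 0" "\<not> M dvd x"
  obtains x' where "[x' = x] (mod M)" "x' \<noteq> 0" "2 * \<bar>x'\<bar> \<le> M"
proof -
  define r where "r = x mod M"
  have r: "0 \<le> r" "r < M" "r \<noteq> 0" using assms by (auto simp: r_def dvd_eq_mod_eq_0)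
  show ?thesis
  proof (cases "2 * r \<le> M")
    case True
    then show ?thesis using r by (intro that[of r]) (auto simp: r_def)
  next
    case False
    have "[r - M = x] (mod M)" by (simp add: r_def cong_def)
    then show ?thesis using r False by (intro that[of "r - M"]) auto
  qed
qed

lemma dilated_quotient_bound:
  fixes M \<nu> \<xi> l :: int and b B :: nat
  assumes M: "M > 0" and b: "0 < b" "b \<le> B"
    and eq: "int b * \<xi> = \<nu> + l * M" and small: "2 * \<bar>\<nu>\<bar> \<le> M" "2 * \<bar>\<xi>\<bar> \<le> M"
  shows "\<bar>l\<bar> \<le> int B"
proof -
  have "\<bar>l\<bar> * M = \<bar>int b * \<xi> - \<nu>\<bar>" using eq M by (simp add: abs_mult)
  also have "\<dots> \<le> int b * \<bar>\<xi>\<bar> + \<bar>\<nu>\<bar>" using abs_triangle_ineq4[of "int b * \<xi>" \<nu>] by (simp add: abs_mult)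
  finally have "2 * (\<bar>l\<bar> * M) \<le> int b * (2 * \<bar>\<xi>\<bar>) + 2 * \<bar>\<nu>\<bar>" by simp
  also have "int b * (2 * \<bar>\<xi>\<bar>) \<le> int B * M" using b small by (intro mult_mono) auto
  also note small(1)
  finally have "(2 * \<bar>l\<bar>) * M \<le> (int B + 1) * M" by (simp add: algebra_simps)
  then show ?thesis using M b by simp
qed

lemma norm_expsum_interval_dilated_le:
  fixes M \<nu> \<xi> l :: int and b B h :: nat
  assumes M: "M > 0" and b: "b \<le> B" "B \<le> h"
    and eq: "int b * \<xi> = \<nu> + l * M" and small: "2 * \<bar>\<nu>\<bar> \<le> M" "2 * \<bar>\<xi>\<bar> \<le> M" and "\<xi> \<noteq> 0"
  shows "(cmod (expsum M {0..<int h} \<xi>))\<^sup>2 \<le> (real h)\<^sup>2 * inverse_square l"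
proof (cases "l = 0")
  case True
  then show ?thesis using norm_expsum_le_card[of M "{0..<int h}" \<xi>] by (simp add: inverse_square_def power_mono)
next
  case False
  have "\<bar>l\<bar> * M - \<bar>\<nu>\<bar> \<le> \<bar>int b * \<xi>\<bar>"
    using eq M abs_triangle_ineq2[of "l * M" "- \<nu>"] by (simp add: abs_mult add.commute)
  moreover have "M \<le> \<bar>l\<bar> * M" using False M by simp
  ultimately have "\<bar>l\<bar> * M \<le> 2 * (int b * \<bar>\<xi>\<bar>)" using small(1) by (simp add: abs_mult)
  also have "\<dots> \<le> 2 * (int h * \<bar>\<xi>\<bar>)" using b by (intro mult_left_mono mult_right_mono) auto
  finally have "real_of_int (\<bar>l\<bar> * M) \<le> real_of_int (2 * (int h * \<bar>\<xi>\<bar>))" by (simp only: of_int_le_iff)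
  then have "M / (2 * \<bar>real_of_int \<xi>\<bar>) \<le> real h / \<bar>real_of_int l\<bar>"
    using False \<open>\<xi> \<noteq> 0\<close> by (simp add: field_simps)
  with norm_expsum_interval_le[OF M small(2) \<open>\<xi> \<noteq> 0\<close>, of h]
  have "cmod (expsum M {0..<int h} \<xi>) \<le> real h / \<bar>real_of_int l\<bar>" by (rule order_trans)
  then have "(cmod (expsum M {0..<int h} \<xi>))\<^sup>2 \<le> (real h / \<bar>real_of_int l\<bar>)\<^sup>2" by (intro power_mono) auto
  then show ?thesis using False by (simp add: inverse_square_def power_divide)
qed

definition sieve_log :: "nat \<Rightarrow> int \<Rightarrow> real" where
  "sieve_log B M = log 2 ((real B + 1) * M)"

lemma sieve_log_nonneg: "M > 0 \<Longrightarrow> 0 \<le> sieve_log B M"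
  using mult_mono[of 1 "real B + 1" 1 "real_of_int M"] by (simp add: sieve_log_def)

lemma card_primes_dvd_progression_le:
  assumes "\<And>b. b \<in> A \<Longrightarrow> prime b \<and> int b dvd \<nu> + l * M"
    and "\<nu> + l * M \<noteq> 0" "2 * \<bar>\<nu>\<bar> \<le> M" "M > 0" "\<bar>l\<bar> \<le> int B"
  shows "real (card A) \<le> sieve_log B M"
proof -
  have "\<bar>\<nu> + l * M\<bar> \<le> \<bar>\<nu>\<bar> + \<bar>l\<bar> * M" using abs_triangle_ineq[of \<nu> "l * M"] assms(4) by (simp add: abs_mult)
  also have "\<dots> \<le> M + int B * M" using assms by (intro add_mono mult_right_mono) auto
  finally have "real_of_int \<bar>\<nu> + l * M\<bar> \<le> real_of_int ((int B + 1) * M)"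
    by (simp only: of_int_le_iff) (simp add: algebra_simps)
  then have "\<bar>real_of_int (\<nu> + l * M)\<bar> \<le> (real B + 1) * M" by simp
  from card_primes_dvd_le_log[OF assms(2) this assms(1)] show ?thesis by (simp add: sieve_log_def)
qed

text \<open>Each integer \<open>\<nu> + l M\<close> has few prime divisors, so few primes \<open>b\<close> admit a small solution of \<open>b \<xi> \<equiv> \<nu>\<close>.\<close>

lemma sum_norm_expsum_interval_small_dilated_le:
  fixes M \<nu> :: int and \<xi> l :: "nat \<Rightarrow> int" and \<B> :: "nat set" and B h :: nat
  assumes M: "M > 0" and \<B>: "finite \<B>" "\<And>b. b \<in> \<B> \<Longrightarrow> prime b \<and> b \<le> B" and B: "B \<le> h"
    and \<nu>: "2 * \<bar>\<nu>\<bar> \<le> M"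
    and \<xi>: "\<And>b. b \<in> \<B> \<Longrightarrow> int b * \<xi> b = \<nu> + l b * M \<and> \<xi> b \<noteq> 0 \<and> 2 * \<bar>\<xi> b\<bar> \<le> M"
  shows "(\<Sum>b\<in>\<B>. (cmod (expsum M {0..<int h} (\<xi> b)))\<^sup>2) \<le> (real h)\<^sup>2 * (5 * sieve_log B M)"
proof -
  have l_bound: "\<bar>l b\<bar> \<le> int B" if "b \<in> \<B>" for b
    using dilated_quotient_bound[OF M] \<xi>[OF that] \<B>(2)[OF that] \<nu> prime_gt_0_nat by blast
  have card_fibre: "real (card {b\<in>\<B>. l b = k}) \<le> sieve_log B M" for k
  proof (cases "{b\<in>\<B>. l b = k} = {}")
    case True
    then show ?thesis using sieve_log_nonneg[OF M] by (simp only: card.empty of_nat_0)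
  next
    case False
    then obtain b where b: "b \<in> \<B>" "l b = k" by blast
    show ?thesis
    proof (rule card_primes_dvd_progression_le[OF _ _ \<nu> M])
      have "int b * \<xi> b \<noteq> 0" using \<xi>[OF b(1)] \<B>(2)[OF b(1)] by (auto simp: prime_gt_0_nat)
      then show "\<nu> + k * M \<noteq> 0" using \<xi>[OF b(1)] b(2) by simp
      show "\<bar>k\<bar> \<le> int B" using l_bound b by blast
      fix b' assume b': "b' \<in> {b\<in>\<B>. l b = k}"
      then have "\<nu> + k * M = int b' * \<xi> b'" using \<xi>[of b'] by simp
      then show "prime b' \<and> int b' dvd \<nu> + k * M" using b' \<B>(2) by simp
    qed
  qed
  have "(\<Sum>b\<in>\<B>. inverse_square (l b)) = (\<Sum>k\<in>{- int B..int B}. \<Sum>b\<in>{b\<in>\<B>. l b = k}. inverse_square (l b))"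
    using \<B> l_bound by (intro sum.group[symmetric]) (force simp: abs_le_iff)+
  also have "\<dots> = (\<Sum>k\<in>{- int B..int B}. real (card {b\<in>\<B>. l b = k}) * inverse_square k)"
    by (intro sum.cong refl) simp
  also have "\<dots> \<le> (\<Sum>k\<in>{- int B..int B}. sieve_log B M * inverse_square k)"
    using card_fibre by (intro sum_mono mult_right_mono) (auto simp: inverse_square_def)
  also have "\<dots> \<le> sieve_log B M * 5"
    unfolding sum_distrib_left[symmetric] using sieve_log_nonneg[OF M]
    by (intro mult_left_mono sum_inverse_square_symmetric_le)
  finally have weights: "(\<Sum>b\<in>\<B>. inverse_square (l b)) \<le> 5 * sieve_log B M" by simp
  have "(\<Sum>b\<in>\<B>. (cmod (expsum M {0..<int h} (\<xi> b)))\<^sup>2) \<le> (\<Sum>b\<in>\<B>. (real h)\<^sup>2 * inverse_square (l b))"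
  proof (intro sum_mono)
    fix b assume "b \<in> \<B>"
    then show "(cmod (expsum M {0..<int h} (\<xi> b)))\<^sup>2 \<le> (real h)\<^sup>2 * inverse_square (l b)"
      using \<B>(2)[of b] \<xi>[of b] B \<nu> norm_expsum_interval_dilated_le[OF M, of b B h "\<xi> b" \<nu> "l b"] by blast
  qed
  also have "\<dots> = (real h)\<^sup>2 * (\<Sum>b\<in>\<B>. inverse_square (l b))" by (simp add: sum_distrib_left)
  also have "\<dots> \<le> (real h)\<^sup>2 * (5 * sieve_log B M)" using weights by (intro mult_left_mono) auto
  finally show ?thesis .
qed

lemma sum_norm_expsum_interval_dilated_le:
  fixes M \<nu> :: int and \<xi> :: "nat \<Rightarrow> int" and \<B> :: "nat set" and B h :: nat
  assumes M: "M > 0" and \<B>: "finite \<B>" "\<And>b. b \<in> \<B> \<Longrightarrow> prime b \<and> b \<le> B" and B: "B \<le> h"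
    and \<nu>: "\<not> M dvd \<nu>" and \<xi>: "\<And>b. b \<in> \<B> \<Longrightarrow> [int b * \<xi> b = \<nu>] (mod M)"
  shows "(\<Sum>b\<in>\<B>. (cmod (expsum M {0..<int h} (\<xi> b)))\<^sup>2) \<le> (real h)\<^sup>2 * (5 * sieve_log B M)"
proof -
  obtain \<nu>' where \<nu>': "[\<nu>' = \<nu>] (mod M)" "2 * \<bar>\<nu>'\<bar> \<le> M"
    using symmetric_representative[OF M \<nu>] .
  have "\<exists>x l. [x = \<xi> b] (mod M) \<and> int b * x = \<nu>' + l * M \<and> x \<noteq> 0 \<and> 2 * \<bar>x\<bar> \<le> M" if b: "b \<in> \<B>" for b
  proof -
    have "\<not> M dvd \<xi> b" using cong_dvd_iff[OF \<xi>[OF b]] \<nu> by auto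
    then obtain x where x: "[x = \<xi> b] (mod M)" "x \<noteq> 0" "2 * \<bar>x\<bar> \<le> M"
      using symmetric_representative[OF M] by blast
    have "[int b * x = \<nu>'] (mod M)"
      using x(1) \<xi>[OF b] \<nu>'(1) by (meson cong_scalar_left cong_sym cong_trans)
    then obtain l where "int b * x - \<nu>' = M * l" by (auto simp: cong_iff_dvd_diff)
    then have "int b * x = \<nu>' + l * M" by (simp add: algebra_simps)
    then show ?thesis using x by blast
  qed
  then obtain x l where x: "\<And>b. b \<in> \<B> \<Longrightarrow>
      [x b = \<xi> b] (mod M) \<and> int b * x b = \<nu>' + l b * M \<and> x b \<noteq> 0 \<and> 2 * \<bar>x b\<bar> \<le> M"
    by metis
  have "(\<Sum>b\<in>\<B>. (cmod (expsum M {0..<int h} (\<xi> b)))\<^sup>2) = (\<Sum>b\<in>\<B>. (cmod (expsum M {0..<int h} (x b)))\<^sup>2)"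
    using x expsum_cong[OF M] by (intro sum.cong refl) metis
  also have "\<dots> \<le> (real h)\<^sup>2 * (5 * sieve_log B M)"
    using x \<nu>' by (intro sum_norm_expsum_interval_small_dilated_le[OF M \<B> B]) auto
  finally show ?thesis .
qed

lemma sum_expsum_product_eq_0:
  assumes M: "M > 0"
    and no_solution: "\<And>z s b y. z \<in> E \<Longrightarrow> s \<in> S \<Longrightarrow> b \<in> \<B> \<Longrightarrow> y \<in> D \<Longrightarrow> \<not> M dvd z + s - int b * y"
  shows "(\<Sum>\<xi>\<in>{0..<M}. expsum M E \<xi> * (expsum M S \<xi> * (\<Sum>b\<in>\<B>. expsum M D (- \<xi> * int b)))) = 0"
proof -
  have split: "addchar M (\<xi> * (z + s - int b * y)) = addchar M (\<xi> * z) * (addchar M (\<xi> * s) * addchar M (- \<xi> * int b * y))"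
    for \<xi> z s b y by (simp add: addchar_add[symmetric] algebra_simps)
  have "expsum M E \<xi> * (expsum M S \<xi> * (\<Sum>b\<in>\<B>. expsum M D (- \<xi> * int b))) =
     (\<Sum>z\<in>E. \<Sum>s\<in>S. \<Sum>b\<in>\<B>. \<Sum>y\<in>D. addchar M (\<xi> * (z + s - int b * y)))" for \<xi>
    unfolding split by (simp only: expsum_def sum_distrib_left[symmetric] sum_distrib_right[symmetric])
  also have "\<dots> \<xi> = (\<Sum>(z, s, b, y)\<in>E \<times> S \<times> \<B> \<times> D. addchar M (\<xi> * (z + s - int b * y)))" for \<xi>
    by (simp add: sum.cartesian_product)
  finally have "(\<Sum>\<xi>\<in>{0..<M}. expsum M E \<xi> * (expsum M S \<xi> * (\<Sum>b\<in>\<B>. expsum M D (- \<xi> * int b)))) =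
      (\<Sum>\<xi>\<in>{0..<M}. \<Sum>(z, s, b, y)\<in>E \<times> S \<times> \<B> \<times> D. addchar M (\<xi> * (z + s - int b * y)))"
    by (intro sum.cong refl)
  also have "\<dots> = (\<Sum>(z, s, b, y)\<in>E \<times> S \<times> \<B> \<times> D. expsum M {0..<M} (z + s - int b * y))"
    by (subst sum.swap) (simp add: expsum_def split_beta mult.commute)
  also have "\<dots> = 0"
    using no_solution by (intro sum.neutral) (auto simp: expsum_complete_residues[OF M])
  finally show ?thesis .
qed

lemma card_product_le_nonzero_frequencies:
  assumes M: "M > 0"
    and no_solution: "\<And>z s b y. z \<in> E \<Longrightarrow> s \<in> S \<Longrightarrow> b \<in> \<B> \<Longrightarrow> y \<in> D \<Longrightarrow> \<not> M dvd z + s - int b * y"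
  shows "real (card E) * (real (card S) * (real (card \<B>) * real (card D)))
    \<le> (\<Sum>\<xi>\<in>{1..<M}. cmod (expsum M E \<xi>) * cmod (expsum M S \<xi> * (\<Sum>b\<in>\<B>. expsum M D (- \<xi> * int b))))"
proof -
  define F where "F \<xi> = expsum M E \<xi> * (expsum M S \<xi> * (\<Sum>b\<in>\<B>. expsum M D (- \<xi> * int b)))" for \<xi>
  have "{0..<M} = insert 0 {1..<M}" using M by auto
  then have "F 0 + (\<Sum>\<xi>\<in>{1..<M}. F \<xi>) = 0"
    using sum_expsum_product_eq_0[OF assms] by (simp add: F_def)
  then have "cmod (F 0) = cmod (\<Sum>\<xi>\<in>{1..<M}. F \<xi>)" by (metis add_eq_0_iff norm_minus_cancel)
  also have "\<dots> \<le> (\<Sum>\<xi>\<in>{1..<M}. cmod (F \<xi>))" by (rule norm_sum)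
  finally show ?thesis by (simp add: F_def norm_mult)
qed

lemma sum_residues_mult:
  assumes "coprime c M" "\<And>x. F (x mod M) = F x"
  shows "(\<Sum>x\<in>{1..<M}. F (c * x)) = (\<Sum>x\<in>{1..<M::int}. F x)"
  using sum.reindex_bij_betw[OF bij_betw_int_remainders_mult[OF assms(1)], of F] assms(2) by simp

lemma sum_norm_expsum_dilate:
  assumes M: "M > 0" and b: "coprime b M"
  shows "(\<Sum>\<xi>\<in>{1..<M}. (cmod (expsum M S \<xi>))\<^sup>2 * (cmod (expsum M D (- \<xi> * b)))\<^sup>2)
    = (\<Sum>\<nu>\<in>{1..<M}. (cmod (expsum M S (modular_inverse M b * \<nu>)))\<^sup>2 * (cmod (expsum M D \<nu>))\<^sup>2)"
proof -
  define F where "F \<xi> = (cmod (expsum M S \<xi>))\<^sup>2 * (cmod (expsum M D (- \<xi> * b)))\<^sup>2" for \<xi>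
  have "F (x mod M) = F x" for x
  proof -
    have "[- (x mod M) * b = - x * b] (mod M)" by (intro cong_mult cong_refl) (simp add: cong_minus_minus_iff)
    then show ?thesis using expsum_cong[OF M] by (simp add: F_def expsum_mod[OF M])
  qed
  then have "(\<Sum>\<xi>\<in>{1..<M}. F \<xi>) = (\<Sum>\<nu>\<in>{1..<M}. F (modular_inverse M b * \<nu>))"
    by (intro sum_residues_mult[symmetric] coprime_modular_inverse b)
  also have "\<dots> = (\<Sum>\<nu>\<in>{1..<M}. (cmod (expsum M S (modular_inverse M b * \<nu>)))\<^sup>2 * (cmod (expsum M D \<nu>))\<^sup>2)"
  proof (intro sum.cong refl)
    fix \<nu>
    have "- (modular_inverse M b * \<nu>) * b = b * modular_inverse M b * - \<nu>" by simp
    also have "[\<dots> = 1 * - \<nu>] (mod M)" by (intro cong_mult cong_modular_inverse1 b cong_refl)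
    finally have "expsum M D (- (modular_inverse M b * \<nu>) * b) = expsum M D (- \<nu>)"
      by (intro expsum_cong[OF M]) simp
    then show "F (modular_inverse M b * \<nu>) = (cmod (expsum M S (modular_inverse M b * \<nu>)))\<^sup>2 * (cmod (expsum M D \<nu>))\<^sup>2"
      by (simp only: F_def norm_expsum_minus)
  qed
  finally show ?thesis by (simp only: F_def)
qed

lemma sum_norm_dilates_second_moment_le:
  fixes M :: int and \<B> :: "nat set" and B h :: nat and D :: "int set"
  assumes M: "M > 0" and \<B>: "finite \<B>" "\<And>b. b \<in> \<B> \<Longrightarrow> prime b \<and> b \<le> B \<and> coprime (int b) M"
    and B: "B \<le> h" and D: "D \<subseteq> {0..<M}"
  shows "(\<Sum>\<xi>\<in>{1..<M}. (cmod (expsum M {0..<int h} \<xi> * (\<Sum>b\<in>\<B>. expsum M ({0..<M} - D) (- \<xi> * int b))))\<^sup>2)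
    \<le> card \<B> * ((real h)\<^sup>2 * (5 * sieve_log B M)) * (real_of_int M * card D)"
proof -
  let ?k = "\<lambda>\<xi>. (cmod (expsum M {0..<int h} \<xi>))\<^sup>2" and ?f = "\<lambda>\<xi>. (cmod (expsum M ({0..<M} - D) \<xi>))\<^sup>2"
  have cauchy_schwarz: "(cmod (\<Sum>b\<in>\<B>. x b))\<^sup>2 \<le> card \<B> * (\<Sum>b\<in>\<B>. (cmod (x b))\<^sup>2)" for x :: "nat \<Rightarrow> complex"
  proof -
    have "(cmod (\<Sum>b\<in>\<B>. x b))\<^sup>2 \<le> (\<Sum>b\<in>\<B>. 1 * cmod (x b))\<^sup>2"
      by (intro power_mono) (simp_all add: norm_sum)
    also have "\<dots> \<le> (\<Sum>b\<in>\<B>. 1\<^sup>2) * (\<Sum>b\<in>\<B>. (cmod (x b))\<^sup>2)" by (rule Cauchy_Schwarz_ineq_sum)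
    finally show ?thesis by simp
  qed
  have "(\<Sum>\<xi>\<in>{1..<M}. (cmod (expsum M {0..<int h} \<xi> * (\<Sum>b\<in>\<B>. expsum M ({0..<M} - D) (- \<xi> * int b))))\<^sup>2)
      \<le> (\<Sum>\<xi>\<in>{1..<M}. ?k \<xi> * (card \<B> * (\<Sum>b\<in>\<B>. ?f (- \<xi> * int b))))"
    unfolding norm_mult power_mult_distrib by (intro sum_mono mult_left_mono cauchy_schwarz) simp
  also have "\<dots> = card \<B> * (\<Sum>b\<in>\<B>. \<Sum>\<xi>\<in>{1..<M}. ?k \<xi> * ?f (- \<xi> * int b))"
    by (subst sum.swap) (simp add: sum_distrib_left mult_ac)
  also have "(\<Sum>b\<in>\<B>. \<Sum>\<xi>\<in>{1..<M}. ?k \<xi> * ?f (- \<xi> * int b)) =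
      (\<Sum>b\<in>\<B>. \<Sum>\<nu>\<in>{1..<M}. ?k (modular_inverse M (int b) * \<nu>) * ?f \<nu>)"
    using \<B>(2) by (intro sum.cong refl sum_norm_expsum_dilate[OF M]) simp
  also have "\<dots> = (\<Sum>\<nu>\<in>{1..<M}. (\<Sum>b\<in>\<B>. ?k (modular_inverse M (int b) * \<nu>)) * ?f \<nu>)"
    by (subst sum.swap) (simp add: sum_distrib_right)
  also have "\<dots> \<le> (\<Sum>\<nu>\<in>{1..<M}. ((real h)\<^sup>2 * (5 * sieve_log B M)) * (cmod (expsum M D \<nu>))\<^sup>2)"
  proof (intro sum_mono)
    fix \<nu> assume "\<nu> \<in> {1..<M}"
    then have \<nu>: "\<not> M dvd \<nu>" by (auto dest: zdvd_imp_le)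
    have "(\<Sum>b\<in>\<B>. ?k (modular_inverse M (int b) * \<nu>)) \<le> (real h)\<^sup>2 * (5 * sieve_log B M)"
    proof (rule sum_norm_expsum_interval_dilated_le[OF M \<B>(1) _ B \<nu>])
      show "[int b * (modular_inverse M (int b) * \<nu>) = \<nu>] (mod M)" if "b \<in> \<B>" for b
        using cong_mult[OF cong_modular_inverse1 cong_refl[of \<nu>]] \<B>(2)[OF that] by (simp add: mult.assoc)
    qed (use \<B>(2) in blast)
    then show "(\<Sum>b\<in>\<B>. ?k (modular_inverse M (int b) * \<nu>)) * ?f \<nu> \<le> ((real h)\<^sup>2 * (5 * sieve_log B M)) * (cmod (expsum M D \<nu>))\<^sup>2"
      unfolding norm_expsum_complement[OF M D \<nu>] by (rule mult_right_mono) simp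
  qed
  also have "\<dots> \<le> ((real h)\<^sup>2 * (5 * sieve_log B M)) * (real_of_int M * card D)"
    unfolding sum_distrib_left[symmetric] using sieve_log_nonneg[OF M]
    by (intro mult_left_mono expsum_parseval_nonzero_le[OF M D]) simp
  finally show ?thesis by (simp add: mult_left_mono mult.assoc)
qed

text \<open>The points of \<open>E\<close> force, through every prime \<open>b\<close>, a whole interval of points of \<open>D\<close>, and for different primes
  these are nearly independent.\<close>

lemma large_sieve_dilates:
  fixes M :: int and \<B> :: "nat set" and B h :: nat and D E :: "int set"
  assumes M: "M > 0" and \<B>: "finite \<B>" "\<And>b. b \<in> \<B> \<Longrightarrow> prime b \<and> b \<le> B \<and> coprime (int b) M"
    and B: "0 < B" "B \<le> h" and D: "D \<subseteq> {0..<M}" and E: "E \<subseteq> {0..<M}"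
    and hit: "\<And>z b s y. z \<in> E \<Longrightarrow> b \<in> \<B> \<Longrightarrow> s \<in> {0..<int h} \<Longrightarrow> y \<in> {0..<M} \<Longrightarrow> [int b * y = z + s] (mod M) \<Longrightarrow> y \<in> D"
  shows "real (card E) * card \<B> * (real_of_int M - card D)\<^sup>2 \<le> 5 * sieve_log B M * M\<^sup>2 * card D"
proof (cases "card E = 0 \<or> card \<B> = 0")
  case True
  then show ?thesis using sieve_log_nonneg[OF M] by auto
next
  case False
  define D' where "D' = {0..<M} - D"
  have "card D' = card {0..<M} - card D"
    unfolding D'_def using D by (intro card_Diff_subset) (auto intro: finite_subset)
  moreover have "card D \<le> card {0..<M}" using D by (intro card_mono) auto
  ultimately have card_D': "real (card D') = real_of_int M - card D" using M by (simp add: of_nat_diff)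
  have no_solution: "\<not> M dvd z + s - int b * y" if "z \<in> E" "s \<in> {0..<int h}" "b \<in> \<B>" "y \<in> D'" for z s b y
    using hit[of z b s y] that by (auto simp: D'_def cong_iff_dvd_diff dvd_diff_commute)
  let ?w = "\<lambda>\<xi>. expsum M {0..<int h} \<xi> * (\<Sum>b\<in>\<B>. expsum M D' (- \<xi> * int b))"
  have "(real (card E) * (real h * (real (card \<B>) * real (card D'))))\<^sup>2
      \<le> (\<Sum>\<xi>\<in>{1..<M}. cmod (expsum M E \<xi>) * cmod (?w \<xi>))\<^sup>2"
    using card_product_le_nonzero_frequencies[OF M no_solution, of E "{0..<int h}" \<B> D'] by (intro power_mono) auto
  also have "\<dots> \<le> (\<Sum>\<xi>\<in>{1..<M}. (cmod (expsum M E \<xi>))\<^sup>2) * (\<Sum>\<xi>\<in>{1..<M}. (cmod (?w \<xi>))\<^sup>2)"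
    by (rule Cauchy_Schwarz_ineq_sum)
  also have "\<dots> \<le> (real_of_int M * card E) * (card \<B> * ((real h)\<^sup>2 * (5 * sieve_log B M)) * (real_of_int M * card D))"
    unfolding D'_def using M
    by (intro mult_mono expsum_parseval_nonzero_le[OF M E] sum_norm_dilates_second_moment_le[OF M \<B> B(2) D])
      (auto intro: sum_nonneg)
  finally have "(real (card E) * (real h)\<^sup>2 * card \<B>) * (real (card E) * card \<B> * (real (card D'))\<^sup>2)
      \<le> (real (card E) * (real h)\<^sup>2 * card \<B>) * (5 * sieve_log B M * M\<^sup>2 * card D)"
    by (simp add: power2_eq_square algebra_simps)
  moreover have "real (card E) * (real h)\<^sup>2 * card \<B> > 0" using False B by simp
  ultimately have "real (card E) * card \<B> * (real (card D'))\<^sup>2 \<le> 5 * sieve_log B M * M\<^sup>2 * card D"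
    by (simp only: mult_le_cancel_left_pos)
  then show ?thesis by (simp only: card_D')
qed

section \<open>Prime number estimates\<close>

abbreviation primes_le :: "nat \<Rightarrow> nat set" where
  "primes_le n \<equiv> {p. prime p \<and> p \<le> n}"

lemma finite_primes_le: "finite (primes_le n)"
  by (rule finite_subset[of _ "{..n}"]) auto

lemma card_multiples_le:
  assumes "d > 0"
  shows "card {m\<in>{1..n}. d dvd m} = n div d"
proof -
  have "{m\<in>{1..n}. d dvd m} = (\<lambda>k. d * k) ` {1..n div d}"
    using assms by (fastforce simp: less_eq_div_iff_mult_less_eq mult.commute Suc_le_eq elim!: dvdE)
  then show ?thesis using assms by (simp add: card_image inj_on_def)
qed

lemma ln_fact_eq_sum_mangoldt:
  assumes "n \<le> N"
  shows "ln (fact n) = (\<Sum>d\<in>{1..N}. (mangoldt d :: real) * real (n div d))"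
proof -
  have "ln (fact n :: real) = (\<Sum>m\<in>{1..n}. ln (real m))"
    by (simp add: fact_prod) (subst ln_prod; auto)
  also have "\<dots> = (\<Sum>m\<in>{1..n}. \<Sum>d\<in>{d\<in>{1..N}. d dvd m}. mangoldt d)"
  proof (intro sum.cong refl)
    fix m assume m: "m \<in> {1..n}"
    then have "{d\<in>{1..N}. d dvd m} = {d. d dvd m}"
      using assms by (auto dest: dvd_imp_le intro: Suc_leI dvd_pos_nat)
    then show "ln (real m) = (\<Sum>d\<in>{d\<in>{1..N}. d dvd m}. mangoldt d)" using m by (simp add: mangoldt_sum)
  qed
  also have "\<dots> = (\<Sum>d\<in>{1..N}. \<Sum>m\<in>{m\<in>{1..n}. d dvd m}. mangoldt d)"
    by (rule sum.swap_restrict) auto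
  also have "\<dots> = (\<Sum>d\<in>{1..N}. mangoldt d * real (n div d))"
    using card_multiples_le by (intro sum.cong refl) (force simp: mult.commute)
  finally show ?thesis .
qed

lemma sum_mangoldt_mono:
  assumes "P \<subseteq> {1..n}" "\<And>d. 0 \<le> c d"
  shows "(\<Sum>p\<in>P. mangoldt p * c p) \<le> (\<Sum>d\<in>{1..n}. mangoldt d * (c d :: real))"
  using assms by (intro sum_mono2 mult_nonneg_nonneg mangoldt_nonneg) auto

lemma double_div_bounds:
  "0 \<le> real ((2 * n) div d) - 2 * real (n div d)" "real ((2 * n) div d) - 2 * real (n div d) \<le> 1"
proof -
  have "2 * (n div d) \<le> (2 * n) div d \<and> (2 * n) div d \<le> 2 * (n div d) + 1"
  proof (cases "d = 0")
    case False
    have "2 * n = 2 * (n mod d) + 2 * (n div d) * d"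
      by (metis add.commute distrib_left div_mult_mod_eq mult.assoc)
    then have "(2 * n) div d = (2 * (n mod d)) div d + 2 * (n div d)" using False by simp
    moreover have "(2 * (n mod d)) div d < 2" using False by (simp add: div_less_iff_less_mult)
    ultimately show ?thesis by linarith
  qed simp
  then show "0 \<le> real ((2 * n) div d) - 2 * real (n div d)" "real ((2 * n) div d) - 2 * real (n div d) \<le> 1"
    by linarith+
qed

lemma ln_central_binomial_eq:
  "ln (real ((2 * n) choose n)) = (\<Sum>d\<in>{1..2 * n}. (mangoldt d :: real) * (real ((2 * n) div d) - 2 * real (n div d)))"
proof -
  have "real ((2 * n) choose n) = fact (2 * n) / (fact n * fact n)"
    using binomial_fact[of n "2 * n", where ?'a = real] by (simp add: mult_2)
  then have "ln (real ((2 * n) choose n)) = ln (fact (2 * n)) - 2 * ln (fact n :: real)"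
    by (simp add: ln_div ln_mult)
  also have "ln (fact (2 * n) :: real) = (\<Sum>d\<in>{1..2 * n}. mangoldt d * real ((2 * n) div d))"
    by (rule ln_fact_eq_sum_mangoldt) simp
  also have "ln (fact n :: real) = (\<Sum>d\<in>{1..2 * n}. mangoldt d * real (n div d))"
    by (rule ln_fact_eq_sum_mangoldt) simp
  finally show ?thesis
    by (simp only: sum_distrib_left sum_subtractf[symmetric]) (simp add: right_diff_distrib mult.left_commute)
qed

definition chebyshev_theta :: "nat \<Rightarrow> real" where
  "chebyshev_theta n = (\<Sum>p\<in>primes_le n. ln (real p))"

lemma chebyshev_theta_double: "chebyshev_theta (2 * n) \<le> chebyshev_theta n + 2 * n * ln 2"
proof -
  let ?P = "{p. prime p \<and> n < p \<and> p \<le> 2 * n}"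
  have "primes_le (2 * n) = primes_le n \<union> ?P" by auto
  then have "chebyshev_theta (2 * n) = chebyshev_theta n + (\<Sum>p\<in>?P. ln (real p))"
    unfolding chebyshev_theta_def
    by (simp only:) (rule sum.union_disjoint, auto intro: finite_subset[OF _ finite_primes_le[of "2 * n"]])
  also have "(\<Sum>p\<in>?P. ln (real p)) = (\<Sum>p\<in>?P. (mangoldt p :: real) * (real ((2 * n) div p) - 2 * real (n div p)))"
  proof (intro sum.cong refl)
    fix p assume p: "p \<in> ?P"
    then have "(2 * n) div p = 1" by (intro div_nat_eqI) auto
    then show "ln (real p) = (mangoldt p :: real) * (real ((2 * n) div p) - 2 * real (n div p))" using p by simp
  qed
  also have "\<dots> \<le> (\<Sum>d\<in>{1..2 * n}. (mangoldt d :: real) * (real ((2 * n) div d) - 2 * real (n div d)))"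
    by (intro sum_mangoldt_mono double_div_bounds) auto
  also have "\<dots> = ln (real ((2 * n) choose n))" by (rule ln_central_binomial_eq[symmetric])
  also have "\<dots> \<le> ln (2 ^ (2 * n))"
  proof -
    have "real ((2 * n) choose n) \<le> 2 ^ (2 * n)"
      using binomial_le_pow2[of "2 * n" n] by (metis of_nat_le_iff of_nat_numeral of_nat_power)
    then show ?thesis by (subst ln_le_cancel_iff) auto
  qed
  also have "\<dots> = 2 * n * ln 2" by (simp add: ln_realpow)
  finally show ?thesis by simp
qed

lemma chebyshev_theta_mono: "m \<le> n \<Longrightarrow> chebyshev_theta m \<le> chebyshev_theta n"
  unfolding chebyshev_theta_def
proof (intro sum_mono2 finite_primes_le)
  fix p assume "p \<in> primes_le n - primes_le m"
  then show "0 \<le> ln (real p)" using prime_ge_1_nat[of p] by simp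
qed auto

lemma chebyshev_theta_le_ln2: "chebyshev_theta n \<le> 4 * ln 2 * n"
proof (induction n rule: less_induct)
  case (less n)
  show ?case
  proof (cases "n \<le> 2")
    case True
    then consider "n \<le> 1" | "n = 2" by linarith
    then show ?thesis
    proof cases
      case 1
      then have "primes_le n = {}" by (auto dest: prime_ge_2_nat)
      then show ?thesis unfolding chebyshev_theta_def by (simp only: sum.empty) simp
    next
      case 2
      have "primes_le 2 = {2}" by (auto dest: prime_ge_2_nat)
      then show ?thesis unfolding chebyshev_theta_def by (simp only: 2) simp
    qed
  next
    case False
    define m where "m = (n + 1) div 2"
    have m: "m < n" "n \<le> 2 * m" "6 * m \<le> 4 * n" using False by (auto simp: m_def)
    have "chebyshev_theta n \<le> chebyshev_theta (2 * m)" using m by (intro chebyshev_theta_mono)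
    also have "\<dots> \<le> chebyshev_theta m + 2 * real m * ln 2" by (rule chebyshev_theta_double)
    also have "chebyshev_theta m \<le> 4 * ln 2 * m" using less m by blast
    finally have "chebyshev_theta n \<le> ln 2 * real (6 * m)" by (simp add: algebra_simps)
    also have "\<dots> \<le> ln 2 * real (4 * n)" using m(3) by (intro mult_left_mono of_nat_mono) auto
    finally show ?thesis by simp
  qed
qed

lemma chebyshev_theta_le: "chebyshev_theta n \<le> 3 * real n"
proof -
  have "4 * ln 2 * real n \<le> 3 * real n" using ln2_le_25_over_36 by (intro mult_right_mono) auto
  then show ?thesis using chebyshev_theta_le_ln2[of n] by linarith
qed

lemma sum_ln_p_over_p_le:
  fixes n :: nat
  assumes "n \<ge> 1"
  shows "(\<Sum>p\<in>primes_le n. ln (real p) / real p) \<le> ln n + 3"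
proof -
  have "(\<Sum>p\<in>primes_le n. ln (real p) * (real n / real p - 1)) \<le> (\<Sum>p\<in>primes_le n. mangoldt p * real (n div p))"
  proof (intro sum_mono)
    fix p assume p: "p \<in> primes_le n"
    have "real n / real p - 1 \<le> real (n div p)"
      using floor_divide_of_nat_eq[of n p, where ?'a = real] floor_correct[of "real n / real p"] by linarith
    moreover have "ln (real p) \<ge> 0" using p prime_ge_1_nat[of p] by simp
    ultimately show "ln (real p) * (real n / real p - 1) \<le> mangoldt p * real (n div p)"
      using p by (simp add: mult_left_mono)
  qed
  also have "\<dots> \<le> (\<Sum>d\<in>{1..n}. mangoldt d * real (n div d))"
    using prime_ge_1_nat by (intro sum_mangoldt_mono) auto
  also have "\<dots> = ln (fact n)" by (rule ln_fact_eq_sum_mangoldt[symmetric]) simp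
  also have "\<dots> \<le> ln (real n ^ n)"
    using assms fact_le_power[of n, where ?'a = real] by (subst ln_le_cancel_iff) auto
  also have "\<dots> = n * ln n" using assms by (simp add: ln_realpow)
  finally have "(\<Sum>p\<in>primes_le n. n * (ln (real p) / real p)) - chebyshev_theta n \<le> n * ln n"
    by (simp add: chebyshev_theta_def sum_subtractf algebra_simps)
  then have "n * (\<Sum>p\<in>primes_le n. ln (real p) / real p) \<le> n * (ln n + 3)"
    using chebyshev_theta_le[of n] by (simp add: sum_distrib_left algebra_simps)
  then show ?thesis using assms by simp
qed

definition mertens_const :: real where
  "mertens_const = 1 + 3 / ln 2 - ln (ln 2)"

lemma sum_primes_le_Suc:
  "(\<Sum>p\<in>primes_le (Suc n). f p) = (\<Sum>p\<in>primes_le n. f p) + (if prime (Suc n) then f (Suc n) else (0::real))"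
proof -
  have "primes_le (Suc n) = (if prime (Suc n) then insert (Suc n) (primes_le n) else primes_le n)"
    by (auto simp: le_Suc_eq)
  then show ?thesis by (simp add: finite_primes_le)
qed

text \<open>Partial summation: passing from \<open>n\<close> to \<open>n + 1\<close>, the difference on the left only changes through the factor \<open>1 / ln n\<close>.\<close>

lemma sum_inverse_primes_partial_summation:
  fixes n :: nat
  assumes "n \<ge> 2"
  shows "(\<Sum>p\<in>primes_le n. 1 / real p) - (\<Sum>p\<in>primes_le n. ln (real p) / real p) / ln n
     \<le> ln (ln n) - 3 / ln n + (mertens_const - 1)"
  using assms
proof (induction n rule: dec_induct)
  case base
  have "primes_le 2 = {2}" by (auto dest: prime_ge_2_nat)
  then show ?case by (simp add: mertens_const_def)
next
  case (step n)
  define I A where "I n = (\<Sum>p\<in>primes_le n. 1 / real p)" and "A n = (\<Sum>p\<in>primes_le n. ln (real p) / real p)" for n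
  have ln_pos: "ln (real n) > 0" "ln (real (Suc n)) > 0" and ln_le: "ln (real n) \<le> ln (real (Suc n))"
    using step.hyps by auto
  have increment: "I (Suc n) - A (Suc n) / ln (Suc n) = I n - A n / ln (Suc n)"
    using ln_pos by (auto simp: I_def A_def sum_primes_le_Suc add_divide_distrib simp del: of_nat_Suc)
  have "A n * (1 / ln n - 1 / ln (Suc n)) \<le> (ln n + 3) * (1 / ln n - 1 / ln (Suc n))"
    using sum_ln_p_over_p_le[of n] step.hyps ln_pos ln_le by (intro mult_right_mono) (auto simp: A_def frac_le)
  also have "\<dots> = (1 - ln n / ln (Suc n)) + 3 / ln n - 3 / ln (Suc n)"
    using ln_pos by (simp add: field_simps)
  also have "1 - ln n / ln (Suc n) \<le> ln (ln (Suc n)) - ln (ln n)"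
    using ln_le_minus_one[of "ln n / ln (Suc n)"] ln_pos by (simp add: ln_div del: of_nat_Suc)
  finally have "A n / ln n - A n / ln (Suc n) \<le> ln (ln (Suc n)) - ln (ln n) + 3 / ln n - 3 / ln (Suc n)"
    by (simp add: algebra_simps del: of_nat_Suc)
  then show ?case using increment step.IH unfolding I_def A_def by linarith
qed

theorem sum_inverse_primes_le:
  fixes n :: nat
  assumes "n \<ge> 2"
  shows "(\<Sum>p\<in>primes_le n. 1 / real p) \<le> ln (ln n) + mertens_const"
proof -
  have ln_pos: "ln (real n) > 0" using assms by simp
  have "(\<Sum>p\<in>primes_le n. ln (real p) / real p) / ln n \<le> (ln n + 3) / ln n"
    using ln_pos assms by (intro divide_right_mono sum_ln_p_over_p_le) auto
  also have "\<dots> = 1 + 3 / ln n" using ln_pos by (simp add: add_divide_distrib)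
  finally show ?thesis using sum_inverse_primes_partial_summation[OF assms] by linarith
qed

lemma card_prime_powers_times_ln_le:
  fixes n p :: nat
  assumes p: "prime p" and n: "n > 0"
  shows "real (card {d\<in>{1..n}. primepow d \<and> aprimedivisor d = p}) * ln p \<le> ln n"
proof -
  define K where "K = nat \<lfloor>ln n / ln p\<rfloor>"
  have ln_p: "ln (real p) > 0" using prime_gt_1_nat[OF p] by simp
  have "{d\<in>{1..n}. primepow d \<and> aprimedivisor d = p} \<subseteq> (\<lambda>k. p ^ k) ` {1..K}"
  proof
    fix d assume d: "d \<in> {d\<in>{1..n}. primepow d \<and> aprimedivisor d = p}"
    then obtain k where k: "k > 0" "d = p ^ k" by (auto simp: primepow_def aprimedivisor_prime_power)
    then have "ln (real (p ^ k)) \<le> ln n" using d n p by (subst ln_le_cancel_iff) (auto simp: prime_gt_0_nat)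
    then have "real k \<le> ln n / ln p" using ln_p by (simp add: ln_realpow le_divide_eq)
    then show "d \<in> (\<lambda>k. p ^ k) ` {1..K}" using k by (auto simp: K_def le_nat_floor)
  qed
  then have "card {d\<in>{1..n}. primepow d \<and> aprimedivisor d = p} \<le> card {1..K}"
    using surj_card_le[of "{1..K}"] by blast
  then have "real (card {d\<in>{1..n}. primepow d \<and> aprimedivisor d = p}) \<le> real K" by simp
  also have "real K \<le> ln n / ln p" using ln_p n unfolding K_def by (intro of_nat_floor) simp
  finally show ?thesis using ln_p by (simp add: le_divide_eq)
qed

lemma sum_mangoldt_le: "(\<Sum>d\<in>{1..n}. (mangoldt d :: real)) \<le> card (primes_le n) * ln n"
proof (cases "n = 0")
  case False
  let ?Q = "{d\<in>{1..n}. primepow d}"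
  have "aprimedivisor d \<in> primes_le n" if "d \<in> ?Q" for d
    using that prime_aprimedivisor'[of d] aprimedivisor_le_nat[of d] primepow_gt_Suc_0[of d] by auto
  then have group: "(\<Sum>p\<in>primes_le n. \<Sum>d\<in>{d\<in>?Q. aprimedivisor d = p}. mangoldt d) = (\<Sum>d\<in>?Q. (mangoldt d :: real))"
    by (intro sum.group finite_primes_le) auto
  have "(\<Sum>d\<in>{1..n}. (mangoldt d :: real)) = (\<Sum>d\<in>?Q. mangoldt d)"
    by (intro sum.mono_neutral_right) (auto simp: mangoldt_def)
  also have "\<dots> \<le> (\<Sum>p\<in>primes_le n. ln n)"
    unfolding group[symmetric]
  proof (intro sum_mono)
    fix p assume "p \<in> primes_le n"
    moreover have "{d\<in>?Q. aprimedivisor d = p} = {d\<in>{1..n}. primepow d \<and> aprimedivisor d = p}" by auto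
    moreover have "(\<Sum>d\<in>{d\<in>?Q. aprimedivisor d = p}. (mangoldt d :: real)) = (\<Sum>d\<in>{d\<in>?Q. aprimedivisor d = p}. ln p)"
      by (intro sum.cong refl) (auto simp: mangoldt_def)
    ultimately show "(\<Sum>d\<in>{d\<in>?Q. aprimedivisor d = p}. (mangoldt d :: real)) \<le> ln n"
      using card_prime_powers_times_ln_le[of p n] False by simp
  qed
  finally show ?thesis by simp
qed simp

theorem prime_counting_lower_bound:
  assumes "N \<ge> 2"
  shows "real N / 8 \<le> card (primes_le N) * ln N"
proof -
  define n where "n = N div 2"
  have n: "n \<ge> 1" "2 * n \<le> N" "N \<le> 2 * n + 1" using assms by (auto simp: n_def)
  have "ln (4::real) = 2 * ln 2" using ln_realpow[of 2 2] by simp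
  then have "real n * (4 / 3) \<le> real n * ln 4" using ln2_ge_two_thirds by (intro mult_left_mono) auto
  moreover have "ln (2 * real n) \<le> 25 / 36 + (real n - 1)"
    using ln2_le_25_over_36 ln_le_minus_one[of "real n"] n by (simp add: ln_mult)
  ultimately have "real n / 3 + 11 / 36 \<le> n * ln 4 - ln (2 * n)" by simp
  moreover have "real N / 8 \<le> real n / 3 + 11 / 36" using n by simp
  ultimately have "real N / 8 \<le> n * ln 4 - ln (2 * n)" by linarith
  also have "\<dots> = ln (4 ^ n / (2 * real n))" using n by (simp add: ln_div ln_realpow)
  also have "\<dots> \<le> ln (real ((2 * n) choose n))"
    using central_binomial_lower_bound[of n] n by (subst ln_le_cancel_iff) auto
  also have "\<dots> = (\<Sum>d\<in>{1..2 * n}. (mangoldt d :: real) * (real ((2 * n) div d) - 2 * real (n div d)))"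
    by (rule ln_central_binomial_eq)
  also have "\<dots> \<le> (\<Sum>d\<in>{1..2 * n}. mangoldt d * 1)"
    by (intro sum_mono mult_left_mono double_div_bounds mangoldt_nonneg)
  also have "\<dots> \<le> (\<Sum>d\<in>{1..N}. mangoldt d)" using n by (simp, intro sum_mono2) (auto simp: mangoldt_nonneg)
  also have "\<dots> \<le> card (primes_le N) * ln N" by (rule sum_mangoldt_le)
  finally show ?thesis .
qed

section \<open>Polynomials modulo a prime\<close>

lemma prime_elem_const_poly: "prime p \<Longrightarrow> prime_elem [:int p:]"
  by (intro lift_prime_elem_poly) simp

lemma const_poly_dvd_mult_iff:
  "prime p \<Longrightarrow> [:int p:] dvd f * g \<longleftrightarrow> [:int p:] dvd f \<or> [:int p:] dvd g"
  by (simp add: prime_elem_dvd_mult_iff prime_elem_const_poly)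

lemma const_poly_dvd_powerD: "prime p \<Longrightarrow> [:int p:] dvd f ^ n \<Longrightarrow> [:int p:] dvd f"
  using prime_elem_dvd_power prime_elem_const_poly by blast

lemma const_poly_dvd_pderiv:
  fixes c :: "'a :: {comm_semiring_1, semiring_no_zero_divisors}"
  shows "[:c:] dvd f \<Longrightarrow> [:c:] dvd pderiv f"
  by (auto simp: const_poly_dvd_iff coeff_pderiv)

lemma const_poly_dvd_higher_pderiv:
  fixes c :: "'a :: {comm_semiring_1, semiring_no_zero_divisors}"
  shows "[:c:] dvd f \<Longrightarrow> [:c:] dvd (pderiv ^^ i) f"
  by (induction i) (simp_all add: const_poly_dvd_pderiv)

lemma const_poly_dvd_poly: "[:c:] dvd f \<Longrightarrow> c dvd poly f x" for c :: "'a :: comm_ring_1"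
  by (auto elim!: dvdE)

lemma const_poly_dvd_mult_diff:
  fixes c :: "'a :: comm_ring_1"
  assumes "[:c:] dvd f - f'" "[:c:] dvd g - g'"
  shows "[:c:] dvd f * g - f' * g'"
proof -
  have "f * g - f' * g' = (f - f') * g + f' * (g - g')" by (simp add: algebra_simps)
  then show ?thesis using assms by simp
qed

lemma const_poly_not_dvd_monic:
  assumes "prime p" "lead_coeff f = 1"
  shows "\<not> [:int p:] dvd f"
proof
  assume "[:int p:] dvd f"
  then have "int p dvd 1" using assms(2) by (metis const_poly_dvd_iff)
  then show False using assms(1) by (auto simp: prime_nat_iff)
qed

lemma const_poly_dvd_low_degree:
  fixes c :: "'a :: idom"
  assumes "[:c:] dvd f + monom 1 n * g" "degree f < n"
  shows "[:c:] dvd f"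
  unfolding const_poly_dvd_iff
proof
  fix i
  show "c dvd coeff f i"
  proof (cases "i < n")
    case True
    then have "coeff (f + monom 1 n * g) i = coeff f i" by (simp add: coeff_monom_mult)
    moreover have "c dvd coeff (f + monom 1 n * g) i" using assms(1) by (simp only: const_poly_dvd_iff)
    ultimately show ?thesis by (simp only:)
  next
    case False
    then show ?thesis using assms(2) by (simp add: coeff_eq_0)
  qed
qed

definition dvd_mod :: "nat \<Rightarrow> int poly \<Rightarrow> int poly \<Rightarrow> bool" where
  "dvd_mod p f h \<longleftrightarrow> (\<exists>g. [:int p:] dvd h - f * g)"

lemma const_poly_dvd_diff_synthetic_div:
  fixes c :: "'a :: idom"
  assumes "c dvd poly g x"
  shows "[:c:] dvd g - [:-x, 1:] * synthetic_div g x"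
proof -
  have "g - [:-x, 1:] * synthetic_div g x = [:poly g x:]"
    using synthetic_div_correct'[of x g] by (simp add: algebra_simps)
  then show ?thesis using assms by simp
qed

lemma poly_higher_pderiv_linear_power:
  "poly ((pderiv ^^ i) ([:-x, 1:] ^ i * g)) x = fact i * poly g (x::int)"
proof (induction i arbitrary: g)
  case (Suc i)
  have "pderiv ([:-x, 1:] ^ Suc i * g) = [:-x,1:] ^ i * (smult (of_nat (Suc i)) g + [:-x,1:] * pderiv g)"
    by (subst pderiv_mult, subst pderiv_power_Suc) (simp add: pderiv_pCons algebra_simps smult_add_left)
  then have "poly ((pderiv ^^ Suc i) ([:-x, 1:] ^ Suc i * g)) x
      = fact i * poly (smult (of_nat (Suc i)) g + [:-x,1:] * pderiv g) x"
    by (simp only: funpow_Suc_right o_apply Suc.IH)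
  then show ?case by (simp add: algebra_simps)
qed simp

lemma linear_power_dvd_mod_of_higher_pderiv:
  assumes "prime p" "l \<le> p" "\<And>i. i < l \<Longrightarrow> int p dvd poly ((pderiv ^^ i) h) x"
  shows "dvd_mod p ([:-x, 1:] ^ l) h"
  using assms(2,3)
proof (induction l)
  case 0
  then show ?case by (auto simp: dvd_mod_def intro: exI[of _ h])
next
  case (Suc l)
  let ?Y = "[:-x, 1:]"
  obtain g where g: "[:int p:] dvd h - ?Y ^ l * g" using Suc by (force simp: dvd_mod_def)
  have "(pderiv ^^ l) h = (pderiv ^^ l) (?Y ^ l * g) + (pderiv ^^ l) (h - ?Y ^ l * g)"
    unfolding higher_pderiv_add[symmetric] by simp
  then have "poly ((pderiv ^^ l) h) x = fact l * poly g x + poly ((pderiv ^^ l) (h - ?Y ^ l * g)) x"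
    by (simp only: poly_add poly_higher_pderiv_linear_power)
  moreover have "int p dvd poly ((pderiv ^^ l) (h - ?Y ^ l * g)) x"
    using g by (intro const_poly_dvd_poly const_poly_dvd_higher_pderiv)
  ultimately have "int p dvd fact l * poly g x"
    using Suc.prems(2)[of l] by (metis dvd_add_left_iff lessI)
  moreover have "\<not> p dvd fact l" using assms(1) Suc.prems(1) by (simp add: prime_dvd_fact_iff)
  then have "\<not> int p dvd fact l" by (metis int_dvd_int_iff of_nat_fact)
  ultimately have "int p dvd poly g x" using assms(1) by (simp add: prime_dvd_mult_iff)
  then have "[:int p:] dvd (h - ?Y ^ l * g) + ?Y ^ l * (g - ?Y * synthetic_div g x)"
    using g const_poly_dvd_diff_synthetic_div by (intro dvd_add dvd_mult)
  also have "(h - ?Y ^ l * g) + ?Y ^ l * (g - ?Y * synthetic_div g x) = h - ?Y ^ Suc l * synthetic_div g x"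
    by (simp add: algebra_simps)
  finally show ?case by (auto simp: dvd_mod_def)
qed

lemma linear_power_dvd_mod_cancel:
  assumes p: "prime p" and dvd: "dvd_mod p ([:-y, 1:] ^ l) (A * g)" and A: "\<not> int p dvd poly A y"
  shows "dvd_mod p ([:-y, 1:] ^ l) g"
proof -
  let ?Y = "[:-y, 1:]"
  obtain u where u: "[:int p:] dvd A * g - ?Y ^ l * u" using dvd by (auto simp: dvd_mod_def)
  have "dvd_mod p (?Y ^ j) g" if "j \<le> l" for j
    using that
  proof (induction j)
    case 0
    then show ?case by (auto simp: dvd_mod_def intro: exI[of _ g])
  next
    case (Suc j)
    then obtain g' where g': "[:int p:] dvd g - ?Y ^ j * g'" by (auto simp: dvd_mod_def)
    have l: "l = j + Suc (l - Suc j)" using Suc.prems by simp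
    have "[:int p:] dvd (A * g - ?Y ^ l * u) - A * (g - ?Y ^ j * g')"
      by (intro dvd_diff u dvd_mult g')
    also have "(A * g - ?Y ^ l * u) - A * (g - ?Y ^ j * g') = ?Y ^ j * (A * g' - ?Y ^ Suc (l - Suc j) * u)"
      by (subst l) (simp only: power_add algebra_simps)
    finally have "[:int p:] dvd A * g' - ?Y ^ Suc (l - Suc j) * u"
      using p const_poly_dvd_powerD[OF p, of ?Y j] const_poly_not_dvd_monic[OF p, of ?Y]
      by (auto simp: const_poly_dvd_mult_iff)
    then have "int p dvd poly (A * g' - ?Y ^ Suc (l - Suc j) * u) y" by (rule const_poly_dvd_poly)
    then have "int p dvd poly g' y" using A p by (simp add: prime_dvd_mult_iff)
    then have "[:int p:] dvd (g - ?Y ^ j * g') + ?Y ^ j * (g' - ?Y * synthetic_div g' y)"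
      using g' const_poly_dvd_diff_synthetic_div by (intro dvd_add dvd_mult)
    also have "(g - ?Y ^ j * g') + ?Y ^ j * (g' - ?Y * synthetic_div g' y) = g - ?Y ^ Suc j * synthetic_div g' y"
      by (simp add: algebra_simps)
    finally show ?case by (auto simp: dvd_mod_def)
  qed
  then show ?thesis by blast
qed

lemma inj_on_mod_iff:
  fixes m :: int
  shows "inj_on (\<lambda>x. x mod m) A \<longleftrightarrow> (\<forall>x\<in>A. \<forall>y\<in>A. x \<noteq> y \<longrightarrow> \<not> m dvd x - y)"
  unfolding inj_on_def by (auto simp: mod_eq_dvd_iff)

lemma prod_linear_powers_dvd_mod:
  assumes p: "prime p" and "finite S" and "inj_on (\<lambda>x. x mod int p) S"
    and "\<And>x. x \<in> S \<Longrightarrow> dvd_mod p ([:-x, 1:] ^ l) h"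
  shows "dvd_mod p ((\<Prod>x\<in>S. [:-x, 1:]) ^ l) h"
  using assms(2-)
proof (induction S rule: finite_induct)
  case empty
  then show ?case by (auto simp: dvd_mod_def intro: exI[of _ h])
next
  case (insert y S)
  let ?A = "(\<Prod>x\<in>S. [:-x, 1:]) ^ l" and ?B = "[:-y, 1:] ^ l"
  have "dvd_mod p ?A h" using insert.IH insert.prems by (auto simp: inj_on_def)
  then obtain g where g: "[:int p:] dvd h - ?A * g" by (auto simp: dvd_mod_def)
  obtain u where u: "[:int p:] dvd h - ?B * u" using insert.prems(2)[of y] by (auto simp: dvd_mod_def)
  have "dvd_mod p ?B (?A * g)"
    using dvd_diff[OF u g] by (auto simp: dvd_mod_def)
  moreover have "\<not> int p dvd poly ?A y"
  proof
    assume "int p dvd poly ?A y"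
    then have "int p dvd (\<Prod>x\<in>S. y - x)"
      using p by (auto simp: poly_prod dest: prime_dvd_power[rotated])
    then obtain x where "x \<in> S" "int p dvd y - x"
      using p \<open>finite S\<close> by (auto simp: prime_dvd_prod_iff)
    then show False using insert.prems(1) insert.hyps by (auto simp: inj_on_mod_iff)
  qed
  ultimately have "dvd_mod p ?B g" by (rule linear_power_dvd_mod_cancel[OF p])
  then obtain g' where g': "[:int p:] dvd g - ?B * g'" by (auto simp: dvd_mod_def)
  have "[:int p:] dvd (h - ?A * g) + ?A * (g - ?B * g')" using g g' by (intro dvd_add dvd_mult)
  also have "(h - ?A * g) + ?A * (g - ?B * g') = h - (\<Prod>x\<in>insert y S. [:-x, 1:]) ^ l * g'"
    unfolding prod.insert[OF insert.hyps] power_mult_distrib by (simp only: algebra_simps)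
  finally show ?case by (auto simp: dvd_mod_def)
qed

lemma degree_le_of_monic_dvd_mod:
  assumes p: "prime p" and A: "lead_coeff A = 1" and dvd: "dvd_mod p A h" and h: "\<not> [:int p:] dvd h"
  shows "degree A \<le> degree h"
proof -
  obtain g where g: "[:int p:] dvd h - A * g" using dvd by (auto simp: dvd_mod_def)
  have "\<not> [:int p:] dvd g" using h g by (metis diff_add_cancel dvd_add dvd_mult)
  then have ne: "{n. \<not> int p dvd coeff g n} \<noteq> {}" by (auto simp: const_poly_dvd_iff)
  have fin: "finite {n. \<not> int p dvd coeff g n}"
    by (rule finite_subset[of _ "{..degree g}"]) (auto intro: le_degree)
  define n where "n = Max {n. \<not> int p dvd coeff g n}"
  have n: "\<not> int p dvd coeff g n" "\<And>i. n < i \<Longrightarrow> int p dvd coeff g i"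
    using Max_in[OF fin ne] Max_ge[OF fin] unfolding n_def by (auto simp: not_le[symmetric])
  have "coeff (A * g) (degree A + n) = (\<Sum>i\<le>degree A + n. coeff A i * coeff g (degree A + n - i))"
    by (rule coeff_mult)
  also have "\<dots> = coeff g n + (\<Sum>i\<in>{..degree A + n} - {degree A}. coeff A i * coeff g (degree A + n - i))"
    using A by (subst sum.remove[of _ "degree A"]) auto
  finally have split: "coeff (A * g) (degree A + n) =
      coeff g n + (\<Sum>i\<in>{..degree A + n} - {degree A}. coeff A i * coeff g (degree A + n - i))" .
  have "int p dvd (\<Sum>i\<in>{..degree A + n} - {degree A}. coeff A i * coeff g (degree A + n - i))"
  proof (intro dvd_sum)
    fix i assume "i \<in> {..degree A + n} - {degree A}"
    then consider "i < degree A" | "degree A < i" by force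
    then show "int p dvd coeff A i * coeff g (degree A + n - i)"
      using n(2) by cases (auto simp: coeff_eq_0)
  qed
  then have "\<not> int p dvd coeff (A * g) (degree A + n)" using n(1) by (simp add: split dvd_add_left_iff)
  moreover have "int p dvd coeff h (degree A + n) - coeff (A * g) (degree A + n)"
    using g by (metis coeff_diff const_poly_dvd_iff)
  ultimately have "coeff h (degree A + n) \<noteq> 0" by (metis diff_0 dvd_minus_iff)
  then show ?thesis using le_degree by force
qed

lemma card_roots_le_degree_mod:
  assumes p: "prime p" and S: "finite S" "inj_on (\<lambda>x. x mod int p) S"
    and h: "\<not> [:int p:] dvd h" and l: "l \<le> p"
    and roots: "\<And>x i. x \<in> S \<Longrightarrow> i < l \<Longrightarrow> int p dvd poly ((pderiv ^^ i) h) x"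
  shows "card S * l \<le> degree h"
proof -
  let ?A = "(\<Prod>x\<in>S. [:-x, 1:]) ^ l"
  have "lead_coeff ?A = 1" by (simp add: lead_coeff_power lead_coeff_prod)
  moreover have "dvd_mod p ?A h"
    using roots by (intro prod_linear_powers_dvd_mod p S linear_power_dvd_mod_of_higher_pderiv l)
  ultimately have "degree ?A \<le> degree h" using degree_le_of_monic_dvd_mod[OF p] h by blast
  moreover have "degree ?A = card S * l"
    using S(1) by (subst degree_power_eq) (auto simp: degree_prod_sum_eq)
  ultimately show ?thesis by simp
qed

lemma freshmans_dream_mod:
  assumes "prime p"
  shows "[:int p:] dvd (f + g) ^ p - (f ^ p + g ^ p)"
proof -
  have p_gt_1: "p > 1" using assms by (rule prime_gt_1_nat)
  define t where "t k = of_nat (p choose k) * f ^ k * g ^ (p - k)" for k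
  have "(f + g) ^ p = (\<Sum>k\<le>p. t k)" unfolding t_def by (rule binomial_ring)
  also have "{..p} = insert 0 (insert p {0<..<p})" using p_gt_1 by auto
  also have "sum t (insert 0 (insert p {0<..<p})) = t 0 + (t p + sum t {0<..<p})"
    using p_gt_1 by (subst sum.insert; simp)+
  also have "\<dots> = f ^ p + g ^ p + sum t {0<..<p}" by (simp add: t_def)
  finally have "(f + g) ^ p - (f ^ p + g ^ p) = sum t {0<..<p}" by simp
  also have "[:int p:] dvd sum t {0<..<p}"
  proof (intro dvd_sum)
    fix k assume "k \<in> {0<..<p}"
    then have "p dvd p choose k" using assms by (intro dvd_choose_prime) auto
    then have "[:int p:] dvd of_nat (p choose k)" by (simp add: of_nat_poly)
    then show "[:int p:] dvd t k" by (simp add: t_def)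
  qed
  finally show ?thesis .
qed

section \<open>Character sums by Stepanov's method\<close>

definition shifted_prod :: "int set \<Rightarrow> int poly" where
  "shifted_prod H = (\<Prod>h\<in>H. [:h, 1:])"

lemma shifted_prod_insert: "finite H \<Longrightarrow> h \<notin> H \<Longrightarrow> shifted_prod (insert h H) = [:h, 1:] * shifted_prod H"
  unfolding shifted_prod_def by (rule prod.insert)

lemma degree_shifted_prod: "finite H \<Longrightarrow> degree (shifted_prod H) = card H"
  by (simp add: shifted_prod_def degree_prod_sum_eq)

lemma lead_coeff_shifted_prod: "lead_coeff (shifted_prod H) = 1"
  by (simp add: shifted_prod_def lead_coeff_prod)

lemma poly_shifted_prod: "poly (shifted_prod H) x = (\<Prod>h\<in>H. h + x)"
  by (simp add: shifted_prod_def poly_prod)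

lemma shifted_prod_power_p:
  assumes p: "prime p" and "finite H" and "\<And>h. h \<in> H \<Longrightarrow> \<not> int p dvd h"
  obtains c w where "[:int p:] dvd shifted_prod H ^ p - ([:c:] + monom 1 p * w)" "\<not> int p dvd c"
proof -
  have "\<exists>c w. [:int p:] dvd shifted_prod H ^ p - ([:c:] + monom 1 p * w) \<and> \<not> int p dvd c"
    using assms(2,3)
  proof (induction H rule: finite_induct)
    case empty
    have "[:int p:] dvd shifted_prod {} ^ p - ([:1:] + monom 1 p * 0)" by (simp add: shifted_prod_def flip: one_pCons)
    moreover have "\<not> int p dvd 1" using p by (auto simp: prime_nat_iff)
    ultimately show ?case by blast
  next
    case (insert h H)
    then obtain c w where cw: "[:int p:] dvd shifted_prod H ^ p - ([:c:] + monom 1 p * w)" "\<not> int p dvd c"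
      by auto
    have "[:h, 1:] = [:h:] + monom 1 1" by (simp add: monom_altdef)
    then have "[:int p:] dvd [:h, 1:] ^ p - ([:h ^ p:] + monom 1 p)"
      using freshmans_dream_mod[OF p, of "[:h:]" "monom 1 1"] by (simp add: poly_const_pow monom_power)
    from const_poly_dvd_mult_diff[OF this cw(1)]
    have "[:int p:] dvd shifted_prod (insert h H) ^ p - ([:h ^ p:] + monom 1 p) * ([:c:] + monom 1 p * w)"
      unfolding shifted_prod_insert[OF insert.hyps] power_mult_distrib .
    also have "([:h ^ p:] + monom 1 p) * ([:c:] + monom 1 p * w)
         = [:h ^ p * c:] + monom 1 p * ([:h ^ p:] * w + [:c:] + monom 1 p * w)"
      by (simp add: algebra_simps)
    finally show ?case using cw(2) insert.prems[of h] p
      by (metis insertI1 prime_dvd_mult_iff prime_dvd_power prime_nat_int_transfer)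
  qed
  then show ?thesis using that by blast
qed

lemma square_times_linear_mod_descent:
  assumes p: "prime p" and F: "\<not> int p dvd poly F x" and c: "\<not> int p dvd c"
    and eq: "[:int p:] dvd r ^ 2 * ([:-x, 1:] * F) - [:c:] * s ^ 2"
  obtains r' where "[:int p:] dvd s - [:-x, 1:] * synthetic_div s x"
    "[:int p:] dvd r' ^ 2 * ([:-x, 1:] * F) - [:c:] * synthetic_div s x ^ 2"
proof -
  let ?Y = "[:-x, 1:]"
  define s' where "s' = synthetic_div s x"
  have not_dvd_Y: "\<not> [:int p:] dvd ?Y" by (rule const_poly_not_dvd_monic[OF p]) simp
  have "int p dvd poly (r ^ 2 * (?Y * F) - [:c:] * s ^ 2) x" using eq by (rule const_poly_dvd_poly)
  then have "int p dvd c * poly s x ^ 2" by simp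
  then have "int p dvd poly s x"
    using c p by (metis prime_dvd_mult_iff prime_dvd_power prime_nat_int_transfer)
  then have s': "[:int p:] dvd s - ?Y * s'" unfolding s'_def by (rule const_poly_dvd_diff_synthetic_div)
  have "[:int p:] dvd (r ^ 2 * (?Y * F) - [:c:] * s ^ 2) + [:c:] * (s * s - (?Y * s') * (?Y * s'))"
    by (intro dvd_add eq dvd_mult const_poly_dvd_mult_diff s')
  also have "\<dots> = ?Y * (r ^ 2 * F - [:c:] * (?Y * s' ^ 2))"
    by (simp only: power2_eq_square algebra_simps)
  finally have quotient: "[:int p:] dvd r ^ 2 * F - [:c:] * (?Y * s' ^ 2)"
    using not_dvd_Y p by (simp only: const_poly_dvd_mult_iff) blast
  then have "int p dvd poly (r ^ 2 * F - [:c:] * (?Y * s' ^ 2)) x" by (rule const_poly_dvd_poly)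
  then have "int p dvd poly r x ^ 2 * poly F x" by simp
  then have "int p dvd poly r x"
    using F p by (metis prime_dvd_mult_iff prime_dvd_power prime_nat_int_transfer)
  then have r': "[:int p:] dvd r - ?Y * synthetic_div r x" by (rule const_poly_dvd_diff_synthetic_div)
  have "[:int p:] dvd (r ^ 2 * F - [:c:] * (?Y * s' ^ 2)) - (r * r - (?Y * synthetic_div r x) * (?Y * synthetic_div r x)) * F"
    by (intro dvd_diff quotient dvd_mult2 const_poly_dvd_mult_diff r')
  also have "\<dots> = ?Y * (synthetic_div r x ^ 2 * (?Y * F) - [:c:] * s' ^ 2)"
    by (simp only: power2_eq_square algebra_simps)
  finally have "[:int p:] dvd synthetic_div r x ^ 2 * (?Y * F) - [:c:] * s' ^ 2"
    using not_dvd_Y p by (simp only: const_poly_dvd_mult_iff) blast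
  then show ?thesis using that s' by (simp only: s'_def)
qed

text \<open>Descent on the degree: each root of the squarefree polynomial would have to occur to an odd order
  on one side and to an even order on the other.\<close>

lemma square_times_shifted_prod_mod:
  assumes p: "prime p" and H: "finite H" "H \<noteq> {}" and inj_mod: "inj_on (\<lambda>h. h mod int p) H"
    and c: "\<not> int p dvd c" and eq: "[:int p:] dvd r ^ 2 * shifted_prod H - [:c:] * s ^ 2"
  shows "[:int p:] dvd r" "[:int p:] dvd s"
proof -
  obtain h where h: "h \<in> H" using H(2) by blast
  define F where "F = shifted_prod (H - {h})"
  have prod_eq: "shifted_prod H = [:-(-h), 1:] * F"
    using H h shifted_prod_insert[of "H - {h}" h] by (simp add: F_def insert_absorb)
  have F: "\<not> int p dvd poly F (-h)"
  proof
    assume "int p dvd poly F (-h)"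
    then have "int p dvd (\<Prod>k\<in>H - {h}. k - h)" by (simp add: F_def poly_shifted_prod)
    then obtain k where "k \<in> H - {h}" "int p dvd k - h"
      using p H by (auto simp: prime_dvd_prod_iff)
    then show False using inj_mod h by (auto simp: inj_on_mod_iff)
  qed
  show s: "[:int p:] dvd s"
    using eq
  proof (induction "degree s" arbitrary: r s rule: less_induct)
    case less
    obtain r' where s': "[:int p:] dvd s - [:-(-h), 1:] * synthetic_div s (-h)"
      and r': "[:int p:] dvd r' ^ 2 * shifted_prod H - [:c:] * synthetic_div s (-h) ^ 2"
      using square_times_linear_mod_descent[OF p F c] less.prems unfolding prod_eq by metis
    have "[:int p:] dvd synthetic_div s (-h)"
    proof (cases "degree s = 0")
      case True
      then have "synthetic_div s (-h) = 0" by (simp add: synthetic_div_eq_0_iff)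
      then show ?thesis by simp
    next
      case False
      then show ?thesis using less.hyps r' by (simp add: degree_synthetic_div)
    qed
    then have "[:int p:] dvd (s - [:-(-h), 1:] * synthetic_div s (-h)) + [:-(-h), 1:] * synthetic_div s (-h)"
      by (intro dvd_add s' dvd_mult)
    then show ?case by (simp only: diff_add_cancel)
  qed
  then have "[:int p:] dvd (r ^ 2 * shifted_prod H - [:c:] * s ^ 2) + [:c:] * s ^ 2"
    unfolding power2_eq_square[of s] by (intro dvd_add eq[unfolded power2_eq_square[of s]] dvd_mult)
  then have "[:int p:] dvd r ^ 2 * shifted_prod H" by (simp only: diff_add_cancel)
  then show "[:int p:] dvd r"
    using p const_poly_dvd_powerD const_poly_not_dvd_monic[OF p lead_coeff_shifted_prod]
    by (auto simp: const_poly_dvd_mult_iff)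
qed

lemma leading_block_mod:
  fixes R S :: "nat \<Rightarrow> int poly"
  assumes p: "prime p" and k: "k < J"
    and zero: "[:int p:] dvd (\<Sum>j<J. (R j + S j * F) * monom 1 (p * j))"
    and lower: "\<And>j. j < k \<Longrightarrow> [:int p:] dvd R j \<and> [:int p:] dvd S j"
  obtains A B where "[:int p:] dvd (R k + monom 1 p * A) + (S k + monom 1 p * B) * F"
proof -
  define t where "t j = (R j + S j * F) * monom 1 (p * j)" for j
  define A where "A = (\<Sum>j\<in>{Suc k..<J}. R j * monom 1 (p * (j - Suc k)))"
  define B where "B = (\<Sum>j\<in>{Suc k..<J}. S j * monom 1 (p * (j - Suc k)))"
  have "(\<Sum>j<J. t j) = (\<Sum>j<k. t j) + (\<Sum>j\<in>{k..<J}. t j)"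
    using sum.atLeastLessThan_concat[of 0 k J t] k by (simp add: lessThan_atLeast0)
  moreover have "[:int p:] dvd (\<Sum>j<k. t j)"
    using lower by (intro dvd_sum) (auto simp: t_def intro!: dvd_mult2 dvd_add)
  ultimately have upper: "[:int p:] dvd (\<Sum>j\<in>{k..<J}. t j)"
    using zero by (simp add: t_def dvd_add_right_iff)
  have "t j = monom 1 (p * k) * (monom 1 p * (R j * monom 1 (p * (j - Suc k)) + S j * monom 1 (p * (j - Suc k)) * F))"
    if j: "j \<in> {Suc k..<J}" for j
  proof -
    obtain i where "j = Suc k + i" using j le_Suc_ex[of "Suc k" j] by auto
    then have "p * j = p * k + (p + p * (j - Suc k))" by (simp add: algebra_simps)
    then have "monom 1 (p * j) = monom 1 (p * k) * (monom 1 p * monom (1::int) (p * (j - Suc k)))"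
      by (simp add: mult_monom)
    then show ?thesis by (simp only: t_def algebra_simps)
  qed
  then have "(\<Sum>j\<in>{Suc k..<J}. t j) = monom 1 (p * k) * (monom 1 p * (A + B * F))"
    by (simp add: A_def B_def sum_distrib_left sum_distrib_right sum.distrib algebra_simps)
  moreover have "(\<Sum>j\<in>{k..<J}. t j) = t k + (\<Sum>j\<in>{Suc k..<J}. t j)"
    using k by (simp add: sum.atLeast_Suc_lessThan)
  ultimately have "(\<Sum>j\<in>{k..<J}. t j) = monom 1 (p * k) * ((R k + monom 1 p * A) + (S k + monom 1 p * B) * F)"
    by (simp only: t_def algebra_simps)
  then have "[:int p:] dvd (R k + monom 1 p * A) + (S k + monom 1 p * B) * F"
    using upper p const_poly_not_dvd_monic[OF p, of "monom 1 (p * k)"]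
    by (auto simp: const_poly_dvd_mult_iff degree_monom_eq)
  then show ?thesis using that by blast
qed

text \<open>Multiplying by the conjugate \<open>U - V f\<^bsup>(p-1)/2\<^esup>\<close> and by \<open>f\<close> turns the relation \<open>U + V f\<^bsup>(p-1)/2\<^esup> \<equiv> 0\<close> into
  \<open>U\<^sup>2 f \<equiv> V\<^sup>2 f\<^sup>p\<close>, whose low-order terms involve only \<open>R\<close>, \<open>S\<close> and the constant term of \<open>f\<^sup>p\<close>.\<close>

lemma block_vanishes_mod:
  fixes R S A B :: "int poly"
  assumes p: "prime p" "odd p" and H: "finite H" "H \<noteq> {}"
    and zero_notin: "\<And>h. h \<in> H \<Longrightarrow> \<not> int p dvd h" and inj_mod: "inj_on (\<lambda>h. h mod int p) H"
    and deg: "degree R < d" "degree S < d" "2 * d + card H \<le> p"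
    and zero: "[:int p:] dvd (R + monom 1 p * A) + (S + monom 1 p * B) * shifted_prod H ^ ((p - 1) div 2)"
  shows "[:int p:] dvd R" "[:int p:] dvd S"
proof -
  define f where "f = shifted_prod H"
  define E where "E = (p - 1) div 2"
  define U V where "U = R + monom 1 p * A" and "V = S + monom 1 p * B"
  have E: "2 * E + 1 = p" using p by (auto simp: E_def elim: oddE)
  obtain c w where cw: "[:int p:] dvd f ^ p - ([:c:] + monom 1 p * w)" "\<not> int p dvd c"
    using shifted_prod_power_p[OF p(1) H(1) zero_notin] unfolding f_def by metis
  have "[:int p:] dvd (U + V * f ^ E) * ((U - V * f ^ E) * f)"
    using zero unfolding U_def V_def f_def E_def by (rule dvd_mult2)
  also have "(U + V * f ^ E) * ((U - V * f ^ E) * f) = U ^ 2 * f - V ^ 2 * f ^ (2 * E + 1)"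
    by (simp only: power_add power_one_right mult_2 power2_eq_square) (simp add: algebra_simps)
  finally have "[:int p:] dvd U ^ 2 * f - V ^ 2 * f ^ p" unfolding E .
  then have "[:int p:] dvd U ^ 2 * f - V ^ 2 * f ^ p + V ^ 2 * (f ^ p - ([:c:] + monom 1 p * w))"
    by (intro dvd_add dvd_mult cw)
  also have "\<dots> = (R ^ 2 * f - [:c:] * S ^ 2)
      + monom 1 p * ((2 * R * A + monom 1 p * A ^ 2) * f - (2 * S * B + monom 1 p * B ^ 2) * [:c:] - V ^ 2 * w)"
    unfolding U_def V_def by (simp only: power2_eq_square algebra_simps mult_2)
  finally have "[:int p:] dvd R ^ 2 * f - [:c:] * S ^ 2"
  proof (rule const_poly_dvd_low_degree)
    have square: "degree (g ^ 2) \<le> 2 * degree g" for g :: "int poly"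
      using degree_power_le[of g 2] by (simp add: mult.commute)
    have "degree (R ^ 2 * f) \<le> degree (R ^ 2) + degree f" by (rule degree_mult_le)
    then have "degree (R ^ 2 * f) < p"
      using square[of R] deg H by (simp add: f_def degree_shifted_prod)
    moreover have "degree ([:c:] * S ^ 2) < p"
      using degree_smult_le[of c "S ^ 2"] square[of S] deg by simp
    ultimately show "degree (R ^ 2 * f - [:c:] * S ^ 2) < p" by (rule degree_diff_less)
  qed
  from square_times_shifted_prod_mod[OF p(1) H inj_mod cw(2) this[unfolded f_def]]
  show "[:int p:] dvd R" "[:int p:] dvd S" .
qed

lemma blocks_vanish_mod:
  fixes R S :: "nat \<Rightarrow> int poly"
  assumes p: "prime p" "odd p" and H: "finite H" "H \<noteq> {}"
    and zero_notin: "\<And>h. h \<in> H \<Longrightarrow> \<not> int p dvd h" and inj_mod: "inj_on (\<lambda>h. h mod int p) H"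
    and deg: "\<And>j. degree (R j) < d" "\<And>j. degree (S j) < d" and d: "2 * d + card H \<le> p"
    and zero: "[:int p:] dvd (\<Sum>j<J. (R j + S j * shifted_prod H ^ ((p - 1) div 2)) * monom 1 (p * j))"
    and "j < J"
  shows "[:int p:] dvd R j \<and> [:int p:] dvd S j"
  using \<open>j < J\<close>
proof (induction j rule: less_induct)
  case (less k)
  obtain A B where "[:int p:] dvd (R k + monom 1 p * A) + (S k + monom 1 p * B) * shifted_prod H ^ ((p - 1) div 2)"
    using leading_block_mod[OF p(1) less.prems zero] less by (metis less_trans)
  then show ?case using block_vanishes_mod[OF p H zero_notin inj_mod deg d] by blast
qed

text \<open>The cofactor of \<^term>\<open>f ^ (e - i)\<close> in the \<open>i\<close>-th derivative of \<^term>\<open>r * f ^ e\<close>.\<close>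

fun deriv_cofactor :: "int poly \<Rightarrow> nat \<Rightarrow> int poly \<Rightarrow> nat \<Rightarrow> int poly" where
  "deriv_cofactor f e r 0 = r"
| "deriv_cofactor f e r (Suc i) =
     pderiv (deriv_cofactor f e r i) * f + of_nat (e - i) * (deriv_cofactor f e r i * pderiv f)"

lemma deriv_cofactor_diff:
  "deriv_cofactor f e (r - s) i = deriv_cofactor f e r i - deriv_cofactor f e s i"
proof (induction i)
  case (Suc i)
  show ?case by (simp only: deriv_cofactor.simps Suc.IH pderiv_diff) (simp add: algebra_simps)
qed simp

lemma degree_deriv_cofactor: "degree (deriv_cofactor f e r i) \<le> degree r + i * degree f"
proof (induction i)
  case (Suc i)
  let ?c = "deriv_cofactor f e r i"
  have "degree (pderiv ?c * f) \<le> degree ?c + degree f"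
    by (rule order_trans[OF degree_mult_le]) (simp add: degree_pderiv)
  moreover have "degree (of_nat (e - i) * (?c * pderiv f)) \<le> degree ?c + degree f"
  proof -
    have "degree (of_nat (e - i) * (?c * pderiv f)) \<le> degree (?c * pderiv f)"
      by (simp add: of_nat_poly degree_smult_le)
    also have "\<dots> \<le> degree ?c + degree (pderiv f)" by (rule degree_mult_le)
    finally show ?thesis by (simp add: degree_pderiv)
  qed
  ultimately have "degree (deriv_cofactor f e r (Suc i)) \<le> degree ?c + degree f"
    by (simp add: degree_add_le)
  then show ?case using Suc by simp
qed simp

lemma higher_pderiv_power_mod:
  assumes "i \<le> e"
  shows "[:int p:] dvd (pderiv ^^ i) (r * f ^ e * monom 1 (p * j)) -
           deriv_cofactor f e r i * f ^ (e - i) * monom 1 (p * j)"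
  using assms
proof (induction i)
  case (Suc i)
  let ?c = "deriv_cofactor f e r i" and ?X = "monom (1::int) (p * j)"
  obtain n where n: "e - i = Suc n" "e - Suc i = n" using Suc.prems by (cases "e - i") auto
  have "[:int p:] dvd (pderiv ^^ i) (r * f ^ e * ?X) - ?c * f ^ (e - i) * ?X" using Suc by simp
  from const_poly_dvd_pderiv[OF this]
  have IH: "[:int p:] dvd (pderiv ^^ Suc i) (r * f ^ e * ?X) - pderiv (?c * f ^ Suc n * ?X)"
    by (simp add: pderiv_diff n)
  have "[:int p:] dvd pderiv ?X" by (simp add: pderiv_monom const_poly_dvd_iff coeff_monom)
  then have "[:int p:] dvd ((pderiv ^^ Suc i) (r * f ^ e * ?X) - pderiv (?c * f ^ Suc n * ?X)) + ?c * f ^ Suc n * pderiv ?X"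
    by (intro dvd_add IH dvd_mult)
  also have "pderiv (?c * f ^ Suc n * ?X) =
     deriv_cofactor f e r (Suc i) * f ^ n * ?X + ?c * f ^ Suc n * pderiv ?X"
    by (simp only: deriv_cofactor.simps pderiv_mult pderiv_power_Suc n of_nat_poly) (simp add: algebra_simps)
  finally show ?case by (simp add: n algebra_simps)
qed simp

lemma fermat_int:
  assumes "prime p" shows "[(x::int) ^ p = x] (mod int p)"
proof -
  define y where "y = nat (x mod int p)"
  have p: "p > 0" using assms by (rule prime_gt_0_nat)
  have y: "[int y = x] (mod int p)" using p by (simp add: y_def cong_def)
  have "[y ^ p = y] (mod p)"
  proof (cases "p dvd y")
    case True
    then show ?thesis using p by (metis cong_0_iff cong_sym cong_trans dvd_power dvd_trans)
  next
    case False
    have "[y ^ (p - 1) * y = 1 * y] (mod p)" using fermat_theorem[OF assms False] by (rule cong_scalar_right)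
    then show ?thesis by (simp only: power_minus_mult[OF p] mult_1)
  qed
  then have "[int y ^ p = int y] (mod int p)" by (metis cong_int_iff of_nat_power)
  then show ?thesis using y by (meson cong_pow cong_sym cong_trans)
qed

lemma homogeneous_system_mod:
  fixes p :: nat and \<Phi> :: "('a \<Rightarrow> int) \<Rightarrow> 'b \<Rightarrow> int"
  assumes p: "p > 1" and I: "finite I" and K: "finite K" "card K < card I"
    and diff: "\<And>c c' k. \<Phi> (\<lambda>u. c u - c' u) k = \<Phi> c k - \<Phi> c' k"
  obtains c u where "u \<in> I" "\<not> int p dvd c u" "\<And>k. k \<in> K \<Longrightarrow> int p dvd \<Phi> c k"
proof -
  define C where "C = PiE I (\<lambda>_. {0..<int p})"
  define \<Psi> where "\<Psi> c = restrict (\<lambda>k. \<Phi> c k mod int p) K" for c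
  have "\<Psi> ` C \<subseteq> PiE K (\<lambda>_. {0..<int p})"
    unfolding \<Psi>_def using p by (intro image_subsetI) (simp add: restrict_PiE_iff)
  then have "card (\<Psi> ` C) \<le> card (PiE K (\<lambda>_. {0..<int p}))"
    using K by (intro card_mono finite_PiE) auto
  also have "\<dots> = p ^ card K" using K by (simp add: card_PiE)
  also have "\<dots> < p ^ card I" using p K by (intro power_strict_increasing) auto
  also have "\<dots> = card C" using I by (simp add: C_def card_PiE)
  finally have "\<not> inj_on \<Psi> C" using card_image by fastforce
  then obtain c c' where c: "c \<in> C" "c' \<in> C" "\<Psi> c = \<Psi> c'" "c \<noteq> c'" by (auto simp: inj_on_def)
  then obtain u where u: "u \<in> I" "c u \<noteq> c' u" unfolding C_def by (metis PiE_ext)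
  have "c u \<in> {0..<int p}" "c' u \<in> {0..<int p}" using c u unfolding C_def by (auto dest: PiE_mem)
  then have "\<not> int p dvd c u - c' u"
    using u(2) cong_less_imp_eq_int[of "c u" "int p" "c' u"] by (auto simp: cong_iff_dvd_diff)
  moreover have "int p dvd \<Phi> (\<lambda>u. c u - c' u) k" if "k \<in> K" for k
    using fun_cong[OF c(3), of k] that by (simp add: \<Psi>_def diff mod_eq_dvd_iff)
  ultimately show ?thesis using that[of u "\<lambda>u. c u - c' u"] u(1) by blast
qed

locale stepanov =
  fixes p d l J :: nat and H :: "int set" and a :: int
  assumes p: "prime p" "odd p" and H: "finite H" "H \<noteq> {}"
    and zero_notin: "\<And>h. h \<in> H \<Longrightarrow> \<not> int p dvd h" and inj_mod: "inj_on (\<lambda>h. h mod int p) H"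
    and d: "2 * d + card H \<le> p" "d > 0" and l: "l \<le> p"
    and many_unknowns: "l * (d + l * card H + J) < 2 * J * d"
begin

definition half :: nat where "half = (p - 1) div 2"

definition exponent :: "nat \<Rightarrow> nat" where "exponent \<epsilon> = l + \<epsilon> * half"

definition block :: "((nat \<times> nat) \<times> nat \<Rightarrow> int) \<Rightarrow> nat \<times> nat \<Rightarrow> int poly" where
  "block c v = (\<Sum>t<d. monom (c (v, t)) t)"

definition aux_poly :: "((nat \<times> nat) \<times> nat \<Rightarrow> int) \<Rightarrow> int poly" where
  "aux_poly c = (\<Sum>v\<in>{..<J} \<times> {..<2}. block c v * shifted_prod H ^ exponent (snd v) * monom 1 (p * fst v))"

text \<open>At the points where \<open>f\<^bsup>(p-1)/2\<^esup> \<equiv> a\<close>, the \<open>i\<close>-th derivative of the auxiliary polynomial is \<open>f\<^bsup>l-i\<^esup>\<close> times this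
  polynomial of much smaller degree, because also \<open>x\<^sup>p \<equiv> x\<close>.\<close>

definition reduced_deriv :: "((nat \<times> nat) \<times> nat \<Rightarrow> int) \<Rightarrow> nat \<Rightarrow> int poly" where
  "reduced_deriv c i = (\<Sum>v\<in>{..<J} \<times> {..<2}.
     smult (a ^ snd v) (deriv_cofactor (shifted_prod H) (exponent (snd v)) (block c v) i * monom 1 (fst v)))"

lemma coeff_block: "coeff (block c v) t = (if t < d then c (v, t) else 0)"
  by (simp add: block_def coeff_sum)

lemma degree_block: "degree (block c v) < d"
  using d(2) by (intro degree_lessI) (auto simp: coeff_block)

lemma reduced_deriv_diff: "reduced_deriv (\<lambda>u. c u - c' u) i = reduced_deriv c i - reduced_deriv c' i"
proof -
  have "block (\<lambda>u. c u - c' u) v = block c v - block c' v" for v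
    by (rule poly_eqI) (simp add: coeff_block)
  then show ?thesis
    by (simp add: reduced_deriv_def deriv_cofactor_diff smult_diff_right left_diff_distrib sum_subtractf)
qed

lemma degree_reduced_deriv:
  assumes "i < l"
  shows "degree (reduced_deriv c i) < d + l * card H + J"
  unfolding reduced_deriv_def
proof (rule degree_sum_less)
  fix v assume v: "v \<in> {..<J} \<times> {..<2::nat}"
  let ?c = "deriv_cofactor (shifted_prod H) (exponent (snd v)) (block c v) i"
  have "degree (smult (a ^ snd v) (?c * monom 1 (fst v))) \<le> degree (?c * monom 1 (fst v))"
    by (rule degree_smult_le)
  also have "\<dots> \<le> degree ?c + degree (monom (1::int) (fst v))" by (rule degree_mult_le)
  also have "degree (monom (1::int) (fst v)) < J" using v by (auto simp: degree_monom_eq)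
  also have "degree ?c \<le> degree (block c v) + i * card H"
    using degree_deriv_cofactor[of "shifted_prod H"] H by (metis degree_shifted_prod)
  also have "i * card H \<le> l * card H" using assms by simp
  finally show "degree (smult (a ^ snd v) (?c * monom 1 (fst v))) < d + l * card H + J"
    using degree_block[of c v] by simp
qed (use d in simp)

lemma ex_reduced_derivs_vanish:
  "\<exists>c. (\<exists>v\<in>{..<J} \<times> {..<2}. \<not> [:int p:] dvd block c v) \<and> (\<forall>i<l. [:int p:] dvd reduced_deriv c i)"
proof -
  let ?I = "({..<J} \<times> {..<2::nat}) \<times> {..<d}" and ?K = "{..<l} \<times> {..<d + l * card H + J}"
  obtain c u where c: "u \<in> ?I" "\<not> int p dvd c u" "\<And>k. k \<in> ?K \<Longrightarrow> int p dvd coeff (reduced_deriv c (fst k)) (snd k)"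
  proof (rule homogeneous_system_mod[of p ?I ?K "\<lambda>c k. coeff (reduced_deriv c (fst k)) (snd k)"])
    show "p > 1" using p(1) by (rule prime_gt_1_nat)
    show "card ?K < card ?I" using many_unknowns by (simp add: card_cartesian_product)
  qed (auto simp: reduced_deriv_diff)
  obtain v t where u: "u = (v, t)" by (metis surj_pair)
  have "coeff (block c v) t = c u" using c(1) by (simp add: coeff_block u)
  then have "\<not> [:int p:] dvd block c v" using c(2) by (metis const_poly_dvd_iff)
  moreover have "[:int p:] dvd reduced_deriv c i" if i: "i < l" for i
    unfolding const_poly_dvd_iff
  proof
    fix n
    show "int p dvd coeff (reduced_deriv c i) n"
    proof (cases "n < d + l * card H + J")
      case True
      then show ?thesis using c(3)[of "(i, n)"] i by simp
    next
      case False
      then show ?thesis using degree_reduced_deriv[OF i, of c] by (simp add: coeff_eq_0)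
    qed
  qed
  ultimately show ?thesis using c(1) u by blast
qed

lemma aux_poly_nonzero_mod:
  assumes v: "v \<in> {..<J} \<times> {..<2}" and block: "\<not> [:int p:] dvd block c v"
  shows "\<not> [:int p:] dvd aux_poly c"
proof
  let ?f = "shifted_prod H"
  assume zero: "[:int p:] dvd aux_poly c"
  have "aux_poly c = (\<Sum>j<J. \<Sum>\<epsilon><2. block c (j, \<epsilon>) * ?f ^ exponent \<epsilon> * monom 1 (p * j))"
    by (simp add: aux_poly_def sum.cartesian_product split_beta)
  also have "\<dots> = ?f ^ l * (\<Sum>j<J. (block c (j, 0) + block c (j, 1) * ?f ^ half) * monom 1 (p * j))"
    by (simp add: exponent_def numeral_2_eq_2 power_add sum_distrib_left algebra_simps)
  finally have "[:int p:] dvd (\<Sum>j<J. (block c (j, 0) + block c (j, 1) * ?f ^ half) * monom 1 (p * j))"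
    using zero p const_poly_dvd_powerD const_poly_not_dvd_monic[OF p(1) lead_coeff_shifted_prod]
    by (auto simp: const_poly_dvd_mult_iff)
  then have "[:int p:] dvd block c (j, 0) \<and> [:int p:] dvd block c (j, 1)" if "j < J" for j
    unfolding half_def using that degree_block by (intro blocks_vanish_mod[OF p H zero_notin inj_mod _ _ d(1)])
  then show False using v block by (auto simp: less_2_cases_iff)
qed

lemma degree_aux_poly: "degree (aux_poly c) \<le> p * J + card H * (l + p)"
  unfolding aux_poly_def
proof (intro degree_sum_le)
  fix v assume v: "v \<in> {..<J} \<times> {..<2::nat}"
  have "degree (block c v * shifted_prod H ^ exponent (snd v) * monom 1 (p * fst v))
      \<le> degree (block c v * shifted_prod H ^ exponent (snd v)) + degree (monom (1::int) (p * fst v))"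
    by (rule degree_mult_le)
  also have "\<dots> \<le> degree (block c v) + degree (shifted_prod H ^ exponent (snd v)) + p * fst v"
    by (intro add_mono degree_mult_le) (simp add: degree_monom_eq)
  also have "degree (shifted_prod H ^ exponent (snd v)) \<le> card H * exponent (snd v)"
    using degree_power_le[of "shifted_prod H"] H by (metis degree_shifted_prod)
  also have "exponent (snd v) \<le> l + p"
    using v by (auto simp: exponent_def half_def less_2_cases_iff mem_Times_iff)
  finally have "degree (block c v * shifted_prod H ^ exponent (snd v) * monom 1 (p * fst v))
      \<le> (p + p * fst v) + card H * (l + p)"
    using degree_block[of c v] d(1) by simp
  also have "p + p * fst v \<le> p * J" using v mult_le_mono2[of "Suc (fst v)" J p] by auto
  finally show "degree (block c v * shifted_prod H ^ exponent (snd v) * monom 1 (p * fst v)) \<le> p * J + card H * (l + p)"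
    by simp
qed auto

lemma poly_higher_pderiv_aux_poly_cong:
  assumes x: "[(\<Prod>h\<in>H. h + x) ^ half = a] (mod int p)" and i: "i < l"
  shows "[poly ((pderiv ^^ i) (aux_poly c)) x = (\<Prod>h\<in>H. h + x) ^ (l - i) * poly (reduced_deriv c i) x] (mod int p)"
proof -
  let ?V = "{..<J} \<times> {..<2::nat}" and ?f = "shifted_prod H" and ?y = "\<Prod>h\<in>H. h + x"
  let ?g = "\<lambda>v. deriv_cofactor ?f (exponent (snd v)) (block c v) i"
  have "(pderiv ^^ i) (aux_poly c) - (\<Sum>v\<in>?V. ?g v * ?f ^ (exponent (snd v) - i) * monom 1 (p * fst v)) =
      (\<Sum>v\<in>?V. (pderiv ^^ i) (block c v * ?f ^ exponent (snd v) * monom 1 (p * fst v))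
        - ?g v * ?f ^ (exponent (snd v) - i) * monom 1 (p * fst v))"
    by (simp add: aux_poly_def higher_pderiv_sum sum_subtractf)
  also have "[:int p:] dvd \<dots>"
    using i by (intro dvd_sum higher_pderiv_power_mod) (simp add: exponent_def)
  finally have "[poly ((pderiv ^^ i) (aux_poly c)) x =
      (\<Sum>v\<in>?V. poly (?g v) x * ?y ^ (exponent (snd v) - i) * x ^ (p * fst v))] (mod int p)"
    using const_poly_dvd_poly[of "int p" _ x] by (fastforce simp: cong_iff_dvd_diff poly_sum poly_monom poly_shifted_prod)
  also have "[(\<Sum>v\<in>?V. poly (?g v) x * ?y ^ (exponent (snd v) - i) * x ^ (p * fst v)) =
      (\<Sum>v\<in>?V. poly (?g v) x * (?y ^ (l - i) * a ^ snd v) * x ^ fst v)] (mod int p)"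
  proof (intro cong_sum cong_mult cong_refl)
    fix v :: "nat \<times> nat"
    have "exponent (snd v) - i = (l - i) + half * snd v" using i by (simp add: exponent_def mult.commute)
    then show "[?y ^ (exponent (snd v) - i) = ?y ^ (l - i) * a ^ snd v] (mod int p)"
      using x by (simp add: power_add power_mult cong_mult cong_pow)
    show "[x ^ (p * fst v) = x ^ fst v] (mod int p)"
      using cong_pow[OF fermat_int[OF p(1), of x]] by (simp add: power_mult)
  qed
  also have "(\<Sum>v\<in>?V. poly (?g v) x * (?y ^ (l - i) * a ^ snd v) * x ^ fst v) = ?y ^ (l - i) * poly (reduced_deriv c i) x"
    by (simp add: reduced_deriv_def poly_sum poly_monom sum_distrib_left algebra_simps)
  finally show ?thesis .
qed

lemma card_shifted_prod_power_eq_le: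
  "card {x\<in>{0..<int p}. [(\<Prod>h\<in>H. h + x) ^ half = a] (mod int p)} * l \<le> p * J + card H * (l + p)"
proof -
  let ?S = "{x\<in>{0..<int p}. [(\<Prod>h\<in>H. h + x) ^ half = a] (mod int p)}"
  obtain c v where c: "v \<in> {..<J} \<times> {..<2}" "\<not> [:int p:] dvd block c v" "\<forall>i<l. [:int p:] dvd reduced_deriv c i"
    using ex_reduced_derivs_vanish by blast
  have "card ?S * l \<le> degree (aux_poly c)"
  proof (rule card_roots_le_degree_mod[OF p(1) _ _ aux_poly_nonzero_mod[OF c(1,2)] l])
    show "inj_on (\<lambda>x. x mod int p) ?S" by (auto simp: inj_on_def)
    show "int p dvd poly ((pderiv ^^ i) (aux_poly c)) x" if "x \<in> ?S" "i < l" for x i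
      using that cong_dvd_iff[OF poly_higher_pderiv_aux_poly_cong[of x i c]] const_poly_dvd_poly[of "int p" _ x] c(3)
      by simp
  qed (auto intro: finite_subset[of _ "{0..<int p}"])
  also have "\<dots> \<le> p * J + card H * (l + p)" by (rule degree_aux_poly)
  finally show ?thesis .
qed

end

lemma Legendre_cong:
  assumes "[a = b] (mod p)" shows "Legendre a p = Legendre b p"
proof -
  have "[a = 0] (mod p) \<longleftrightarrow> [b = 0] (mod p)" "QuadRes p a \<longleftrightarrow> QuadRes p b"
    using assms by (auto simp: QuadRes_def) (meson cong_trans cong_sym)+
  then show ?thesis by (simp add: Legendre_def)
qed

lemma Legendre_values: "Legendre a p \<in> {-1, 0, 1}"
  by (simp add: Legendre_def)

lemma Legendre_eqI:
  assumes "p > 2" "s \<in> {-1, 0, 1}" "[Legendre a p = s] (mod p)"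
  shows "Legendre a p = s"
proof -
  have "\<bar>Legendre a p - s\<bar> < p" using Legendre_values[of a p] assms(1,2) by auto
  then show ?thesis using assms(3) dvd_imp_le_int[of "Legendre a p - s" p] by (auto simp: cong_iff_dvd_diff)
qed

lemma Legendre_eq_iff_power:
  assumes "prime p" "p > 2" "s \<in> {-1, 1}"
  shows "Legendre a (int p) = s \<longleftrightarrow> [a ^ ((p - 1) div 2) = s] (mod int p)"
proof
  assume "Legendre a (int p) = s"
  then show "[a ^ ((p - 1) div 2) = s] (mod int p)"
    using euler_criterion[OF assms(1,2), of a] by (simp add: cong_sym)
next
  assume "[a ^ ((p - 1) div 2) = s] (mod int p)"
  then have "[Legendre a (int p) = s] (mod int p)"
    using euler_criterion[OF assms(1,2), of a] cong_trans by blast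
  then show "Legendre a (int p) = s" using assms by (intro Legendre_eqI) auto
qed

lemma Legendre_mult:
  assumes "prime p" "p > 2"
  shows "Legendre (a * b) (int p) = Legendre a (int p) * Legendre b (int p)"
proof (rule Legendre_eqI)
  have "[Legendre (a * b) (int p) = (a * b) ^ ((p - 1) div 2)] (mod int p)" by (rule euler_criterion[OF assms])
  moreover have "[Legendre a (int p) * Legendre b (int p) = a ^ ((p - 1) div 2) * b ^ ((p - 1) div 2)] (mod int p)"
    by (intro cong_mult euler_criterion[OF assms])
  ultimately show "[Legendre (a * b) (int p) = Legendre a (int p) * Legendre b (int p)] (mod int p)"
    by (metis cong_sym cong_trans power_mult_distrib)
  show "Legendre a (int p) * Legendre b (int p) \<in> {-1, 0, 1}"
    using Legendre_values[of a "int p"] Legendre_values[of b "int p"] by auto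
qed (use assms in simp)

text \<open>The parameters are \<open>l \<approx> \<surd>p\<close>, \<open>d \<approx> p / 2\<close> and \<open>J \<approx> l / 2 + 2 m\<close>.\<close>

lemma stepanov_many_unknowns:
  fixes l d J m p :: real
  assumes "0 \<le> m" "0 < p" "l * l \<le> p" "p / 2 \<le> 2 * d - l" "l + 4 * m + 3 \<le> 2 * J"
  shows "l * (d + l * m + J) < 2 * J * d"
proof -
  have "(4 * m + 2) * (p / 2) < (4 * m + 3) * (2 * d - l)"
    using assms by (intro mult_less_le_imp_less) auto
  moreover have "l * l * (2 * m + 1) \<le> p * (2 * m + 1)" using assms by (intro mult_right_mono) auto
  moreover have "(l + 4 * m + 3) * (2 * d - l) \<le> 2 * J * (2 * d - l)"
    using assms by (intro mult_right_mono) auto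
  ultimately show ?thesis by (simp add: algebra_simps)
qed

lemma stepanov_ratio_le:
  fixes l J m p :: real
  assumes m: "1 \<le> m" "21 * m \<le> sqrt p" and l: "0 < l" "20 * sqrt p \<le> 21 * l" and p: "0 \<le> p"
    and J: "2 * J \<le> l + 4 * m + 4"
  shows "(p * J + m * (l + p)) / l \<le> p / 2 + 6 * m * sqrt p"
proof -
  have "20 * p = sqrt p * (20 * sqrt p)" using p by simp
  also have "\<dots> \<le> sqrt p * (21 * l)" using l p by (intro mult_left_mono) auto
  finally have "p / l \<le> (21 / 20) * sqrt p" using l by (simp add: divide_le_eq mult_ac)
  then have "p / l * (3 * m + 2) \<le> (21 / 20) * sqrt p * (5 * m)"
    using m p by (intro mult_mono) auto
  moreover have "m * 21 \<le> m * sqrt p" using m by (intro mult_left_mono) auto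
  moreover have "(p * J + m * (l + p)) / l \<le> p / 2 + p / l * (3 * m + 2) + m"
  proof -
    have "p * (2 * J) \<le> p * (l + 4 * m + 4)" using J p by (intro mult_left_mono) auto
    then have "p * J + m * (l + p) \<le> (p / 2 + p / l * (3 * m + 2) + m) * l"
      using l by (simp add: algebra_simps)
    then show ?thesis using l by (simp add: divide_le_eq)
  qed
  moreover have "(21 / 20) * sqrt p * (5 * m) = 21 / 4 * (m * sqrt p)" "6 * m * sqrt p = 6 * (m * sqrt p)" by simp_all
  ultimately show ?thesis using m by linarith
qed

lemma stepanov_parameters:
  fixes p m :: nat
  assumes "441 * m^2 < p" "m > 0"
  obtains l d J where "2 * d + m \<le> p" "d > 0" "l \<le> p" "l * (d + l * m + J) < 2 * J * d" "l > 0"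
    "real (p * J + m * (l + p)) / l \<le> real p / 2 + 6 * m * sqrt p"
proof -
  define l where "l = nat \<lfloor>sqrt p\<rfloor>"
  define d where "d = (p - m) div 2"
  define J where "J = (l + 4 * m + 4) div 2"
  have "real (441 * m^2) < real p" using assms(1) by (simp only: of_nat_less_iff)
  then have "sqrt (441 * (real m)\<^sup>2) < sqrt p" by (intro real_sqrt_less_mono) simp
  then have sqrt_gt: "21 * m < sqrt p" by (simp add: real_sqrt_mult)
  have m_ge_1: "real m \<ge> 1" using assms by simp
  have "21 * sqrt p \<le> sqrt p * sqrt p" using sqrt_gt m_ge_1 by (intro mult_right_mono) auto
  then have sqrt_le: "21 * sqrt p \<le> p" by simp
  have l: "real l \<le> sqrt p" "sqrt p < real l + 1" unfolding l_def by (simp_all add: floor_less_cancel)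
  have d: "real (2 * d) \<ge> real p - m - 1" "2 * d + m \<le> p"
    using sqrt_gt sqrt_le m_ge_1 unfolding d_def by simp_all
  have J: "real (2 * J) \<ge> l + 4 * m + 3" "real (2 * J) \<le> l + 4 * m + 4"
    unfolding J_def by linarith+
  have two_d_minus_l: "real p / 2 \<le> 2 * real d - l" using d l sqrt_gt sqrt_le m_ge_1 by simp
  show ?thesis
  proof (rule that[of d l J])
    show "2 * d + m \<le> p" by fact
    have "real d > 0" using two_d_minus_l sqrt_le sqrt_gt m_ge_1 by simp
    then show "d > 0" by simp
    show "l \<le> p" using l sqrt_le by linarith
    show l_pos: "l > 0" using l sqrt_gt m_ge_1 by (cases l) auto
    have "real l * real l \<le> sqrt p * sqrt p" using l by (intro mult_mono) auto
    then have "real l * (real d + real l * real m + real J) < 2 * real J * real d"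
      using two_d_minus_l J(1) assms by (intro stepanov_many_unknowns[of "real m" "real p"]) auto
    then have "real (l * (d + l * m + J)) < real (2 * J * d)" by simp
    then show "l * (d + l * m + J) < 2 * J * d" by (simp only: of_nat_less_iff)
    have "(real p * real J + real m * (real l + real p)) / real l \<le> real p / 2 + 6 * real m * sqrt p"
      using l_pos l J(2) sqrt_gt m_ge_1 by (intro stepanov_ratio_le) auto
    then show "real (p * J + m * (l + p)) / l \<le> real p / 2 + 6 * m * sqrt p" by simp
  qed
qed

lemma card_Legendre_shifted_prod_eq_le:
  assumes p: "prime p" "odd p" and H: "finite H" "H \<noteq> {}" and zero_notin: "\<And>h. h \<in> H \<Longrightarrow> \<not> int p dvd h"
    and inj_mod: "inj_on (\<lambda>h. h mod int p) H" and large: "441 * (card H)^2 < p" and s: "s \<in> {-1, 1}"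
  shows "real (card {x\<in>{0..<int p}. Legendre (\<Prod>h\<in>H. h + x) (int p) = s}) \<le> real p / 2 + 6 * card H * sqrt p"
proof -
  have p_gt_2: "p > 2" using p prime_gt_1_nat[OF p(1)] by (cases "p = 2") auto
  obtain l d J where parameters: "2 * d + card H \<le> p" "d > 0" "l \<le> p" "l * (d + l * card H + J) < 2 * J * d" "l > 0"
    "real (p * J + card H * (l + p)) / l \<le> real p / 2 + 6 * card H * sqrt p"
    using stepanov_parameters[OF large] H by (metis card_gt_0_iff)
  interpret stepanov p d l J H s using p H zero_notin inj_mod parameters by unfold_locales
  have "real (card {x\<in>{0..<int p}. Legendre (\<Prod>h\<in>H. h + x) (int p) = s} * l) \<le> real (p * J + card H * (l + p))"
    unfolding Legendre_eq_iff_power[OF p(1) p_gt_2 s] half_def[symmetric] of_nat_le_iff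
    by (rule card_shifted_prod_power_eq_le)
  then have "real (card {x\<in>{0..<int p}. Legendre (\<Prod>h\<in>H. h + x) (int p) = s}) \<le> real (p * J + card H * (l + p)) / l"
    using parameters(5) by (simp add: le_divide_eq)
  then show ?thesis using parameters(6) by linarith
qed

lemma card_residue_translates_le:
  assumes "finite H"
  shows "card {x\<in>{0..<m::int}. \<exists>h\<in>H. m dvd h + x} \<le> card H"
proof -
  have "{x\<in>{0..<m}. \<exists>h\<in>H. m dvd h + x} \<subseteq> (\<lambda>h. (-h) mod m) ` H"
  proof
    fix x assume "x \<in> {x\<in>{0..<m}. \<exists>h\<in>H. m dvd h + x}"
    then obtain h where "h \<in> H" "m dvd x - (-h)" "x \<in> {0..<m}" by (auto simp: add.commute)
    then show "x \<in> (\<lambda>h. (-h) mod m) ` H" unfolding mod_eq_dvd_iff[symmetric] by auto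
  qed
  then show ?thesis using assms by (rule surj_card_le[rotated])
qed

lemma sum_signs_eq_card_diff:
  assumes "finite A" "\<And>x. x \<in> A \<Longrightarrow> F x \<in> {-1, 0, 1 :: int}"
  shows "(\<Sum>x\<in>A. F x) = int (card {x\<in>A. F x = 1}) - int (card {x\<in>A. F x = -1})"
    and "card A = card {x\<in>A. F x = 1} + card {x\<in>A. F x = -1} + card {x\<in>A. F x = 0}"
proof -
  have card_eq: "card {x\<in>A. P x} = (\<Sum>x\<in>A. if P x then 1 else 0)" for P
    using assms(1) by (simp add: sum.inter_filter[symmetric])
  show "(\<Sum>x\<in>A. F x) = int (card {x\<in>A. F x = 1}) - int (card {x\<in>A. F x = -1})"
    unfolding card_eq of_nat_sum sum_subtractf[symmetric] using assms(2) by (intro sum.cong refl) force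
  have "card A = (\<Sum>x\<in>A. 1)" by simp
  also have "\<dots> = card {x\<in>A. F x = 1} + card {x\<in>A. F x = -1} + card {x\<in>A. F x = 0}"
    unfolding card_eq sum.distrib[symmetric] using assms(2) by (intro sum.cong refl) force
  finally show "card A = card {x\<in>A. F x = 1} + card {x\<in>A. F x = -1} + card {x\<in>A. F x = 0}" .
qed

lemma Legendre_shifted_prod_sum_bound_nonzero:
  assumes p: "prime p" "odd p" and H: "finite H" "H \<noteq> {}" and zero_notin: "\<And>h. h \<in> H \<Longrightarrow> \<not> int p dvd h"
    and inj_mod: "inj_on (\<lambda>h. h mod int p) H" and large: "441 * (card H)^2 < p"
  shows "\<bar>real_of_int (\<Sum>x\<in>{0..<int p}. Legendre (\<Prod>h\<in>H. h + x) (int p))\<bar> \<le> 21 * card H * sqrt p"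
proof -
  define F where "F x = Legendre (\<Prod>h\<in>H. h + x) (int p)" for x
  define N where "N s = card {x\<in>{0..<int p}. F x = s}" for s
  have N_le: "real (N s) \<le> real p / 2 + 6 * (card H * sqrt p)" if "s \<in> {-1, 1}" for s
  proof -
    have "real (N s) \<le> real p / 2 + 6 * card H * sqrt p"
      unfolding N_def F_def by (rule card_Legendre_shifted_prod_eq_le[OF p H zero_notin inj_mod large that])
    then show ?thesis by simp
  qed
  have "{x\<in>{0..<int p}. F x = 0} \<subseteq> {x\<in>{0..<int p}. \<exists>h\<in>H. int p dvd h + x}"
    using p H by (auto simp: F_def Legendre_def cong_0_iff prime_dvd_prod_iff split: if_splits)
  then have "N 0 \<le> card {x\<in>{0..<int p}. \<exists>h\<in>H. int p dvd h + x}"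
    unfolding N_def by (intro card_mono) (auto intro: finite_subset[of _ "{0..<int p}"])
  also have "\<dots> \<le> card H" by (rule card_residue_translates_le[OF H(1)])
  finally have zeros: "real (N 0) \<le> card H" by simp
  have F: "F x \<in> {-1, 0, 1}" for x unfolding F_def by (rule Legendre_values)
  have "(\<Sum>x\<in>{0..<int p}. F x) = int (N 1) - int (N (-1))"
    using sum_signs_eq_card_diff(1)[of "{0..<int p}" F] F by (simp add: N_def)
  then have sum_eq: "real_of_int (\<Sum>x\<in>{0..<int p}. F x) = real (N 1) - real (N (-1))" by simp
  have "p = N 1 + N (-1) + N 0"
    using sum_signs_eq_card_diff(2)[of "{0..<int p}" F] F by (simp add: N_def)
  then have "real p = real (N 1) + real (N (-1)) + real (N 0)" by (metis of_nat_add)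
  moreover have "real (card H) * 1 \<le> real (card H) * sqrt p"
    using prime_gt_1_nat[OF p(1)] by (intro mult_left_mono) auto
  moreover have "real (N 1) \<le> real p / 2 + 6 * (card H * sqrt p)" "real (N (-1)) \<le> real p / 2 + 6 * (card H * sqrt p)"
    by (simp_all only: N_le insert_iff simp_thms)
  ultimately have "\<bar>real_of_int (\<Sum>x\<in>{0..<int p}. F x)\<bar> \<le> 13 * (real (card H) * sqrt p)"
    using zeros unfolding sum_eq abs_le_iff by linarith
  also have "\<dots> \<le> 21 * card H * sqrt p" by simp
  finally show ?thesis by (simp only: F_def)
qed

lemma bij_betw_add_mod:
  assumes "(n::int) > 0"
  shows "bij_betw (\<lambda>x. (x + c) mod n) {0..<n} {0..<n}"
proof (rule bij_betwI[where g = "\<lambda>x. (x - c) mod n"])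
  show "((x + c) mod n - c) mod n = x" if "x \<in> {0..<n}" for x
    using that by (simp add: mod_simps)
  show "((x - c) mod n + c) mod n = x" if "x \<in> {0..<n}" for x
    using that by (simp add: mod_simps)
qed (use assms in auto)

lemma sum_periodic_shift:
  assumes "(n::int) > 0" "\<And>x. F (x mod n) = F x"
  shows "(\<Sum>x\<in>{0..<n}. F (x + c)) = (\<Sum>x\<in>{0..<n}. F x)"
  using sum.reindex_bij_betw[OF bij_betw_add_mod[OF assms(1), of c], of F] assms(2) by simp

lemma Legendre_shifted_prod_sum_translate:
  assumes "p > 0"
  shows "(\<Sum>x\<in>{0..<p}. Legendre (\<Prod>h\<in>(\<lambda>h. h + c) ` H. h + x) p) = (\<Sum>x\<in>{0..<p::int}. Legendre (\<Prod>h\<in>H. h + x) p)"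
proof -
  define F where "F x = Legendre (\<Prod>h\<in>H. h + x) p" for x
  have "F (x mod p) = F x" for x
    unfolding F_def by (intro Legendre_cong cong_prod cong_add cong_refl) (simp add: cong_def)
  then have "(\<Sum>x\<in>{0..<p}. F (x + c)) = (\<Sum>x\<in>{0..<p}. F x)" using assms by (intro sum_periodic_shift)
  moreover have "F (x + c) = Legendre (\<Prod>h\<in>(\<lambda>h. h + c) ` H. h + x) p" for x
    by (simp add: F_def prod.reindex inj_on_def algebra_simps)
  ultimately show ?thesis by (simp add: F_def)
qed

theorem Legendre_shifted_prod_sum_bound:
  assumes p: "prime p" "odd p" and H: "finite H" "H \<noteq> {}" and inj_mod: "inj_on (\<lambda>h. h mod int p) H"
  shows "\<bar>real_of_int (\<Sum>x\<in>{0..<int p}. Legendre (\<Prod>h\<in>H. h + x) (int p))\<bar> \<le> 21 * card H * sqrt p"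
proof (cases "441 * (card H)^2 < p")
  case False
  have "\<bar>real_of_int (\<Sum>x\<in>{0..<int p}. Legendre (\<Prod>h\<in>H. h + x) (int p))\<bar> \<le> (\<Sum>x\<in>{0..<int p}. 1)"
    unfolding of_int_sum by (intro order_trans[OF sum_abs sum_mono]) (simp add: Legendre_def)
  also have "\<dots> = real p" by simp
  finally have "\<bar>real_of_int (\<Sum>x\<in>{0..<int p}. Legendre (\<Prod>h\<in>H. h + x) (int p))\<bar> \<le> real p" .
  also have "real p = sqrt p * sqrt p" by simp
  also have "\<dots> \<le> 21 * card H * sqrt p"
  proof (intro mult_right_mono)
    have "real p \<le> real (441 * (card H)^2)" using False by (simp only: of_nat_le_iff)
    then have "sqrt p \<le> sqrt (441 * (real (card H))\<^sup>2)" by (intro real_sqrt_le_mono) simp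
    then show "sqrt p \<le> 21 * card H" by (simp add: real_sqrt_mult)
  qed simp
  finally show ?thesis .
next
  case True
  then have "card H < p" using le_square[of "card H"] unfolding power2_eq_square by linarith
  then have "card {x\<in>{0..<int p}. \<exists>h\<in>H. int p dvd h + x} < card {0..<int p}"
    using card_residue_translates_le[OF H(1), of "int p"] by simp
  then have "{x\<in>{0..<int p}. \<exists>h\<in>H. int p dvd h + x} \<noteq> {0..<int p}" by force
  then obtain c where c: "\<And>h. h \<in> H \<Longrightarrow> \<not> int p dvd h + c" by blast
  have inj: "inj_on (\<lambda>h. h + c) H" by (auto simp: inj_on_def)
  have "inj_on (\<lambda>h. h mod int p) ((\<lambda>h. h + c) ` H)" using inj_mod by (auto simp: inj_on_mod_iff)
  then have "\<bar>real_of_int (\<Sum>x\<in>{0..<int p}. Legendre (\<Prod>h\<in>(\<lambda>h. h + c) ` H. h + x) (int p))\<bar> \<le> 21 * card ((\<lambda>h. h + c) ` H) * sqrt p"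
    using H c True card_image[OF inj] by (intro Legendre_shifted_prod_sum_bound_nonzero p) auto
  then show ?thesis
    using Legendre_shifted_prod_sum_translate[of "int p" c H] prime_gt_0_nat[OF p(1)] card_image[OF inj] by simp
qed

section \<open>Rough squarefree numbers\<close>

definition coprime_upto :: "nat set \<Rightarrow> nat \<Rightarrow> nat set" where
  "coprime_upto P z = {m\<in>{1..z}. \<forall>p\<in>P. \<not> p dvd m}"

lemma finite_coprime_upto: "finite (coprime_upto P z)"
  by (simp add: coprime_upto_def)

lemma sum_inverse_multiples_coprime_upto_le:
  fixes p z :: nat
  assumes "p > 0"
  shows "(\<Sum>m\<in>{m\<in>coprime_upto P z. p dvd m}. 1 / real m) \<le> 1 / p * (\<Sum>k\<in>coprime_upto P z. 1 / real k)"
proof -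
  let ?S = "coprime_upto P z"
  have "(\<Sum>m\<in>{m\<in>?S. p dvd m}. 1 / real m) = (\<Sum>m\<in>{m\<in>?S. p dvd m}. 1 / p * (1 / real (m div p)))"
    using assms by (intro sum.cong refl) (auto elim!: dvdE)
  also have "\<dots> = 1 / p * (\<Sum>k\<in>(\<lambda>m. m div p) ` {m\<in>?S. p dvd m}. 1 / real k)"
    using assms by (subst sum.reindex) (auto simp: inj_on_def sum_distrib_left elim!: dvdE)
  also have "\<dots> \<le> 1 / p * (\<Sum>k\<in>?S. 1 / real k)"
  proof (intro mult_left_mono sum_mono2 finite_coprime_upto image_subsetI)
    fix m assume m: "m \<in> {m\<in>?S. p dvd m}"
    then obtain k where k: "m = p * k" by auto
    have "k dvd m" "k > 0" "k \<le> m" "m div p = k" using m k assms by (auto simp: coprime_upto_def)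
    moreover have "m \<le> z" "\<forall>p\<in>P. \<not> p dvd m" using m by (auto simp: coprime_upto_def)
    ultimately show "m div p \<in> ?S" by (auto simp: coprime_upto_def dest: dvd_trans)
  qed auto
  finally show ?thesis .
qed

lemma sum_inverse_coprime_upto:
  assumes "finite P" "\<And>p. p \<in> P \<Longrightarrow> prime p"
  shows "(\<Prod>p\<in>P. 1 - 1 / real p) * (\<Sum>m\<in>{1..z}. 1 / real m) \<le> (\<Sum>m\<in>coprime_upto P z. 1 / real m)"
  using assms
proof (induction P rule: finite_induct)
  case empty
  have "coprime_upto {} z = {1..z}" by (auto simp: coprime_upto_def)
  then show ?case by simp
next
  case (insert p P)
  let ?S = "coprime_upto P z"
  have p: "p > 0" using insert.prems prime_gt_0_nat[of p] by auto
  have "(1 - 1 / p) * ((\<Prod>p\<in>P. 1 - 1 / real p) * (\<Sum>m\<in>{1..z}. 1 / real m)) \<le> (1 - 1 / p) * (\<Sum>m\<in>?S. 1 / real m)"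
    using insert p by (intro mult_left_mono) auto
  also have "\<dots> \<le> (\<Sum>m\<in>?S. 1 / real m) - (\<Sum>m\<in>{m\<in>?S. p dvd m}. 1 / real m)"
    using sum_inverse_multiples_coprime_upto_le[OF p, of P z] by (simp add: algebra_simps)
  also have "\<dots> = (\<Sum>m\<in>?S - {m\<in>?S. p dvd m}. 1 / real m)"
    using finite_coprime_upto by (intro sum_diff[symmetric]) auto
  also have "?S - {m\<in>?S. p dvd m} = coprime_upto (insert p P) z" by (auto simp: coprime_upto_def)
  finally show ?case using insert.hyps by (simp add: mult.assoc)
qed

definition rough_prime_sets :: "nat \<Rightarrow> nat \<Rightarrow> nat set set" where
  "rough_prime_sets y z = {T. T \<subseteq> {p. prime p \<and> y < p \<and> p \<le> z} \<and> \<Prod>T \<le> z}"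

lemma finite_rough_prime_sets: "finite (rough_prime_sets y z)"
  by (rule finite_subset[of _ "Pow (primes_le z)"])
     (auto simp: rough_prime_sets_def finite_primes_le)

lemma rough_prime_setsD:
  assumes "S \<in> rough_prime_sets y z"
  shows "finite S" "\<And>p. p \<in> S \<Longrightarrow> prime p \<and> y < p \<and> p \<le> z" "\<Prod>S \<le> z" "\<Prod>S > 0"
proof -
  have sub: "S \<subseteq> {p. prime p \<and> y < p \<and> p \<le> z}" and le: "\<Prod>S \<le> z" using assms by (auto simp: rough_prime_sets_def)
  show "finite S" by (rule finite_subset[OF sub]) (rule finite_subset[OF _ finite_primes_le[of z]], auto)
  show "prime p \<and> y < p \<and> p \<le> z" if "p \<in> S" for p using sub that by auto
  show "\<Prod>S \<le> z" by (rule le)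
  show "\<Prod>S > 0" using sub by (intro prod_pos) (auto simp: prime_gt_0_nat)
qed

lemma prod_prime_factors_squarefree:
  fixes n :: nat
  assumes "squarefree n"
  shows "\<Prod>(prime_factors n) = n"
proof -
  have n: "n \<noteq> 0" using assms by (metis not_squarefree_0)
  have "multiplicity p n = 1" if "p \<in> prime_factors n" for p
    using that assms n by (auto simp: squarefree_factorial_semiring'' prime_factors_multiplicity le_Suc_eq)
  then show ?thesis using prod_prime_factors[OF n] by simp
qed

lemma prime_factors_squarefree_part_rough:
  assumes "m \<in> coprime_upto (primes_le y) z"
  shows "prime_factors (squarefree_part m) \<in> rough_prime_sets y z"
proof -
  let ?T = "prime_factors (squarefree_part m)"
  have m: "m > 0" "m \<le> z" using assms by (auto simp: coprime_upto_def)
  have dvd: "squarefree_part m dvd m" using squarefree_decompose[of m] by (metis dvd_triv_left)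
  have "p \<le> z \<and> y < p" if p: "p \<in> ?T" for p
  proof -
    have "p dvd m" "prime p" using p dvd by (auto dest: dvd_trans)
    then show ?thesis using assms m dvd_imp_le[of p m] by (auto simp: coprime_upto_def)
  qed
  moreover have "\<Prod>?T \<le> z"
    using dvd_imp_le[OF dvd m(1)] m(2) by (simp add: prod_prime_factors_squarefree)
  ultimately show ?thesis by (auto simp: rough_prime_sets_def)
qed

lemma sum_coprime_upto_le_rough_prime_sets:
  "(\<Sum>m\<in>coprime_upto (primes_le y) z. 1 / real m) \<le> 2 * (\<Sum>T\<in>rough_prime_sets y z. 1 / real (\<Prod>T))"
proof -
  let ?S = "coprime_upto (primes_le y) z"
  define \<phi> where "\<phi> m = (prime_factors (squarefree_part m), square_part m)" for m :: nat
  define g where "g = (\<lambda>(T, w). 1 / real (\<Prod>T) * (1 / (real w)\<^sup>2))"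
  have decompose: "m = \<Prod>(fst (\<phi> m)) * (snd (\<phi> m))\<^sup>2" for m
    using squarefree_decompose[of m] by (simp add: \<phi>_def prod_prime_factors_squarefree)
  have inj: "inj_on \<phi> ?S" by (rule inj_onI) (metis decompose)
  have "square_part m \<in> {1..z}" if "m \<in> ?S" for m
  proof -
    have m: "m > 0" "m \<le> z" using that by (auto simp: coprime_upto_def)
    then have "square_part m \<le> m"
      using square_part_square_dvd[of m] by (intro dvd_imp_le) (auto simp: power2_eq_square dest: dvd_mult_left)
    moreover have "square_part m > 0" using m(1) square_part_0_iff[of m] by (metis gr0I less_irrefl)
    ultimately show ?thesis using m(2) by simp
  qed
  then have sub: "\<phi> ` ?S \<subseteq> rough_prime_sets y z \<times> {1..z}"
    using prime_factors_squarefree_part_rough by (auto simp: \<phi>_def)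
  have "1 / real m = g (\<phi> m)" for m
    using arg_cong[OF decompose[of m], of real] by (simp add: g_def split_beta)
  then have "(\<Sum>m\<in>?S. 1 / real m) = (\<Sum>v\<in>\<phi> ` ?S. g v)" using inj by (simp add: sum.reindex)
  also have "\<dots> \<le> (\<Sum>v\<in>rough_prime_sets y z \<times> {1..z}. g v)"
    using sub finite_rough_prime_sets by (intro sum_mono2) (auto simp: g_def intro!: mult_nonneg_nonneg prod_nonneg)
  also have "\<dots> = (\<Sum>T\<in>rough_prime_sets y z. 1 / real (\<Prod>T)) * (\<Sum>w\<in>{1..z}. 1 / (real w)\<^sup>2)"
    unfolding g_def by (simp only: sum.cartesian_product[symmetric] sum_product)
  also have "\<dots> \<le> (\<Sum>T\<in>rough_prime_sets y z. 1 / real (\<Prod>T)) * 2"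
    using sum_inverse_squares_le_2 by (intro mult_left_mono sum_nonneg) (auto intro: prod_nonneg)
  finally show ?thesis by simp
qed

lemma exp_le_one_minus_inverse_prime:
  fixes p :: nat
  assumes "prime p"
  shows "exp (- (1 / real p) - 2 * (1 / (real p)\<^sup>2)) \<le> 1 - 1 / real p"
proof -
  have p: "real p \<ge> 2" using prime_ge_2_nat[OF assms] by simp
  then have "- (1 / real p) - 2 * (1 / real p)\<^sup>2 \<le> ln (1 - 1 / real p)"
    by (intro ln_one_minus_pos_lower_bound) (auto simp: field_simps)
  then have "exp (- (1 / real p) - 2 * (1 / real p)\<^sup>2) \<le> exp (ln (1 - 1 / real p))" by simp
  also have "\<dots> = 1 - 1 / real p" using p by (intro exp_ln) (simp add: field_simps)
  finally show ?thesis by (simp add: power_divide)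
qed

lemma prod_one_minus_inverse_primes_ge:
  fixes y :: nat
  assumes "y \<ge> 2"
  shows "exp (- mertens_const - 4) / ln y \<le> (\<Prod>p\<in>primes_le y. 1 - 1 / real p)"
proof -
  have "exp (- mertens_const - 4) / ln y = exp (- mertens_const - 4) * exp (- ln (ln y))"
    using assms by (simp add: exp_minus divide_inverse)
  also have "\<dots> = exp (- (ln (ln y) + mertens_const) - 4)" by (simp add: exp_add[symmetric])
  also have "\<dots> \<le> exp (\<Sum>p\<in>primes_le y. - (1 / real p) - 2 * (1 / (real p)\<^sup>2))"
  proof -
    have "(\<Sum>p\<in>primes_le y. 1 / (real p)\<^sup>2) \<le> (\<Sum>w\<in>{1..y}. 1 / (real w)\<^sup>2)"
      by (intro sum_mono2) (auto dest: prime_ge_1_nat)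
    then have "(\<Sum>p\<in>primes_le y. 1 / (real p)\<^sup>2) \<le> 2" using sum_inverse_squares_le_2[of y] by linarith
    moreover have "(\<Sum>p\<in>primes_le y. 1 / real p) \<le> ln (ln y) + mertens_const"
      using assms by (rule sum_inverse_primes_le)
    moreover have "(\<Sum>p\<in>primes_le y. - (1 / real p) - 2 * (1 / (real p)\<^sup>2))
        = - (\<Sum>p\<in>primes_le y. 1 / real p) - 2 * (\<Sum>p\<in>primes_le y. 1 / (real p)\<^sup>2)"
      by (simp only: sum_subtractf sum_negf sum_distrib_left)
    ultimately show ?thesis unfolding exp_le_cancel_iff by linarith
  qed
  also have "\<dots> = (\<Prod>p\<in>primes_le y. exp (- (1 / real p) - 2 * (1 / (real p)\<^sup>2)))"
    by (rule exp_sum) (rule finite_primes_le)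
  also have "\<dots> \<le> (\<Prod>p\<in>primes_le y. 1 - 1 / real p)"
    using exp_le_one_minus_inverse_prime by (intro prod_mono conjI) auto
  finally show ?thesis .
qed

definition rough_const :: real where
  "rough_const = exp (- mertens_const - 4) / 2"

lemma rough_const_pos: "rough_const > 0"
  by (simp add: rough_const_def)

theorem rough_prime_sets_lower_bound:
  assumes "y \<ge> 2" "z \<ge> 1"
  shows "(\<Sum>T\<in>rough_prime_sets y z. 1 / real (\<Prod>T)) \<ge> rough_const * ln z / ln y"
proof -
  have "ln (real z) \<le> ln (real z + 1)" using assms by simp
  also have "\<dots> \<le> harm z" by (rule ln_le_harm)
  also have "harm z = (\<Sum>m\<in>{1..z}. 1 / real m)" by (simp add: harm_def divide_inverse)
  finally have "exp (- mertens_const - 4) / ln y * ln z \<le> (\<Prod>p\<in>primes_le y. 1 - 1 / real p) * (\<Sum>m\<in>{1..z}. 1 / real m)"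
    using prod_one_minus_inverse_primes_ge[OF assms(1)] assms
    by (intro mult_mono) (auto intro!: prod_nonneg dest!: prime_ge_1_nat)
  also have "\<dots> \<le> (\<Sum>m\<in>coprime_upto (primes_le y) z. 1 / real m)"
    by (rule sum_inverse_coprime_upto) (auto simp: finite_primes_le)
  also have "\<dots> \<le> 2 * (\<Sum>T\<in>rough_prime_sets y z. 1 / real (\<Prod>T))"
    by (rule sum_coprime_upto_le_rough_prime_sets)
  finally show ?thesis by (simp add: rough_const_def)
qed

lemma sum_Pow_prod:
  fixes f :: "'a \<Rightarrow> 'b :: comm_semiring_1"
  assumes "finite A"
  shows "(\<Sum>X\<in>Pow A. \<Prod>x\<in>X. f x) = (\<Prod>x\<in>A. 1 + f x)"
  using prod_add[OF assms, of f "\<lambda>_. 1"] by (simp add: add.commute)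

lemma rough_prime_sets_rankin:
  fixes c :: real
  assumes "c \<ge> 0" "z \<ge> 2"
  shows "(\<Sum>T\<in>rough_prime_sets y z. c ^ card T / real (\<Prod>T)) \<le> exp (c * (ln (ln z) + mertens_const))"
proof -
  have "(\<Sum>T\<in>rough_prime_sets y z. c ^ card T / real (\<Prod>T)) \<le> (\<Sum>T\<in>Pow (primes_le z). c ^ card T / real (\<Prod>T))"
  proof (intro sum_mono2)
    show "0 \<le> c ^ card T / real (\<Prod>T)" for T using assms by (intro divide_nonneg_nonneg of_nat_0_le_iff) auto
  qed (auto simp: finite_primes_le rough_prime_sets_def)
  also have "\<dots> = (\<Sum>T\<in>Pow (primes_le z). \<Prod>p\<in>T. c / real p)"
    by (intro sum.cong refl) (simp add: prod_dividef)
  also have "\<dots> = (\<Prod>p\<in>primes_le z. 1 + c / real p)" by (rule sum_Pow_prod[OF finite_primes_le])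
  also have "\<dots> \<le> (\<Prod>p\<in>primes_le z. exp (c / real p))"
    using assms by (intro prod_mono) (auto intro: exp_ge_add_one_self)
  also have "\<dots> = exp (c * (\<Sum>p\<in>primes_le z. 1 / real p))"
    by (simp add: exp_sum[OF finite_primes_le] sum_distrib_left)
  also have "\<dots> \<le> exp (c * (ln (ln z) + mertens_const))"
    using assms sum_inverse_primes_le[of z] by (simp add: mult_left_mono)
  finally show ?thesis .
qed

section \<open>Patterns of quadratic residues\<close>

lemma Legendre_prod:
  assumes "prime p" "p > 2" "finite S"
  shows "(\<Prod>h\<in>S. Legendre (f h) (int p)) = Legendre (\<Prod>h\<in>S. f h) (int p)"
  using assms(3)
proof (induction S rule: finite_induct)
  case empty
  have "\<not> [1 = (0::int)] (mod int p)" using assms by (auto simp: cong_def)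
  moreover have "QuadRes (int p) 1" unfolding QuadRes_def by (intro exI[of _ 1]) simp
  ultimately show ?case by (simp add: Legendre_def)
qed (simp add: Legendre_mult[OF assms(1,2)])

lemma QuadRes_cong: "[a = b] (mod m) \<Longrightarrow> QuadRes m a \<longleftrightarrow> QuadRes m b"
  unfolding QuadRes_def by (meson cong_sym cong_trans)

lemma QuadRes_mod: "QuadRes m (a mod m) \<longleftrightarrow> QuadRes m a"
  by (rule QuadRes_cong) (simp add: cong_def)

lemma QuadRes_translate_mod: "QuadRes m (b * (x mod m + h)) \<longleftrightarrow> QuadRes m (b * (x + h))"
  by (intro QuadRes_cong cong_mult cong_add cong_refl) (simp add: cong_def)

lemma QuadRes_0: "QuadRes m 0"
  unfolding QuadRes_def by (intro exI[of _ 0]) simp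

lemma QuadRes_iff_Legendre: "QuadRes p a \<longleftrightarrow> Legendre a p \<in> {0, 1}"
proof -
  have "QuadRes p a" if "[a = 0] (mod p)" using QuadRes_cong[OF that] QuadRes_0 by simp
  then show ?thesis by (auto simp: Legendre_def)
qed

text \<open>Off the zeros of \<open>b (x + h)\<close> this is the indicator of \<open>b (x + h)\<close> being a square for all \<open>h\<close>.\<close>

definition pattern_weight :: "nat \<Rightarrow> int \<Rightarrow> int set \<Rightarrow> int \<Rightarrow> real" where
  "pattern_weight p b H x = (\<Prod>h\<in>H. (1 + real_of_int (Legendre (b * (x + h)) (int p))) / 2)"

lemma pattern_weight_bounds: "0 \<le> pattern_weight p b H x" "pattern_weight p b H x \<le> 1"
proof -
  have "0 \<le> (1 + real_of_int (Legendre a (int p))) / 2" "(1 + real_of_int (Legendre a (int p))) / 2 \<le> 1" for a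
    using Legendre_values[of a "int p"] by auto
  then show "0 \<le> pattern_weight p b H x" "pattern_weight p b H x \<le> 1"
    unfolding pattern_weight_def by (auto intro!: prod_nonneg prod_le_1)
qed

lemma pattern_weight_eq_indicator:
  assumes H: "finite H" and nonzero: "\<And>h. h \<in> H \<Longrightarrow> \<not> int p dvd b * (x + h)"
  shows "pattern_weight p b H x = (if \<forall>h\<in>H. QuadRes (int p) (b * (x + h)) then 1 else 0)"
proof -
  have Legendre_eq: "Legendre (b * (x + h)) (int p) = (if QuadRes (int p) (b * (x + h)) then 1 else - 1)" if "h \<in> H" for h
    using nonzero[OF that] by (simp add: Legendre_def cong_0_iff)
  show ?thesis
  proof (cases "\<forall>h\<in>H. QuadRes (int p) (b * (x + h))")
    case True
    then show ?thesis using Legendre_eq by (simp add: pattern_weight_def)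
  next
    case False
    then obtain h where h: "h \<in> H" "\<not> QuadRes (int p) (b * (x + h))" by blast
    then have "pattern_weight p b H x = 0"
      unfolding pattern_weight_def using Legendre_eq[OF h(1)] H by (intro prod_zero bexI[of _ h]) auto
    then show ?thesis using False by simp
  qed
qed

lemma card_QuadRes_pattern_weight_le:
  assumes p: "prime p" and b: "\<not> int p dvd b" and H: "finite H"
  shows "\<bar>real (card {x\<in>{0..<int p}. \<forall>h\<in>H. QuadRes (int p) (b * (x + h))}) - (\<Sum>x\<in>{0..<int p}. pattern_weight p b H x)\<bar> \<le> card H"
proof -
  define ind where "ind x = (if \<forall>h\<in>H. QuadRes (int p) (b * (x + h)) then 1 else 0 :: real)" for x
  define zeros where "zeros = {x\<in>{0..<int p}. \<exists>h\<in>H. int p dvd h + x}"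
  have "real (card {x\<in>{0..<int p}. \<forall>h\<in>H. QuadRes (int p) (b * (x + h))}) = (\<Sum>x\<in>{0..<int p}. ind x)"
    unfolding ind_def by (subst sum.inter_filter[symmetric]) auto
  then have "\<bar>real (card {x\<in>{0..<int p}. \<forall>h\<in>H. QuadRes (int p) (b * (x + h))}) - (\<Sum>x\<in>{0..<int p}. pattern_weight p b H x)\<bar>
      = \<bar>\<Sum>x\<in>{0..<int p}. ind x - pattern_weight p b H x\<bar>"
    by (simp add: sum_subtractf)
  also have "(\<Sum>x\<in>{0..<int p}. ind x - pattern_weight p b H x) = (\<Sum>x\<in>zeros. ind x - pattern_weight p b H x)"
  proof (intro sum.mono_neutral_right ballI)
    fix x assume "x \<in> {0..<int p} - zeros"
    then have "\<not> int p dvd b * (x + h)" if "h \<in> H" for h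
      using b p that by (auto simp: zeros_def prime_dvd_mult_iff add.commute)
    then show "ind x - pattern_weight p b H x = 0" by (simp add: pattern_weight_eq_indicator[OF H] ind_def)
  qed (auto simp: zeros_def)
  also have "\<bar>\<dots>\<bar> \<le> (\<Sum>x\<in>zeros. 1)"
  proof (rule order_trans[OF sum_abs sum_mono])
    show "\<bar>ind x - pattern_weight p b H x\<bar> \<le> 1" for x
      using pattern_weight_bounds[of p b H x] by (auto simp: ind_def)
  qed
  also have "\<dots> \<le> card H" unfolding zeros_def using card_residue_translates_le[OF H, of "int p"] by simp
  finally show ?thesis .
qed

lemma pattern_weight_expand:
  assumes p: "prime p" "p > 2" and H: "finite H"
  shows "pattern_weight p b H x =
    (\<Sum>S\<in>Pow H. real_of_int (Legendre b (int p)) ^ card S * real_of_int (Legendre (\<Prod>h\<in>S. h + x) (int p))) / 2 ^ card H"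
proof -
  have "(\<Prod>h\<in>H. 1 + real_of_int (Legendre (b * (x + h)) (int p))) = (\<Sum>S\<in>Pow H. \<Prod>h\<in>S. real_of_int (Legendre (b * (x + h)) (int p)))"
    using H by (rule sum_Pow_prod[symmetric])
  also have "\<dots> = (\<Sum>S\<in>Pow H. real_of_int (Legendre b (int p)) ^ card S * real_of_int (Legendre (\<Prod>h\<in>S. h + x) (int p)))"
  proof (intro sum.cong refl)
    fix S assume "S \<in> Pow H"
    then have S: "finite S" using H finite_subset by auto
    have "(\<Prod>h\<in>S. Legendre (b * (x + h)) (int p)) = (\<Prod>h\<in>S. Legendre b (int p) * Legendre (h + x) (int p))"
      by (simp add: Legendre_mult[OF p] add.commute)
    also have "\<dots> = Legendre b (int p) ^ card S * Legendre (\<Prod>h\<in>S. h + x) (int p)"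
      by (simp add: prod.distrib Legendre_prod[OF p S])
    finally show "(\<Prod>h\<in>S. real_of_int (Legendre (b * (x + h)) (int p)))
        = real_of_int (Legendre b (int p)) ^ card S * real_of_int (Legendre (\<Prod>h\<in>S. h + x) (int p))"
      by (metis of_int_mult of_int_power of_int_prod)
  qed
  finally show ?thesis by (simp add: pattern_weight_def prod_dividef)
qed

lemma sum_pattern_weight_bound:
  assumes p: "prime p" "p > 2" and H: "finite H" and dist: "inj_on (\<lambda>h. h mod int p) H"
  shows "\<bar>(\<Sum>x\<in>{0..<int p}. pattern_weight p b H x) - p / 2 ^ card H\<bar> \<le> 21 * card H * sqrt p"
proof -
  define k where "k = card H"
  define W where "W S = real_of_int (\<Sum>x\<in>{0..<int p}. Legendre (\<Prod>h\<in>S. h + x) (int p))" for S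
  let ?\<chi> = "real_of_int (Legendre b (int p))"
  have "(\<Sum>x\<in>{0..<int p}. pattern_weight p b H x) = (\<Sum>S\<in>Pow H. ?\<chi> ^ card S * W S) / 2 ^ k"
    unfolding pattern_weight_expand[OF p H] W_def k_def sum_divide_distrib[symmetric]
    by (subst sum.swap) (simp add: sum_distrib_left)
  also have "(\<Sum>S\<in>Pow H. ?\<chi> ^ card S * W S) = W {} + (\<Sum>S\<in>Pow H - {{}}. ?\<chi> ^ card S * W S)"
    using H by (subst sum.remove[of _ "{}"]) auto
  also have "W {} = p" using Legendre_prod[OF p, of "{}" "\<lambda>h. h"] by (simp add: W_def)
  finally have deviation: "(\<Sum>x\<in>{0..<int p}. pattern_weight p b H x) - p / 2 ^ k = (\<Sum>S\<in>Pow H - {{}}. ?\<chi> ^ card S * W S) / 2 ^ k"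
    by (simp add: add_divide_distrib)
  have "\<bar>\<Sum>S\<in>Pow H - {{}}. ?\<chi> ^ card S * W S\<bar> \<le> (\<Sum>S\<in>Pow H - {{}}. 21 * k * sqrt p)"
  proof (rule order_trans[OF sum_abs sum_mono])
    fix S assume S: "S \<in> Pow H - {{}}"
    then have fin: "finite S" "card S \<le> k" using H finite_subset card_mono by (auto simp: k_def)
    have "\<bar>?\<chi>\<bar> \<le> 1" using Legendre_values[of b "int p"] by auto
    then have "\<bar>?\<chi> ^ card S * W S\<bar> \<le> 1 * \<bar>W S\<bar>"
      unfolding abs_mult power_abs by (intro mult_right_mono power_le_one) auto
    also have "\<bar>W S\<bar> \<le> 21 * card S * sqrt p"
      unfolding W_def using S inj_on_subset[OF dist] p(2) prime_odd_nat[OF p(1)]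
      by (intro Legendre_shifted_prod_sum_bound p(1) fin) auto
    also have "\<dots> \<le> 21 * k * sqrt p" using fin by (intro mult_right_mono) auto
    finally show "\<bar>?\<chi> ^ card S * W S\<bar> \<le> 21 * k * sqrt p" by simp
  qed
  also have "\<dots> = card (Pow H - {{}}) * (21 * k * sqrt p)" by simp
  also have "\<dots> \<le> 2 ^ k * (21 * k * sqrt p)"
    using H by (intro mult_right_mono) (simp_all add: card_Diff_subset card_Pow k_def)
  finally show ?thesis unfolding k_def[symmetric] deviation by (simp add: abs_divide divide_le_eq mult.commute)
qed

theorem card_QuadRes_pattern:
  assumes p: "prime p" "p > 2" and b: "\<not> int p dvd b" and H: "finite H" and dist: "inj_on (\<lambda>h. h mod int p) H"
  shows "\<bar>real (card {x\<in>{0..<int p}. \<forall>h\<in>H. QuadRes (int p) (b * (x + h))}) - p / 2 ^ card H\<bar> \<le> 22 * card H * sqrt p"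
proof -
  have "real (card H) * 1 \<le> card H * sqrt p" using p by (intro mult_left_mono) auto
  moreover have "22 * card H * sqrt p = 21 * card H * sqrt p + card H * sqrt p" by (simp add: algebra_simps)
  ultimately show ?thesis
    using card_QuadRes_pattern_weight_le[OF p(1) b H] sum_pattern_weight_bound[OF p H dist, of b] by linarith
qed

lemma card_QuadRes_pattern_ratio:
  assumes p: "prime p" "p > 2" and b: "\<not> int p dvd b" and H: "finite H" "card H \<le> K"
    and dist: "inj_on (\<lambda>h. h mod int p) H" and y: "0 < y" "y \<le> p"
  shows "\<bar>real (card {x\<in>{0..<int p}. \<forall>h\<in>H. QuadRes (int p) (b * (x + h))}) * 2 ^ card H / p - 1\<bar> \<le> 22 * real K * 2 ^ K / sqrt y"
proof -
  let ?N = "real (card {x\<in>{0..<int p}. \<forall>h\<in>H. QuadRes (int p) (b * (x + h))})" and ?k = "card H"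
  have "?N * 2 ^ ?k / p - 1 = (?N - p / 2 ^ ?k) * (2 ^ ?k / p)"
    using p by (simp add: field_simps)
  also have "\<bar>\<dots>\<bar> = \<bar>?N - p / 2 ^ ?k\<bar> * (2 ^ ?k / p)" by (simp add: abs_mult)
  also have "\<dots> \<le> 22 * ?k * sqrt p * (2 ^ ?k / p)"
    using card_QuadRes_pattern[OF p b H(1) dist] by (intro mult_right_mono) auto
  also have "\<dots> = 22 * real ?k * 2 ^ ?k / sqrt p" using p by (simp add: field_simps)
  also have "\<dots> \<le> 22 * real K * 2 ^ K / sqrt y"
    using H(2) y by (intro frac_le mult_mono power_increasing) auto
  finally show ?thesis .
qed

lemma QuadRes_mult_coprime:
  assumes "coprime m n"
  shows "QuadRes (m * n) a \<longleftrightarrow> QuadRes m a \<and> QuadRes n a"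
proof
  assume "QuadRes (m * n) a"
  then show "QuadRes m a \<and> QuadRes n a" unfolding QuadRes_def
    by (metis cong_modulus_mult mult.commute)
next
  assume "QuadRes m a \<and> QuadRes n a"
  then obtain x y where xy: "[x^2 = a] (mod m)" "[y^2 = a] (mod n)" by (auto simp: QuadRes_def)
  obtain z where z: "[z = x] (mod m)" "[z = y] (mod n)"
    using binary_chinese_remainder_int[OF assms, of x y] by blast
  have "[z^2 = a] (mod m)" "[z^2 = a] (mod n)"
    using z xy by (meson cong_pow cong_trans)+
  then have "[z^2 = a] (mod m * n)" using assms by (intro coprime_cong_mult)
  then show "QuadRes (m * n) a" by (auto simp: QuadRes_def)
qed

lemma coprime_mult_prod_primes:
  assumes "prime (p::nat)" "p \<notin> T" "\<And>r. r \<in> T \<Longrightarrow> prime r" "coprime p q"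
  shows "coprime p (q * \<Prod>T)"
  using assms by (auto intro!: prod_coprime_right primes_coprime)

lemma QuadRes_mult_prod:
  assumes "finite T" "\<And>p. p \<in> T \<Longrightarrow> prime (p::nat)" "\<And>p. p \<in> T \<Longrightarrow> coprime p q"
  shows "QuadRes (int (q * \<Prod>T)) a \<longleftrightarrow> QuadRes (int q) a \<and> (\<forall>p\<in>T. QuadRes (int p) a)"
  using assms
proof (induction T rule: finite_induct)
  case (insert p T)
  have "coprime p (q * \<Prod>T)" using insert.prems insert.hyps by (intro coprime_mult_prod_primes) auto
  then have coprime: "coprime (int p) (int (q * \<Prod>T))" by (simp only: coprime_int_iff)
  have product: "int (q * \<Prod>(insert p T)) = int p * int (q * \<Prod>T)" using insert.hyps by simp
  have IH: "QuadRes (int (q * \<Prod>T)) a \<longleftrightarrow> QuadRes (int q) a \<and> (\<forall>p\<in>T. QuadRes (int p) a)"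
    by (rule insert.IH) (use insert.prems in auto)
  show ?case unfolding product QuadRes_mult_coprime[OF coprime] IH by auto
qed simp

lemma card_crt:
  assumes coprime: "coprime m n" "m > 0" "n > (0::int)"
    and P: "\<And>x. P (x mod m) = P x" and Q: "\<And>x. Q (x mod n) = Q x"
  shows "card {x\<in>{0..<m * n}. P x \<and> Q x} = card {x\<in>{0..<m}. P x} * card {x\<in>{0..<n}. Q x}"
proof -
  have "bij_betw (\<lambda>x. (x mod m, x mod n)) {x\<in>{0..<m * n}. P x \<and> Q x} ({x\<in>{0..<m}. P x} \<times> {x\<in>{0..<n}. Q x})"
  proof (rule bij_betwI')
    fix x y assume xy: "x \<in> {x\<in>{0..<m * n}. P x \<and> Q x}" "y \<in> {x\<in>{0..<m * n}. P x \<and> Q x}"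
    show "((x mod m, x mod n) = (y mod m, y mod n)) = (x = y)"
    proof
      assume "(x mod m, x mod n) = (y mod m, y mod n)"
      then have "[x = y] (mod m * n)" using coprime(1) by (intro coprime_cong_mult) (auto simp: cong_def)
      then show "x = y" using xy by (simp add: cong_def)
    qed auto
  next
    fix x assume "x \<in> {x\<in>{0..<m * n}. P x \<and> Q x}"
    then show "(x mod m, x mod n) \<in> {x\<in>{0..<m}. P x} \<times> {x\<in>{0..<n}. Q x}" using coprime P Q by auto
  next
    fix v assume v: "v \<in> {x\<in>{0..<m}. P x} \<times> {x\<in>{0..<n}. Q x}"
    obtain z where z: "[z = fst v] (mod m)" "[z = snd v] (mod n)"
      using binary_chinese_remainder_int[OF coprime(1)] by blast
    define x where "x = z mod (m * n)"
    have residues: "x mod m = fst v" "x mod n = snd v"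
      using z v by (auto simp: x_def cong_def mod_mod_cancel)
    moreover have "0 \<le> x" "x < m * n" using coprime by (simp_all add: x_def)
    moreover have "P x" "Q x" using residues v P[of x] Q[of x] by auto
    ultimately show "\<exists>x\<in>{x\<in>{0..<m * n}. P x \<and> Q x}. v = (x mod m, x mod n)"
      by (intro bexI[of _ x]) auto
  qed
  from bij_betw_same_card[OF this] show ?thesis by (simp only: card_cartesian_product)
qed

lemma card_crt_prod:
  assumes "finite T" "\<And>p. p \<in> T \<Longrightarrow> prime (p::nat)" "\<And>p. p \<in> T \<Longrightarrow> coprime p q" "q > 0"
    and P0: "\<And>x. P0 (x mod int q) = P0 x"
    and P: "\<And>p x. p \<in> T \<Longrightarrow> P p (x mod int p) = P p x"
  shows "card {x\<in>{0..<int (q * \<Prod>T)}. P0 x \<and> (\<forall>p\<in>T. P p x)} = card {x\<in>{0..<int q}. P0 x} * (\<Prod>p\<in>T. card {x\<in>{0..<int p}. P p x})"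
  using assms(1-3) P
proof (induction T rule: finite_induct)
  case (insert p T)
  have "coprime p (q * \<Prod>T)" using insert.prems insert.hyps by (intro coprime_mult_prod_primes) auto
  then have coprime: "coprime (int (q * \<Prod>T)) (int p)" by (simp only: coprime_int_iff coprime_commute)
  have "q * \<Prod>T > 0" "p > 0"
    using assms(4) insert.prems(1) by (simp_all add: prime_gt_0_nat prod_pos)
  then have pos: "int (q * \<Prod>T) > 0" "int p > 0" by (simp_all only: of_nat_0_less_iff)
  have mod: "x mod int (q * \<Prod>T) mod int r = x mod int r" if "r dvd q * \<Prod>T" for x r
    using that by (intro mod_mod_cancel) (simp only: int_dvd_int_iff)
  have "r dvd q * \<Prod>T" if "r \<in> T" for r using that insert.hyps by (intro dvd_mult dvd_prodI) auto
  then have "P r (x mod int (q * \<Prod>T)) = P r x" if "r \<in> T" for r x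
    using mod[of r x] insert.prems(3)[of r] that by (metis insertCI)
  moreover have "P0 (x mod int (q * \<Prod>T)) = P0 x" for x using mod[of q x] P0 by (metis dvd_triv_left)
  ultimately have periodic: "(P0 (x mod int (q * \<Prod>T)) \<and> (\<forall>p\<in>T. P p (x mod int (q * \<Prod>T)))) = (P0 x \<and> (\<forall>p\<in>T. P p x))" for x
    by auto
  have "int (q * \<Prod>(insert p T)) = int (q * \<Prod>T) * int p" using insert.hyps by simp
  then have "card {x\<in>{0..<int (q * \<Prod>(insert p T))}. P0 x \<and> (\<forall>p\<in>insert p T. P p x)}
      = card {x\<in>{0..<int (q * \<Prod>T) * int p}. (P0 x \<and> (\<forall>p\<in>T. P p x)) \<and> P p x}"
    by (intro arg_cong[of _ _ card]) auto
  also have "\<dots> = card {x\<in>{0..<int (q * \<Prod>T)}. P0 x \<and> (\<forall>p\<in>T. P p x)} * card {x\<in>{0..<int p}. P p x}"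
    using insert.prems(3) by (intro card_crt coprime pos periodic) auto
  finally show ?case using insert by simp
qed simp

section \<open>Truncated inclusion-exclusion\<close>

definition subsets_upto :: "'a set \<Rightarrow> nat \<Rightarrow> 'a set set" where
  "subsets_upto X K = {H\<in>Pow X. card H \<le> K}"

lemma finite_subsets_upto: "finite X \<Longrightarrow> finite (subsets_upto X K)"
  by (simp add: subsets_upto_def)

lemma sum_subsets_upto_alternating:
  assumes "finite X"
  shows "(\<Sum>H\<in>subsets_upto X K. (-1) ^ card H) = (-1) ^ K * (real (card X) - 1 gchoose K)"
proof -
  have "(\<Sum>H\<in>subsets_upto X K. (-1) ^ card H) =
      (\<Sum>k\<in>{..K}. \<Sum>H\<in>{H\<in>subsets_upto X K. card H = k}. (-1) ^ card H :: real)"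
    using assms by (intro sum.group[symmetric] finite_subsets_upto) (auto simp: subsets_upto_def)
  also have "\<dots> = (\<Sum>k\<le>K. (real (card X) gchoose k) * (-1) ^ k)"
  proof (intro sum.cong refl)
    fix k assume "k \<in> {..K}"
    then have "{H\<in>subsets_upto X K. card H = k} = {H. H \<subseteq> X \<and> card H = k}" by (auto simp: subsets_upto_def)
    then have "card {H\<in>subsets_upto X K. card H = k} = card X choose k" using assms by (simp add: n_subsets)
    then show "(\<Sum>H\<in>{H\<in>subsets_upto X K. card H = k}. (-1) ^ card H) = (real (card X) gchoose k) * (-1) ^ k"
      by (simp add: binomial_gbinomial)
  qed
  also have "\<dots> = (-1) ^ K * (real (card X) - 1 gchoose K)" by (rule gbinomial_sum_lower_neg)
  finally show ?thesis .
qed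

lemma bonferroni_even:
  assumes "finite X" "even K"
  shows "(if X = {} then 1 else 0) \<le> (\<Sum>H\<in>subsets_upto X K. (-1) ^ card H :: real)"
proof (cases "X = {}")
  case True
  then have "subsets_upto X K = {{}}" by (auto simp: subsets_upto_def)
  then show ?thesis using True by simp
next
  case False
  then obtain n where "card X = Suc n" using assms(1) by (metis card_0_eq not0_implies_Suc)
  then have "(\<Sum>H\<in>subsets_upto X K. (-1) ^ card H :: real) = real (n choose K)"
    using assms(2) by (simp add: sum_subsets_upto_alternating[OF assms(1)] binomial_gbinomial)
  then show ?thesis using False by simp
qed

lemma card_no_hits_le_bonferroni:
  assumes X: "finite X" and A: "finite A" "\<And>x. hits x \<subseteq> A" and K: "even K"
  shows "real (card {x\<in>X. hits x = {}}) \<le> (\<Sum>H\<in>subsets_upto A K. (-1) ^ card H * real (card {x\<in>X. H \<subseteq> hits x}))"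
proof -
  note fin = finite_subsets_upto[OF A(1), of K]
  have "real (card {x\<in>X. hits x = {}}) = (\<Sum>x\<in>X. if hits x = {} then 1 else 0)"
    using X by (simp add: sum.inter_filter[symmetric])
  also have "\<dots> \<le> (\<Sum>x\<in>X. \<Sum>H\<in>{H\<in>subsets_upto A K. H \<subseteq> hits x}. (-1) ^ card H)"
  proof (intro sum_mono)
    fix x
    have "{H\<in>subsets_upto A K. H \<subseteq> hits x} = subsets_upto (hits x) K"
      using A(2) by (force simp: subsets_upto_def)
    then show "(if hits x = {} then 1 else 0) \<le> (\<Sum>H\<in>{H\<in>subsets_upto A K. H \<subseteq> hits x}. (-1) ^ card H :: real)"
      using bonferroni_even[OF finite_subset[OF A(2) A(1)] K, of x] by simp
  qed
  also have "\<dots> = (\<Sum>H\<in>subsets_upto A K. \<Sum>x\<in>{x\<in>X. H \<subseteq> hits x}. (-1) ^ card H)"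
    using X fin by (rule sum.swap_restrict)
  finally show ?thesis by (simp add: mult.commute)
qed

lemma sum_Pow_power_card: "finite A \<Longrightarrow> (\<Sum>H\<in>Pow A. c ^ card H) = (1 + c) ^ card A" for c :: real
  using sum_Pow_prod[of A "\<lambda>_. c"] by simp

lemma one_plus_power_le_exp:
  fixes c :: real
  assumes "0 \<le> c" "n * c \<le> \<kappa>"
  shows "(1 + c) ^ n \<le> exp \<kappa>"
proof -
  have "(1 + c) ^ n \<le> exp c ^ n" using assms by (intro power_mono exp_ge_add_one_self) auto
  also have "\<dots> = exp (n * c)" by (simp add: exp_of_nat_mult)
  also have "\<dots> \<le> exp \<kappa>" using assms by simp
  finally show ?thesis .
qed

lemma sum_subsets_upto_power_le_exp:
  fixes a :: real
  assumes "finite A" "0 \<le> a" "card A * a \<le> \<kappa>"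
  shows "(\<Sum>H\<in>subsets_upto A K. a ^ card H) \<le> exp \<kappa>"
proof -
  have "(\<Sum>H\<in>subsets_upto A K. a ^ card H) \<le> (\<Sum>H\<in>Pow A. a ^ card H)"
    using assms by (intro sum_mono2) (auto simp: subsets_upto_def)
  also have "\<dots> \<le> exp \<kappa>" using assms by (simp add: sum_Pow_power_card one_plus_power_le_exp)
  finally show ?thesis .
qed

lemma sum_subsets_upto_alternating_power_le:
  fixes a :: real
  assumes A: "finite A" and a: "0 \<le> a" and \<kappa>: "card A * a \<le> \<kappa>"
  shows "(\<Sum>H\<in>subsets_upto A K. (- a) ^ card H) \<le> (1 - a) ^ card A + exp (2 * \<kappa>) / 2 ^ K"
proof -
  let ?B = "Pow A - subsets_upto A K"
  have "- (\<Sum>H\<in>?B. (- a) ^ card H) \<le> \<bar>\<Sum>H\<in>?B. (- a) ^ card H\<bar>" by simp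
  also have "\<dots> \<le> (\<Sum>H\<in>?B. a ^ card H)"
    using a by (intro order_trans[OF sum_abs] sum_mono) (simp add: power_abs)
  also have "\<dots> \<le> (\<Sum>H\<in>?B. (2 * a) ^ card H / 2 ^ K)"
  proof (intro sum_mono)
    fix H assume "H \<in> ?B"
    then have "(2::real) ^ K \<le> 2 ^ card H" by (intro power_increasing) (auto simp: subsets_upto_def)
    then have "a ^ card H * 2 ^ K \<le> a ^ card H * 2 ^ card H" using a by (intro mult_left_mono) auto
    then show "a ^ card H \<le> (2 * a) ^ card H / 2 ^ K" by (simp add: le_divide_eq power_mult_distrib mult.commute)
  qed
  also have "\<dots> \<le> (\<Sum>H\<in>Pow A. (2 * a) ^ card H / 2 ^ K)" using A a by (intro sum_mono2) auto
  also have "\<dots> = (1 + 2 * a) ^ card A / 2 ^ K"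
    by (simp only: sum_divide_distrib[symmetric] sum_Pow_power_card[OF A])
  also have "\<dots> \<le> exp (2 * \<kappa>) / 2 ^ K"
    using a \<kappa> by (intro divide_right_mono one_plus_power_le_exp) auto
  finally have "- (\<Sum>H\<in>?B. (- a) ^ card H) \<le> exp (2 * \<kappa>) / 2 ^ K" .
  moreover have "(\<Sum>H\<in>subsets_upto A K. (- a) ^ card H) = (1 - a) ^ card A + - (\<Sum>H\<in>?B. (- a) ^ card H)"
    using sum_Pow_power_card[OF A, of "- a"] A
    by (subst sum_diff) (auto simp: subsets_upto_def)
  ultimately show ?thesis by linarith
qed

section \<open>Empty windows of squares modulo \<open>q t\<close>\<close>

locale residue_setting =
  fixes q y :: nat and T :: "nat set"
  assumes q_pos: "q > 0" and finite_T: "finite T" and y_pos: "y > 0"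
    and T: "\<And>p. p \<in> T \<Longrightarrow> prime p \<and> p > 2 \<and> coprime p q \<and> y < p"
begin

definition modulus :: nat where "modulus = q * \<Prod>T"

definition thinning :: real (\<open>\<alpha>\<close>) where "\<alpha> = 1 / 2 ^ card T"

definition pattern_error :: "nat \<Rightarrow> real" where
  "pattern_error K = (1 + 22 * real K * 2 ^ K / sqrt y) ^ card T - 1"

lemma thinning_bounds: "0 < \<alpha>" "\<alpha> \<le> 1"
  by (simp_all add: thinning_def)

lemma pattern_error_nonneg: "0 \<le> pattern_error K"
  by (simp add: pattern_error_def one_le_power)

lemma prod_T_pos: "\<Prod>T > 0"
  using T by (intro prod_pos) (auto simp: prime_gt_0_nat)

lemma modulus_pos: "modulus > 0"
  using q_pos prod_T_pos by (simp add: modulus_def)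

lemma coprime_modulus_not_dvd:
  assumes "coprime b (int modulus)" "p \<in> T"
  shows "\<not> int p dvd b"
proof -
  have "p dvd modulus" unfolding modulus_def using assms(2) finite_T by (intro dvd_mult dvd_prodI) auto
  then have "int p dvd int modulus" by (simp only: int_dvd_int_iff)
  then show ?thesis
    using assms T[of p] by (metis coprime_common_divisor not_prime_unit prime_nat_int_transfer)
qed

lemma QuadRes_modulus: "QuadRes (int modulus) a \<longleftrightarrow> QuadRes (int q) a \<and> (\<forall>p\<in>T. QuadRes (int p) a)"
  unfolding modulus_def using T by (intro QuadRes_mult_prod finite_T) auto

definition pattern_count :: "int \<Rightarrow> int set \<Rightarrow> nat" where
  "pattern_count b H = (\<Prod>p\<in>T. card {x\<in>{0..<int p}. \<forall>h\<in>H. QuadRes (int p) (b * (x + h))})"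

lemma pattern_count_bound:
  assumes b: "coprime b (int modulus)" and H: "H \<subseteq> {0..int L}" "card H \<le> K" and L: "L \<le> y"
  shows "\<bar>real (pattern_count b H) - \<Prod>T * \<alpha> ^ card H\<bar> \<le> \<Prod>T * \<alpha> ^ card H * pattern_error K"
proof -
  define k where "k = card H"
  define ratio where "ratio p = real (card {x\<in>{0..<int p}. \<forall>h\<in>H. QuadRes (int p) (b * (x + h))}) * 2 ^ k / p" for p :: nat
  have finite_H: "finite H" using H finite_subset by blast
  have near: "\<bar>ratio p - 1\<bar> \<le> 22 * real K * 2 ^ K / sqrt y" if p: "p \<in> T" for p
    unfolding ratio_def k_def
  proof (rule card_QuadRes_pattern_ratio)
    have "H \<subseteq> {0..<int p}" using H L T[OF p] by auto
    then show "inj_on (\<lambda>h. h mod int p) H" by (auto simp: inj_on_def subset_iff)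
  qed (use T[OF p] y_pos coprime_modulus_not_dvd[OF b p] finite_H H in auto)
  have "real (pattern_count b H) = (\<Prod>p\<in>T. real p / 2 ^ k * ratio p)"
    unfolding pattern_count_def of_nat_prod using T by (intro prod.cong refl) (force simp: ratio_def)
  also have "\<dots> = real (\<Prod>T) * \<alpha> ^ k * (\<Prod>p\<in>T. ratio p)"
    by (simp add: prod.distrib prod_dividef thinning_def power_divide power_mult[symmetric] mult.commute)
  finally have "real (pattern_count b H) - \<Prod>T * \<alpha> ^ k = \<Prod>T * \<alpha> ^ k * ((\<Prod>p\<in>T. ratio p) - 1)"
    by (simp add: right_diff_distrib)
  then have "\<bar>real (pattern_count b H) - \<Prod>T * \<alpha> ^ k\<bar> = \<Prod>T * \<alpha> ^ k * \<bar>(\<Prod>p\<in>T. ratio p) - 1\<bar>"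
    using thinning_bounds by (simp add: abs_mult prod_nonneg)
  also have "\<dots> \<le> \<Prod>T * \<alpha> ^ k * pattern_error K"
  proof (intro mult_left_mono)
    have "\<bar>(\<Prod>p\<in>T. ratio p) - 1\<bar> \<le> (\<Prod>p\<in>T. 1 + \<bar>ratio p - 1\<bar>) - 1"
      using norm_prod_minus1_le_prod_minus1[of "\<lambda>p. ratio p - 1" T] by simp
    also have "(\<Prod>p\<in>T. 1 + \<bar>ratio p - 1\<bar>) \<le> (\<Prod>p\<in>T. 1 + 22 * real K * 2 ^ K / sqrt y)"
      using near by (intro prod_mono) auto
    finally show "\<bar>(\<Prod>p\<in>T. ratio p) - 1\<bar> \<le> pattern_error K" by (simp add: pattern_error_def)
  qed (use thinning_bounds in \<open>simp add: prod_nonneg\<close>)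
  finally show ?thesis by (simp add: k_def)
qed

lemma card_pattern_in_class:
  assumes "u \<in> {0..<int q}"
  shows "card {x\<in>{0..<int modulus}. x mod int q = u \<and> (\<forall>p\<in>T. \<forall>h\<in>H. QuadRes (int p) (b * (x + h)))} = pattern_count b H"
proof -
  have "card {x\<in>{0..<int modulus}. x mod int q = u \<and> (\<forall>p\<in>T. \<forall>h\<in>H. QuadRes (int p) (b * (x + h)))} =
      card {x\<in>{0..<int q}. x mod int q = u} * pattern_count b H"
    unfolding pattern_count_def modulus_def using T
    by (intro card_crt_prod finite_T q_pos) (auto simp: QuadRes_translate_mod)
  also have "{x\<in>{0..<int q}. x mod int q = u} = {u}" using assms by auto
  finally show ?thesis by simp
qed

definition base_card :: nat where "base_card = card {v\<in>{0..<int q}. QuadRes (int q) v}"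

definition num_squares :: nat where "num_squares = card {x\<in>{0..<int modulus}. QuadRes (int modulus) x}"

lemma num_squares_eq: "num_squares = base_card * pattern_count 1 {0}"
proof -
  have "pattern_count 1 {0} = (\<Prod>p\<in>T. card {x\<in>{0..<int p}. QuadRes (int p) x})" by (simp add: pattern_count_def)
  then show ?thesis
    unfolding num_squares_def QuadRes_modulus base_card_def unfolding modulus_def using T
    by (simp only:) (intro card_crt_prod finite_T q_pos QuadRes_mod; simp)
qed

lemma num_squares_bounds:
  "real num_squares \<le> base_card * \<Prod>T * \<alpha> * (1 + pattern_error 1)"
  "base_card * \<Prod>T * \<alpha> * (1 - pattern_error 1) \<le> real num_squares"
proof -
  have "\<bar>real (pattern_count 1 {0}) - \<Prod>T * \<alpha>\<bar> \<le> \<Prod>T * \<alpha> * pattern_error 1"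
    using pattern_count_bound[of 1 "{0}" 0 1] by simp
  then have "\<Prod>T * \<alpha> * (1 - pattern_error 1) \<le> real (pattern_count 1 {0})"
    "real (pattern_count 1 {0}) \<le> \<Prod>T * \<alpha> * (1 + pattern_error 1)"
    by (simp_all add: abs_le_iff algebra_simps)
  then show "real num_squares \<le> base_card * \<Prod>T * \<alpha> * (1 + pattern_error 1)"
    "base_card * \<Prod>T * \<alpha> * (1 - pattern_error 1) \<le> real num_squares"
    unfolding num_squares_eq of_nat_mult by (simp_all add: mult.assoc mult_left_mono)
qed

definition window_error :: "nat \<Rightarrow> real \<Rightarrow> real" where
  "window_error K \<kappa> = exp (2 * \<kappa>) / 2 ^ K + pattern_error K * exp \<kappa>"

lemma window_error_nonneg: "0 \<le> window_error K \<kappa>"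
  using pattern_error_nonneg by (simp add: window_error_def)

lemma card_avoiding_le:
  assumes b: "coprime b (int modulus)" and u: "u \<in> {0..<int q}" and A: "A \<subseteq> {1..int L}" and L: "L \<le> y" and K: "even K"
    and \<kappa>: "card A * \<alpha> \<le> \<kappa>"
  shows "real (card {x\<in>{0..<int modulus}. x mod int q = u \<and> (\<forall>h\<in>A. \<not> (\<forall>p\<in>T. QuadRes (int p) (b * (x + h))))})
    \<le> \<Prod>T * ((1 - \<alpha>) ^ card A + window_error K \<kappa>)"
proof -
  define X where "X = {x\<in>{0..<int modulus}. x mod int q = u}"
  define hits where "hits x = {h\<in>A. \<forall>p\<in>T. QuadRes (int p) (b * (x + h))}" for x
  define t where "t = real (\<Prod>T)"
  have finite_A: "finite A" using A finite_subset by blast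
  have finite_X: "finite X" unfolding X_def by (rule finite_subset[of _ "{0..<int modulus}"]) auto
  have count: "card {x\<in>X. H \<subseteq> hits x} = pattern_count b H" if "H \<subseteq> A" for H
  proof -
    have "{x\<in>X. H \<subseteq> hits x} = {x\<in>{0..<int modulus}. x mod int q = u \<and> (\<forall>p\<in>T. \<forall>h\<in>H. QuadRes (int p) (b * (x + h)))}"
      using that by (auto simp: X_def hits_def)
    then show ?thesis using card_pattern_in_class[OF u, of H b] by simp
  qed
  have "{x\<in>{0..<int modulus}. x mod int q = u \<and> (\<forall>h\<in>A. \<not> (\<forall>p\<in>T. QuadRes (int p) (b * (x + h))))} = {x\<in>X. hits x = {}}"
    by (auto simp: X_def hits_def)
  also have "real (card \<dots>) \<le> (\<Sum>H\<in>subsets_upto A K. (-1) ^ card H * real (card {x\<in>X. H \<subseteq> hits x}))"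
    by (rule card_no_hits_le_bonferroni[OF finite_X finite_A _ K]) (auto simp: hits_def)
  also have "\<dots> \<le> (\<Sum>H\<in>subsets_upto A K. t * ((- \<alpha>) ^ card H + \<alpha> ^ card H * pattern_error K))"
  proof (intro sum_mono)
    fix H assume H: "H \<in> subsets_upto A K"
    let ?N = "real (pattern_count b H)"
    have "H \<subseteq> {0..int L}" "card H \<le> K" using H A by (auto simp: subsets_upto_def)
    from pattern_count_bound[OF b this L]
    have bound: "\<bar>?N - t * \<alpha> ^ card H\<bar> \<le> t * \<alpha> ^ card H * pattern_error K" by (simp add: t_def)
    have "(-1) ^ card H * ?N - t * (- \<alpha>) ^ card H = (-1) ^ card H * (?N - t * \<alpha> ^ card H)"
      by (simp add: algebra_simps power_minus[of \<alpha>])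
    also have "\<dots> \<le> \<bar>(-1) ^ card H * (?N - t * \<alpha> ^ card H)\<bar>" by simp
    also have "\<dots> = \<bar>?N - t * \<alpha> ^ card H\<bar>" by (simp add: abs_mult)
    finally have "(-1) ^ card H * ?N \<le> t * ((- \<alpha>) ^ card H + \<alpha> ^ card H * pattern_error K)"
      using bound by (simp add: algebra_simps)
    then show "(-1) ^ card H * real (card {x\<in>X. H \<subseteq> hits x}) \<le> t * ((- \<alpha>) ^ card H + \<alpha> ^ card H * pattern_error K)"
      using H count[of H] by (simp add: subsets_upto_def)
  qed
  also have "\<dots> = t * ((\<Sum>H\<in>subsets_upto A K. (- \<alpha>) ^ card H) + (\<Sum>H\<in>subsets_upto A K. \<alpha> ^ card H) * pattern_error K)"
    by (simp only: sum_distrib_left[symmetric] sum.distrib sum_distrib_right[symmetric])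
  also have "\<dots> \<le> t * (((1 - \<alpha>) ^ card A + exp (2 * \<kappa>) / 2 ^ K) + exp \<kappa> * pattern_error K)"
    using thinning_bounds \<kappa> finite_A unfolding t_def
    by (intro mult_left_mono add_mono mult_right_mono pattern_error_nonneg of_nat_0_le_iff
        sum_subsets_upto_alternating_power_le sum_subsets_upto_power_le_exp) auto
  finally show ?thesis by (simp only: t_def window_error_def mult.commute add.assoc)
qed

definition local_count :: "int \<Rightarrow> int \<Rightarrow> nat \<Rightarrow> nat" where
  "local_count b u L = card {i\<in>{1..int L}. QuadRes (int q) (b * (u + i))}"

definition empty_windows :: "int \<Rightarrow> nat \<Rightarrow> int set" where
  "empty_windows b L = {x\<in>{0..<int modulus}. \<forall>i\<in>{1..int L}. \<not> QuadRes (int modulus) (b * (x + i))}"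

lemma finite_empty_windows: "finite (empty_windows b L)"
  unfolding empty_windows_def by (rule finite_subset[of _ "{0..<int modulus}"]) auto

lemma card_empty_windows_antimono: "L \<le> L' \<Longrightarrow> card (empty_windows b L') \<le> card (empty_windows b L)"
  by (intro card_mono finite_empty_windows) (auto simp: empty_windows_def)

lemma empty_windows_in_class:
  "{x\<in>empty_windows b L. x mod int q = u} =
    {x\<in>{0..<int modulus}. x mod int q = u \<and>
      (\<forall>h\<in>{i\<in>{1..int L}. QuadRes (int q) (b * (u + i))}. \<not> (\<forall>p\<in>T. QuadRes (int p) (b * (x + h))))}"
proof -
  have "(\<forall>i\<in>{1..int L}. \<not> QuadRes (int modulus) (b * (x + i))) \<longleftrightarrow>
      (\<forall>h\<in>{i\<in>{1..int L}. QuadRes (int q) (b * (u + i))}. \<not> (\<forall>p\<in>T. QuadRes (int p) (b * (x + h))))"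
    if "x mod int q = u" for x
    using QuadRes_translate_mod[of "int q" b x] that unfolding QuadRes_modulus by blast
  then show ?thesis unfolding empty_windows_def by blast
qed

lemma card_empty_windows_le:
  assumes b: "coprime b (int modulus)" and L: "L \<le> y" and K: "even K"
    and \<kappa>: "\<And>u. u \<in> {0..<int q} \<Longrightarrow> local_count b u L * \<alpha> \<le> \<kappa>"
  shows "real (card (empty_windows b L)) \<le> \<Prod>T * (\<Sum>u\<in>{0..<int q}. (1 - \<alpha>) ^ local_count b u L + window_error K \<kappa>)"
proof -
  have "card (empty_windows b L) = (\<Sum>u\<in>{0..<int q}. \<Sum>x\<in>{x\<in>empty_windows b L. x mod int q = u}. 1)"
    unfolding card_eq_sum using q_pos by (intro sum.group[symmetric] finite_empty_windows) auto
  then have "real (card (empty_windows b L)) = (\<Sum>u\<in>{0..<int q}. real (card {x\<in>empty_windows b L. x mod int q = u}))"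
    by simp
  also have "\<dots> \<le> (\<Sum>u\<in>{0..<int q}. \<Prod>T * ((1 - \<alpha>) ^ local_count b u L + window_error K \<kappa>))"
    unfolding empty_windows_in_class local_count_def using \<kappa>
    by (intro sum_mono card_avoiding_le[OF b _ _ L K]) (auto simp: local_count_def)
  finally show ?thesis by (simp add: sum_distrib_left)
qed

end

section \<open>The periodic model\<close>

lemma one_minus_power_le:
  fixes a :: real
  assumes "0 \<le> a" "a \<le> 1"
  shows "(1 - a) ^ n \<le> 1 - n * a + real n * (real n - 1) / 2 * a\<^sup>2"
proof (induction n)
  case (Suc n)
  have "(1 - a) ^ Suc n \<le> (1 - a) * (1 - n * a + real n * (real n - 1) / 2 * a\<^sup>2)"
    using Suc assms by (simp add: mult_left_mono)
  also have "\<dots> = (1 - Suc n * a + real (Suc n) * (real (Suc n) - 1) / 2 * a\<^sup>2) - real n * (real n - 1) / 2 * a ^ 3"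
    by (simp add: field_simps power2_eq_square power3_eq_cube)
  also have "\<dots> \<le> 1 - Suc n * a + real (Suc n) * (real (Suc n) - 1) / 2 * a\<^sup>2"
  proof -
    have "real n * (real n - 1) \<ge> 0" by (cases n) auto
    then show ?thesis using assms by (simp add: zero_le_mult_iff)
  qed
  finally show ?case .
qed simp

lemma one_minus_power_le_of_le:
  fixes a Q :: real
  assumes "0 \<le> a" "a \<le> 1" "n \<le> Q"
  shows "(1 - a) ^ n \<le> 1 - n * a + Q\<^sup>2 / 2 * a\<^sup>2"
proof -
  have "real n * (real n - 1) \<le> real n * real n" by (simp add: mult_left_mono)
  also have "\<dots> \<le> Q * Q" using assms(3) by (intro mult_mono) auto
  finally have "real n * (real n - 1) / 2 * a\<^sup>2 \<le> Q\<^sup>2 / 2 * a\<^sup>2"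
    by (intro mult_right_mono) (auto simp: power2_eq_square)
  then show ?thesis using one_minus_power_le[OF assms(1,2), of n] by linarith
qed

lemma sum_power_le_inverse:
  fixes w d :: real
  assumes "0 \<le> w" "w \<le> 1 - d" "0 < d"
  shows "(\<Sum>j<g. w ^ j) \<le> 1 / d"
proof -
  have "(\<Sum>j<g. w ^ j) = (1 - w ^ g) / (1 - w)" using assms by (simp add: sum_gp_strict)
  also have "\<dots> \<le> 1 / (1 - w)" using assms by (intro divide_right_mono) auto
  also have "\<dots> \<le> 1 / d" using assms by (intro divide_left_mono) auto
  finally show ?thesis .
qed

text \<open>The gain \<open>1 / 4\<close> over the value \<open>Q\<^sup>2 / (E a)\<close> of a purely random set reflects the regularity of a periodic set;
  it is positive because \<open>E < Q\<close>.\<close>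

lemma periodic_gain:
  fixes Q E a :: real
  assumes Q: "1 \<le> E" "E + 1 \<le> Q" and a: "0 < a" "Q ^ 3 * a \<le> 1 / 2"
  defines "d \<equiv> E * a * (1 - (E - 1) * a / 2)"
  shows "Q * Q - E * a * (Q * (Q - 1) / 2) + Q * (Q * (Q\<^sup>2 / 2 * a\<^sup>2)) \<le> (Q\<^sup>2 / (E * a) - 1 / 4) * d"
proof -
  have "(Q\<^sup>2 / (E * a) - 1 / 4) * d = (Q\<^sup>2 - E * a / 4) * (1 - (E - 1) * a / 2)"
    using Q a by (simp add: d_def field_simps)
  also have "\<dots> = Q\<^sup>2 - Q\<^sup>2 * (E - 1) * a / 2 - E * a / 4 + E * a / 4 * ((E - 1) * a / 2)"
    by (simp add: field_simps)
  finally have expanded: "(Q\<^sup>2 / (E * a) - 1 / 4) * d \<ge> Q\<^sup>2 - Q\<^sup>2 * (E - 1) * a / 2 - E * a / 4"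
    using Q a by simp
  have "Q * (Q ^ 3 * a) \<le> Q * (1 / 2)" using a Q by (intro mult_left_mono) auto
  moreover have "Q * 1 \<le> Q * (Q - E)" using Q by (intro mult_left_mono) auto
  ultimately have "Q * (Q ^ 3 * a) + E / 2 \<le> Q * (Q - E)" using Q by linarith
  then have "a / 2 * (Q * (Q ^ 3 * a) + E / 2) \<le> a / 2 * (Q * (Q - E))" using a by (intro mult_left_mono) auto
  then have "Q * Q - E * a * (Q * (Q - 1) / 2) + Q * (Q * (Q\<^sup>2 / 2 * a\<^sup>2)) \<le> Q\<^sup>2 - Q\<^sup>2 * (E - 1) * a / 2 - E * a / 4"
    by (simp add: power2_eq_square power3_eq_cube field_simps)
  then show ?thesis using expanded by linarith
qed

lemma bij_betw_filter: "bij_betw f A B \<Longrightarrow> bij_betw f {i\<in>A. P (f i)} {v\<in>B. P v}"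
  unfolding bij_betw_def inj_on_def by auto

lemma bij_betw_affine_mod:
  fixes b u n :: int
  assumes "coprime b n" "n > 0"
  shows "bij_betw (\<lambda>i. b * (u + i) mod n) {1..n} {0..<n}"
proof -
  have "inj_on (\<lambda>i. b * (u + i) mod n) {1..n}"
  proof (rule inj_onI)
    fix i j assume ij: "i \<in> {1..n}" "j \<in> {1..n}" "b * (u + i) mod n = b * (u + j) mod n"
    then have "[b * (u + i) = b * (u + j)] (mod n)" by (simp add: cong_def)
    then have "[u + i = u + j] (mod n)" using assms by (simp add: cong_mult_lcancel)
    then have "[i - 1 = j - 1] (mod n)" by (simp add: cong_iff_dvd_diff)
    then have "i - 1 = j - 1" using ij by (intro cong_less_imp_eq_int[of _ n]) auto
    then show "i = j" by simp
  qed
  moreover have "(\<lambda>i. b * (u + i) mod n) ` {1..n} = {0..<n}"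
  proof (rule card_subset_eq)
    show "card ((\<lambda>i. b * (u + i) mod n) ` {1..n}) = card {0..<n}" using calculation by (simp add: card_image)
  qed (use assms(2) in auto)
  ultimately show ?thesis by (simp add: bij_betw_def)
qed

context residue_setting
begin

lemma base_card_pos: "base_card \<ge> 1"
proof -
  have "0 \<in> {v\<in>{0..<int q}. QuadRes (int q) v}" using q_pos QuadRes_0 by simp
  moreover have "finite {v\<in>{0..<int q}. QuadRes (int q) v}" by (rule finite_subset[of _ "{0..<int q}"]) auto
  ultimately have "card {v\<in>{0..<int q}. QuadRes (int q) v} > 0" by (subst card_gt_0_iff) blast
  then show ?thesis by (simp add: base_card_def)
qed

lemma base_card_less:
  assumes "q \<ge> 3" shows "base_card < q"
proof -
  have "{v\<in>{0..<int q}. QuadRes (int q) v} \<subseteq> (\<lambda>a. a\<^sup>2 mod int q) ` {0..<int q - 1}"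
  proof
    fix v assume v: "v \<in> {v\<in>{0..<int q}. QuadRes (int q) v}"
    then obtain a where "[a\<^sup>2 = v] (mod int q)" by (auto simp: QuadRes_def)
    then have square: "(a mod int q)\<^sup>2 mod int q = v" using v by (simp add: cong_def power_mod)
    show "v \<in> (\<lambda>a. a\<^sup>2 mod int q) ` {0..<int q - 1}"
    proof (cases "a mod int q = int q - 1")
      case True
      have "(int q - 1)\<^sup>2 = 1\<^sup>2 + int q * (int q - 2)" by (simp add: power2_eq_square algebra_simps)
      then have "(int q - 1)\<^sup>2 mod int q = 1\<^sup>2 mod int q" by (simp only: mod_mult_self2)
      then have "v = 1\<^sup>2 mod int q" using square True by simp
      then show ?thesis using assms by (intro image_eqI[of _ _ 1]) auto
    next
      case False
      have "0 \<le> a mod int q" "a mod int q < int q" using q_pos by auto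
      then show ?thesis using square False by (intro image_eqI[of _ _ "a mod int q"]) auto
    qed
  qed
  then have "base_card \<le> card {0..<int q - 1}" unfolding base_card_def by (rule surj_card_le[rotated]) simp
  then show ?thesis using assms by simp
qed

lemma local_count_le: "local_count b u L \<le> L"
proof -
  have "local_count b u L \<le> card {1..int L}" unfolding local_count_def by (intro card_mono) auto
  then show ?thesis by simp
qed

lemma local_count_period:
  assumes "coprime b (int q)"
  shows "local_count b u q = base_card"
proof -
  have "bij_betw (\<lambda>i. b * (u + i) mod int q)
      {i\<in>{1..int q}. QuadRes (int q) (b * (u + i) mod int q)} {v\<in>{0..<int q}. QuadRes (int q) v}"
    using assms q_pos by (intro bij_betw_filter bij_betw_affine_mod) auto
  then have "card {i\<in>{1..int q}. QuadRes (int q) (b * (u + i) mod int q)} = base_card"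
    unfolding base_card_def by (rule bij_betw_same_card)
  then show ?thesis by (simp add: local_count_def QuadRes_mod)
qed

lemma local_count_add_period:
  assumes "coprime b (int q)"
  shows "local_count b u (q + L) = base_card + local_count b u L"
proof -
  let ?f = "\<lambda>i. QuadRes (int q) (b * (u + i))"
  have periodic: "?f (i + int q) = ?f i" for i
    by (intro QuadRes_cong cong_mult cong_refl) (simp add: cong_def add.assoc[symmetric])
  have "{i\<in>{1..int (q + L)}. ?f i} = {i\<in>{1..int q}. ?f i} \<union> (\<lambda>i. i + int q) ` {i\<in>{1..int L}. ?f i}" (is "_ = ?A \<union> ?B")
  proof (intro equalityI subsetI)
    fix i assume i: "i \<in> {i\<in>{1..int (q + L)}. ?f i}"
    show "i \<in> ?A \<union> ?B"
    proof (cases "i \<le> int q")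
      case False
      have "?f (i - int q)" using i periodic[of "i - int q"] by simp
      then show ?thesis using i False by (intro UnI2 image_eqI[of _ _ "i - int q"]) auto
    qed (use i in auto)
  qed (use periodic in auto)
  moreover have "finite {i\<in>{1..int n}. ?f i}" for n by (rule finite_subset[of _ "{1..int n}"]) auto
  then have "card (?A \<union> ?B) = card ?A + card ?B"
    by (intro card_Un_disjoint finite_imageI) auto
  moreover have "card ?B = card {i\<in>{1..int L}. ?f i}" by (rule card_image) (simp add: inj_on_def)
  ultimately show ?thesis using local_count_period[OF assms, of u] by (simp add: local_count_def)
qed

lemma local_count_mult_add:
  assumes "coprime b (int q)"
  shows "local_count b u (q * j + L) = base_card * j + local_count b u L"
proof (induction j)
  case (Suc j)
  have "local_count b u (q * Suc j + L) = local_count b u (q + (q * j + L))" by (simp add: add.assoc)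
  then show ?case using Suc local_count_add_period[OF assms, of u "q * j + L"] by simp
qed simp

lemma local_count_mult:
  assumes "coprime b (int q)"
  shows "local_count b u (q * j) = base_card * j"
  using local_count_mult_add[OF assms, of u j 0] by (simp add: local_count_def)

lemma local_count_mono: "L \<le> L' \<Longrightarrow> local_count b u L \<le> local_count b u L'"
  unfolding local_count_def
  by (intro card_mono finite_subset[of "{i \<in> {1..int L'}. QuadRes (int q) (b * (u + i))}" "{1..int L'}"]) auto

lemma sum_local_count: "(\<Sum>u\<in>{0..<int q}. local_count 1 u L) = base_card * L"
proof -
  have "(\<Sum>u\<in>{0..<int q}. local_count 1 u L) = base_card * card {1..int L}"
    unfolding local_count_def
  proof (rule sum_multicount)
    show "\<forall>i\<in>{1..int L}. card {u\<in>{0..<int q}. QuadRes (int q) (1 * (u + i))} = base_card"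
    proof
      fix i
      have "card {u\<in>{0..<int q}. QuadRes (int q) (u + i)} = (\<Sum>u\<in>{0..<int q}. if QuadRes (int q) (u + i) then 1 else 0)"
        by (simp add: sum.inter_filter[symmetric])
      also have "\<dots> = (\<Sum>u\<in>{0..<int q}. if QuadRes (int q) u then 1 else 0)"
        using q_pos by (intro sum_periodic_shift) (auto simp: QuadRes_mod)
      also have "\<dots> = base_card" by (simp add: base_card_def sum.inter_filter[symmetric])
      finally show "card {u\<in>{0..<int q}. QuadRes (int q) (1 * (u + i))} = base_card" by simp
    qed
  qed auto
  then show ?thesis by simp
qed

lemma sum_power_local_count_blocks:
  fixes w :: real
  assumes "coprime b (int q)"
  shows "(\<Sum>L<q * g. w ^ local_count b u L) = (\<Sum>j<g. (w ^ base_card) ^ j) * (\<Sum>L<q. w ^ local_count b u L)"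
proof -
  have "(\<Sum>L<q * g. w ^ local_count b u L) = (\<Sum>j<g. \<Sum>L\<in>{j * q..<j * q + q}. w ^ local_count b u L)"
    using sum.nat_group[of "\<lambda>L. w ^ local_count b u L" q g] by (simp add: mult.commute)
  also have "\<dots> = (\<Sum>j<g. \<Sum>L<q. w ^ local_count b u (q * j + L))"
  proof (rule sum.cong[OF refl])
    fix j
    show "(\<Sum>L\<in>{j * q..<j * q + q}. w ^ local_count b u L) = (\<Sum>L<q. w ^ local_count b u (q * j + L))"
      using sum.shift_bounds_nat_ivl[of "\<lambda>L. w ^ local_count b u L" 0 "j * q" q]
      by (simp add: add.commute mult.commute lessThan_atLeast0)
  qed
  also have "\<dots> = (\<Sum>j<g. (w ^ base_card) ^ j * (\<Sum>L<q. w ^ local_count b u L))"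
    by (simp add: local_count_mult_add[OF assms] sum_distrib_left power_add power_mult)
  finally show ?thesis by (simp add: sum_distrib_right)
qed

lemma sum_thinning_power_first_block_le:
  "(\<Sum>u\<in>{0..<int q}. \<Sum>L<q. (1 - \<alpha>) ^ local_count 1 u L)
    \<le> real q * q - base_card * \<alpha> * (real q * (real q - 1) / 2) + q * (q * ((real q)\<^sup>2 / 2 * \<alpha>\<^sup>2))"
proof -
  have "(\<Sum>u\<in>{0..<int q}. \<Sum>L<q. (1 - \<alpha>) ^ local_count 1 u L)
      \<le> (\<Sum>u\<in>{0..<int q}. \<Sum>L<q. 1 - local_count 1 u L * \<alpha> + (real q)\<^sup>2 / 2 * \<alpha>\<^sup>2)"
  proof (intro sum_mono one_minus_power_le_of_le)
    show "real (local_count 1 u L) \<le> real q" if "L \<in> {..<q}" for u L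
      using local_count_le[of 1 u L] that by simp
  qed (use thinning_bounds in auto)
  also have "\<dots> = (\<Sum>L<q. \<Sum>u\<in>{0..<int q}. 1 - local_count 1 u L * \<alpha> + (real q)\<^sup>2 / 2 * \<alpha>\<^sup>2)" by (rule sum.swap)
  also have "\<dots> = (\<Sum>L<q. q - base_card * L * \<alpha> + q * ((real q)\<^sup>2 / 2 * \<alpha>\<^sup>2))"
  proof (rule sum.cong[OF refl])
    fix L
    have "(\<Sum>u\<in>{0..<int q}. real (local_count 1 u L)) = base_card * L"
      using arg_cong[OF sum_local_count[of L], of real] by simp
    then show "(\<Sum>u\<in>{0..<int q}. 1 - local_count 1 u L * \<alpha> + (real q)\<^sup>2 / 2 * \<alpha>\<^sup>2)
        = q - base_card * L * \<alpha> + q * ((real q)\<^sup>2 / 2 * \<alpha>\<^sup>2)"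
      by (simp add: sum.distrib sum_subtractf sum_distrib_right[symmetric])
  qed
  also have "\<dots> = real q * q - base_card * \<alpha> * (\<Sum>L<q. real L) + q * (q * ((real q)\<^sup>2 / 2 * \<alpha>\<^sup>2))"
    by (simp add: sum.distrib sum_subtractf sum_distrib_left mult.commute mult.left_commute)
  also have "(\<Sum>L<n. real L) = real n * (real n - 1) / 2" for n
    by (induction n) (simp_all add: field_simps)
  finally show ?thesis .
qed

lemma sum_thinning_power_le:
  assumes q_ge_3: "q \<ge> 3" and small: "real q ^ 3 * \<alpha> \<le> 1 / 2"
  shows "(\<Sum>u\<in>{0..<int q}. \<Sum>L<q * g. (1 - \<alpha>) ^ local_count 1 u L) \<le> q * (q / (base_card * \<alpha>) - 1 / (4 * q))"
proof -
  define E where "E = real base_card"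
  define d where "d = E * \<alpha> * (1 - (E - 1) * \<alpha> / 2)"
  let ?S = "\<Sum>u\<in>{0..<int q}. \<Sum>L<q. (1 - \<alpha>) ^ local_count 1 u L"
  note \<alpha> = thinning_bounds
  have E: "1 \<le> E" "E + 1 \<le> q" using base_card_less[OF q_ge_3] base_card_pos by (auto simp: E_def)
  have "real q ^ 1 \<le> real q ^ 3" using q_ge_3 by (intro power_increasing) auto
  then have "E - 1 \<le> real q ^ 3" using E unfolding power_one_right by linarith
  then have "(E - 1) * \<alpha> \<le> real q ^ 3 * \<alpha>" using \<alpha> by (intro mult_right_mono) auto
  then have "(E - 1) * \<alpha> \<le> 1 / 2" using small by linarith
  then have d_pos: "d > 0" using E \<alpha> by (simp add: d_def)
  have "(1 - \<alpha>) ^ base_card \<le> 1 - d"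
    using one_minus_power_le[of \<alpha> base_card] \<alpha> by (simp add: d_def E_def power2_eq_square field_simps)
  then have geometric: "(\<Sum>j<g. ((1 - \<alpha>) ^ base_card) ^ j) \<le> 1 / d"
    using \<alpha> d_pos by (intro sum_power_le_inverse) auto
  have "(\<Sum>u\<in>{0..<int q}. \<Sum>L<q * g. (1 - \<alpha>) ^ local_count 1 u L) = (\<Sum>j<g. ((1 - \<alpha>) ^ base_card) ^ j) * ?S"
    by (simp add: sum_power_local_count_blocks sum_distrib_left)
  also have "\<dots> \<le> 1 / d * (((real q)\<^sup>2 / (E * \<alpha>) - 1 / 4) * d)"
  proof (intro mult_mono geometric)
    show "?S \<le> ((real q)\<^sup>2 / (E * \<alpha>) - 1 / 4) * d"
      using sum_thinning_power_first_block_le periodic_gain[OF E \<alpha>(1) small] unfolding d_def E_def by linarith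
  qed (use \<alpha> d_pos in \<open>auto intro!: sum_nonneg\<close>)
  also have "\<dots> = (real q)\<^sup>2 / (E * \<alpha>) - 1 / 4" using d_pos by simp
  also have "\<dots> = q * (q / (base_card * \<alpha>) - 1 / (4 * q))"
    using q_pos by (simp add: E_def power2_eq_square right_diff_distrib)
  finally show ?thesis .
qed

end

section \<open>Long empty windows\<close>

context residue_setting
begin

definition twist_class :: "nat \<Rightarrow> nat \<times> nat set" where
  "twist_class b = (b mod q, {p\<in>T. QuadRes (int p) (int b)})"

lemma QuadRes_twist_class:
  assumes coprime: "coprime b modulus" "coprime c modulus" and same: "twist_class b = twist_class c"
  shows "QuadRes (int modulus) (int b * v) \<longleftrightarrow> QuadRes (int modulus) (int c * v)"
proof -
  have "b mod q = c mod q" and squares: "{p\<in>T. QuadRes (int p) (int b)} = {p\<in>T. QuadRes (int p) (int c)}"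
    using same by (simp_all add: twist_class_def)
  then have "[int b = int c] (mod int q)" by (simp add: cong_def flip: of_nat_mod)
  then have "QuadRes (int q) (int b * v) \<longleftrightarrow> QuadRes (int q) (int c * v)"
    by (intro QuadRes_cong cong_mult cong_refl)
  moreover have "QuadRes (int p) (int b * v) \<longleftrightarrow> QuadRes (int p) (int c * v)" if p: "p \<in> T" for p
  proof -
    have "\<not> int p dvd int b" "\<not> int p dvd int c"
      using coprime by (auto intro!: coprime_modulus_not_dvd[OF _ p] simp del: int_dvd_int_iff)
    moreover have "QuadRes (int p) (int b) \<longleftrightarrow> QuadRes (int p) (int c)" using squares p by blast
    ultimately have "Legendre (int b) (int p) = Legendre (int c) (int p)" by (simp add: Legendre_def cong_0_iff)
    then show ?thesis using T[OF p] by (simp add: QuadRes_iff_Legendre Legendre_mult)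
  qed
  ultimately show ?thesis unfolding QuadRes_modulus by blast
qed

lemma empty_windows_divide:
  assumes z: "z \<in> empty_windows 1 H" and x: "x \<in> {0..<int modulus}" and eq: "[int b * x = z + s] (mod int modulus)"
    and b: "0 < b" "b \<le> B" and s: "0 \<le> s" "s < int h" and H: "h + B * J \<le> H"
  shows "x \<in> empty_windows (int b) J"
proof -
  have "\<not> QuadRes (int modulus) (int b * (x + i))" if i: "i \<in> {1..int J}" for i
  proof
    assume "QuadRes (int modulus) (int b * (x + i))"
    moreover have "[int b * (x + i) = z + (s + int b * i)] (mod int modulus)"
      using cong_add[OF eq cong_refl[of "int b * i" "int modulus"]] by (simp add: algebra_simps)
    ultimately have "QuadRes (int modulus) (z + (s + int b * i))" using QuadRes_cong by blast
    moreover have "s + int b * i \<in> {1..int H}"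
    proof -
      have "1 * 1 \<le> int b * i" using b i by (intro mult_mono) auto
      moreover have "int b * i \<le> int B * int J" using b i by (intro mult_mono) auto
      moreover have "int h + int B * int J \<le> int H" using H by (metis of_nat_add of_nat_le_iff of_nat_mult)
      ultimately show ?thesis using s by auto
    qed
    ultimately show False using z by (auto simp: empty_windows_def)
  qed
  then show ?thesis using x by (simp add: empty_windows_def)
qed

lemma card_empty_windows_twist_class_le:
  fixes \<delta> :: real
  assumes sparse: "\<And>b. coprime b (int modulus) \<Longrightarrow> card (empty_windows b J) \<le> \<delta> * modulus" and \<delta>: "\<delta> \<le> 1 / 2"
    and B: "0 < B" "B \<le> h" "h + B * J \<le> H"
    and \<B>: "finite \<B>" "\<And>b. b \<in> \<B> \<Longrightarrow> prime b \<and> b \<le> B \<and> coprime b modulus \<and> twist_class b = c"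
  shows "real (card (empty_windows 1 H)) * card \<B> \<le> 20 * sieve_log B modulus * \<delta> * modulus"
proof (cases "\<B> = {}")
  case True
  have "0 \<le> \<delta> * modulus" using sparse[of 1] by simp
  then show ?thesis using True sieve_log_nonneg[of "int modulus" B] modulus_pos by (simp add: mult.assoc)
next
  case False
  then obtain b\<^sub>0 where b\<^sub>0: "b\<^sub>0 \<in> \<B>" by blast
  define D where "D = empty_windows (int b\<^sub>0) J"
  define Z where "Z = real (card (empty_windows 1 H)) * card \<B>"
  have Z: "Z * (real_of_int (int modulus) - card D)\<^sup>2 \<le> 5 * sieve_log B (int modulus) * (int modulus)\<^sup>2 * card D"
    unfolding Z_def
  proof (rule large_sieve_dilates[OF _ \<B>(1) _ B(1,2)])
    show "int modulus > 0" using modulus_pos by simp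
    show "prime b \<and> b \<le> B \<and> coprime (int b) (int modulus)" if "b \<in> \<B>" for b using \<B>(2)[OF that] by simp
    show "D \<subseteq> {0..<int modulus}" "empty_windows 1 H \<subseteq> {0..<int modulus}" by (auto simp: D_def empty_windows_def)
    fix z b s x
    assume z: "z \<in> empty_windows 1 H" and b: "b \<in> \<B>" and s: "s \<in> {0..<int h}" and x: "x \<in> {0..<int modulus}"
      and eq: "[int b * x = z + s] (mod int modulus)"
    have "x \<in> empty_windows (int b) J"
      using \<B>(2)[OF b] s by (intro empty_windows_divide[OF z x eq _ _ _ _ B(3)]) (auto simp: prime_gt_0_nat)
    then show "x \<in> D"
      using QuadRes_twist_class[of b\<^sub>0 b] \<B>(2)[OF b] \<B>(2)[OF b\<^sub>0] by (simp add: D_def empty_windows_def)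
  qed
  have D: "real (card D) \<le> \<delta> * modulus" unfolding D_def using sparse \<B>(2)[OF b\<^sub>0] by simp
  have "\<delta> * modulus \<le> 1 / 2 * modulus" using \<delta> by (intro mult_right_mono) auto
  then have "real modulus / 2 \<le> real modulus - card D" using D by simp
  then have "Z * (real modulus / 2)\<^sup>2 \<le> Z * (real modulus - card D)\<^sup>2"
    unfolding Z_def by (intro mult_left_mono power_mono) auto
  also have "\<dots> \<le> 5 * sieve_log B modulus * (real modulus)\<^sup>2 * card D" using Z by simp
  also have "\<dots> \<le> 5 * sieve_log B modulus * (real modulus)\<^sup>2 * (\<delta> * modulus)"
    using D sieve_log_nonneg[of "int modulus" B] modulus_pos by (intro mult_left_mono) auto
  finally have "Z * (real modulus)\<^sup>2 \<le> (20 * sieve_log B modulus * \<delta> * modulus) * (real modulus)\<^sup>2"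
    by (simp add: power2_eq_square algebra_simps)
  then show ?thesis using modulus_pos by (simp add: Z_def)
qed

definition coprime_primes_le :: "nat \<Rightarrow> nat set" where
  "coprime_primes_le B = {b. prime b \<and> b \<le> B \<and> coprime b modulus}"

lemma finite_coprime_primes_le: "finite (coprime_primes_le B)"
  unfolding coprime_primes_le_def by (rule finite_subset[OF _ finite_primes_le[of B]]) auto

lemma card_empty_windows_large_sieve:
  fixes \<delta> :: real
  assumes sparse: "\<And>b. coprime b (int modulus) \<Longrightarrow> card (empty_windows b J) \<le> \<delta> * modulus" and \<delta>: "\<delta> \<le> 1 / 2"
    and B: "0 < B" "B \<le> h" "h + B * J \<le> H"
  shows "real (card (empty_windows 1 H)) * card (coprime_primes_le B)
         \<le> q * 2 ^ card T * (20 * sieve_log B modulus * \<delta> * modulus)"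
proof -
  let ?C = "{0..<q} \<times> Pow T"
  have "\<exists>c\<in>?C. card (twist_class -` {c} \<inter> coprime_primes_le B) * card ?C \<ge> card (coprime_primes_le B)"
    using q_pos finite_T finite_coprime_primes_le by (intro pigeonhole_card) (auto simp: twist_class_def)
  then obtain c where "card (coprime_primes_le B) \<le> card (twist_class -` {c} \<inter> coprime_primes_le B) * card ?C" by blast
  then have "real (card (coprime_primes_le B)) \<le> card (twist_class -` {c} \<inter> coprime_primes_le B) * card ?C"
    by (simp only: of_nat_le_iff)
  moreover have "card ?C = q * 2 ^ card T" using finite_T by (simp add: card_Pow)
  ultimately have "real (card (empty_windows 1 H)) * card (coprime_primes_le B)
      \<le> real (card (empty_windows 1 H)) * (card (twist_class -` {c} \<inter> coprime_primes_le B) * (q * 2 ^ card T))"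
    by (intro mult_left_mono) auto
  also have "\<dots> = q * 2 ^ card T * (real (card (empty_windows 1 H)) * card (twist_class -` {c} \<inter> coprime_primes_le B))"
    by simp
  also have "\<dots> \<le> q * 2 ^ card T * (20 * sieve_log B modulus * \<delta> * modulus)"
    using finite_coprime_primes_le
    by (intro mult_left_mono card_empty_windows_twist_class_le[OF sparse \<delta> B]) (auto simp: coprime_primes_le_def)
  finally show ?thesis .
qed

lemma card_empty_windows_full_periods:
  assumes b: "coprime b (int modulus)" and L: "q * g \<le> y" and K: "even K" and \<kappa>: "base_card * g * \<alpha> \<le> \<kappa>"
  shows "real (card (empty_windows b (q * g))) \<le> modulus * ((1 - \<alpha>) ^ (base_card * g) + window_error K \<kappa>)"
proof -
  have coprime: "coprime b (int q)" using b by (simp add: modulus_def)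
  have "real (card (empty_windows b (q * g))) \<le> \<Prod>T * (\<Sum>u\<in>{0..<int q}. (1 - \<alpha>) ^ local_count b u (q * g) + window_error K \<kappa>)"
    using \<kappa> by (intro card_empty_windows_le[OF b L K]) (simp add: local_count_mult[OF coprime])
  then show ?thesis by (simp add: local_count_mult[OF coprime] modulus_def mult.assoc mult.left_commute)
qed

lemma sum_card_empty_windows_head:
  assumes q_ge_3: "q \<ge> 3" and small: "real q ^ 3 * \<alpha> \<le> 1 / 2"
    and L: "q * g \<le> y" and K: "even K" and \<kappa>: "base_card * g * \<alpha> \<le> \<kappa>"
  shows "(\<Sum>L<q * g. real (card (empty_windows 1 L)))
    \<le> modulus * (q / (base_card * \<alpha>) - 1 / (4 * q) + q * g * window_error K \<kappa>)"
proof -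
  have "(\<Sum>L<q * g. real (card (empty_windows 1 L)))
     \<le> (\<Sum>L<q * g. \<Prod>T * (\<Sum>u\<in>{0..<int q}. (1 - \<alpha>) ^ local_count 1 u L + window_error K \<kappa>))"
  proof (intro sum_mono card_empty_windows_le K)
    fix L' u assume "L' \<in> {..<q * g}"
    then have "local_count 1 u L' \<le> local_count 1 u (q * g)" by (intro local_count_mono) simp
    then have "real (local_count 1 u L') \<le> real (base_card * g)"
      unfolding of_nat_le_iff by (simp add: local_count_mult)
    then have "local_count 1 u L' * \<alpha> \<le> real (base_card * g) * \<alpha>" using thinning_bounds by (intro mult_right_mono) auto
    then show "local_count 1 u L' * \<alpha> \<le> \<kappa>" using \<kappa> by simp
    show "L' \<le> y" using \<open>L' \<in> {..<q * g}\<close> L by simp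
  qed simp
  also have "\<dots> = \<Prod>T * ((\<Sum>L<q * g. \<Sum>u\<in>{0..<int q}. (1 - \<alpha>) ^ local_count 1 u L) + q * (q * g) * window_error K \<kappa>)"
    by (simp add: sum_distrib_left[symmetric] sum.distrib algebra_simps)
  also have "(\<Sum>L<q * g. \<Sum>u\<in>{0..<int q}. (1 - \<alpha>) ^ local_count 1 u L) = (\<Sum>u\<in>{0..<int q}. \<Sum>L<q * g. (1 - \<alpha>) ^ local_count 1 u L)"
    by (rule sum.swap)
  also have "\<Prod>T * (\<dots> + q * (q * g) * window_error K \<kappa>)
      \<le> \<Prod>T * (q * (q / (base_card * \<alpha>) - 1 / (4 * q)) + q * (q * g) * window_error K \<kappa>)"
    using sum_thinning_power_le[OF q_ge_3 small, of g] by (intro mult_left_mono add_right_mono of_nat_0_le_iff)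
  also have "\<dots> = modulus * (q / (base_card * \<alpha>) - 1 / (4 * q) + q * g * window_error K \<kappa>)"
    by (simp add: modulus_def algebra_simps)
  finally show ?thesis .
qed

end

section \<open>Good moduli\<close>

lemma exp_nat_mult_ln:
  assumes "x > 0" shows "exp (real n * ln x) = x ^ n"
  using assms by (simp add: exp_of_nat_mult)

lemma exp_2_le_8: "exp (2::real) \<le> 8"
proof -
  have "exp (2::real) = exp 1 * exp 1" by (simp flip: exp_add)
  also have "\<dots> \<le> (272/100) * (272/100)" using e_less_272 by (intro mult_mono) auto
  finally show ?thesis by simp
qed

lemma inverse_power_mono: "(x::real) \<ge> 1 \<Longrightarrow> m \<le> n \<Longrightarrow> 1 / x ^ n \<le> 1 / x ^ m"
  by (intro divide_left_mono power_increasing) auto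

lemma inverse_power_absorb: "(x::real) > 0 \<Longrightarrow> c \<le> x ^ m \<Longrightarrow> c / x ^ (n + m) \<le> 1 / x ^ n"
  by (simp add: field_simps power_add)

lemma one_plus_power_minus_one_le:
  fixes \<eta> :: real
  assumes "0 \<le> \<eta>" "n * \<eta> \<le> 1"
  shows "(1 + \<eta>) ^ n - 1 \<le> 2 * (n * \<eta>)"
proof -
  have "(1 + \<eta>) ^ n \<le> exp (n * \<eta>)" using assms by (intro one_plus_power_le_exp) auto
  also have "\<dots> \<le> 1 + n * \<eta> + (n * \<eta>)\<^sup>2" using assms by (intro exp_bound) auto
  also have "(n * \<eta>)\<^sup>2 \<le> n * \<eta>"
    unfolding power2_eq_square using assms by (intro mult_left_le_one_le) auto
  finally show ?thesis by (simp add: mult.commute)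
qed

lemma harm_le_one_plus_ln: "n > 0 \<Longrightarrow> harm n \<le> 1 + ln (real n)"
  using euler_mascheroni_sequence_decreasing[of 1 n] by (simp add: harm_def)

lemma half_le_div:
  fixes a b :: nat
  assumes "a div b \<ge> 1" shows "real a / (2 * real b) \<le> real (a div b)"
proof -
  have b: "b > 0" using assms by (cases b) auto
  have "a < (a div b + 1) * b" using dividend_less_div_times[OF b, of a] by (simp add: algebra_simps)
  also have "\<dots> \<le> (2 * (a div b)) * b" using assms by (intro mult_right_mono) auto
  finally have "real a \<le> real (2 * (a div b) * b)" by (simp only: of_nat_le_iff)
  then show ?thesis using b by (simp add: field_simps)
qed

lemma divide_minus_divide_square_le:
  fixes m k :: real
  assumes "0 \<le> m" "0 < k"
  shows "m / k - m / k\<^sup>2 \<le> (m + 1) / (k + 1)"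
proof -
  have "m * ((k - 1) * (k + 1)) \<le> m * k\<^sup>2"
    using assms by (intro mult_left_mono) (auto simp: power2_eq_square algebra_simps)
  then have "m * (k - 1) / k\<^sup>2 \<le> m / (k + 1)" using assms by (simp add: field_simps)
  moreover have "m / k - m / k\<^sup>2 = m * (k - 1) / k\<^sup>2" using assms by (simp add: field_simps power2_eq_square)
  moreover have "m / (k + 1) \<le> (m + 1) / (k + 1)" using assms by (intro divide_right_mono) auto
  ultimately show ?thesis by linarith
qed

locale good_modulus = residue_setting +
  fixes \<Lambda> :: real
  assumes \<Lambda>: "\<Lambda> \<ge> 20000" and q_ge_3: "q \<ge> 3" and q_power: "real q ^ 20 \<le> \<Lambda>"
    and many_primes: "\<Lambda> \<le> (2 ^ card T) ^ 4" and few_primes: "2 ^ card T \<le> \<Lambda> ^ 2"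
    and y_ge: "\<Lambda> ^ 220 \<le> real y" and ln_modulus: "ln (real modulus) \<le> \<Lambda>"
begin

lemma \<Lambda>_ge_1: "\<Lambda> \<ge> 1" and \<Lambda>_pos: "\<Lambda> > 0"
  using \<Lambda> by auto

lemma le_\<Lambda>_power: "0 < n \<Longrightarrow> \<Lambda> \<le> \<Lambda> ^ n"
  using \<Lambda>_ge_1 by (intro self_le_power)

lemma ln_\<Lambda>_pos: "0 < ln \<Lambda>"
  using \<Lambda> by simp

lemma ln_\<Lambda>_le: "ln \<Lambda> \<le> \<Lambda>"
  using ln_le_minus_one[of \<Lambda>] \<Lambda> by simp

lemma q_le_\<Lambda>: "real q \<le> \<Lambda>"
proof -
  have "real q \<le> real q ^ 20" using q_ge_3 by (intro self_le_power) auto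
  then show ?thesis using q_power by linarith
qed

lemma thinning_lower: "1 / \<Lambda> ^ 2 \<le> \<alpha>"
  unfolding thinning_def using few_primes by (intro divide_left_mono) (use \<Lambda>_ge_1 in auto)

lemma q_cubed_thinning_le: "real q ^ 3 * \<alpha> \<le> 1 / 2"
proof (rule ccontr)
  assume "\<not> ?thesis"
  then have "(1 / 2) ^ 20 < (real q ^ 3 * \<alpha>) ^ 20" by (intro power_strict_mono) auto
  also have "\<dots> = (real q ^ 20) ^ 3 / ((2 ^ card T) ^ 4) ^ 5"
    by (simp add: thinning_def power_mult_distrib power_divide flip: power_mult)
  also have "\<dots> \<le> \<Lambda> ^ 3 / \<Lambda> ^ 5"
    using q_power many_primes \<Lambda>_ge_1 by (intro frac_le power_mono) auto
  also have "\<dots> = 1 / \<Lambda> ^ 2" using \<Lambda>_ge_1 by (simp add: field_simps)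
  also have "\<dots> \<le> 1 / 20000 ^ 2" using \<Lambda> by (intro divide_left_mono power_mono) auto
  finally show False by (simp add: power_divide)
qed

lemma density_pos: "0 < base_card * \<alpha>"
  using base_card_pos thinning_bounds by simp

lemma density_le_1: "base_card * \<alpha> \<le> 1"
proof -
  have "real base_card \<le> real q" using base_card_less[OF q_ge_3] by simp
  also have "\<dots> \<le> real q ^ 3" using q_ge_3 by (intro self_le_power) auto
  finally have "base_card * \<alpha> \<le> real q ^ 3 * \<alpha>" using thinning_bounds by (intro mult_right_mono) auto
  then show ?thesis using q_cubed_thinning_le by simp
qed

lemma density_lower: "1 / \<Lambda> ^ 2 \<le> base_card * \<alpha>"
proof -
  have "1 * \<alpha> \<le> base_card * \<alpha>" using base_card_pos thinning_bounds by (intro mult_right_mono) auto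
  then show ?thesis using thinning_lower by simp
qed

lemma card_T_le: "real (card T) \<le> \<Lambda>"
proof -
  have "real (card T) * (2 / 3) \<le> real (card T) * ln 2" using ln2_ge_two_thirds by (intro mult_left_mono) auto
  also have "\<dots> = ln (2 ^ card T)" by (simp add: ln_realpow)
  also have "\<dots> \<le> ln (\<Lambda> ^ 2)" using few_primes \<Lambda>_ge_1 by (subst ln_le_cancel_iff) auto
  also have "\<dots> = 4 * ln (sqrt \<Lambda>)" using \<Lambda>_ge_1 by (simp add: ln_realpow ln_sqrt)
  also have "\<dots> \<le> 4 * sqrt \<Lambda>" using ln_le_minus_one[of "sqrt \<Lambda>"] \<Lambda>_ge_1 by simp
  finally have "real (card T) \<le> 6 * sqrt \<Lambda>" by simp
  also have "\<dots> \<le> sqrt \<Lambda> * sqrt \<Lambda>"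
  proof (rule mult_right_mono)
    show "6 \<le> sqrt \<Lambda>" using \<Lambda> by (intro real_le_rsqrt) simp
  qed (use \<Lambda>_ge_1 in simp)
  finally show ?thesis using \<Lambda>_ge_1 by simp
qed

lemma pattern_error_le:
  assumes "real K \<le> 100 * ln \<Lambda> + 2" "2 ^ K \<le> exp 2 * \<Lambda> ^ 70"
  shows "pattern_error K \<le> 1 / \<Lambda> ^ 36"
proof -
  define \<eta> where "\<eta> = 22 * real K * 2 ^ K / sqrt y"
  have \<eta>_nonneg: "\<eta> \<ge> 0" by (simp add: \<eta>_def)
  have "\<Lambda> ^ 110 = sqrt (\<Lambda> ^ 220)" using \<Lambda>_ge_1 by (intro real_sqrt_unique[symmetric]) (auto simp flip: power_mult)
  also have "\<dots> \<le> sqrt y" using y_ge by (rule real_sqrt_le_mono)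
  finally have sqrt_y: "\<Lambda> ^ 110 \<le> sqrt y" .
  have "22 * real K \<le> 22 * (102 * \<Lambda>)" using assms(1) ln_\<Lambda>_le \<Lambda> by simp
  then have "22 * real K * 2 ^ K \<le> 22 * (102 * \<Lambda>) * (8 * \<Lambda> ^ 70)"
    using assms(2) exp_2_le_8 \<Lambda>_ge_1 by (intro mult_mono) (auto intro: order_trans[OF _ mult_right_mono])
  then have "\<eta> \<le> 22 * (102 * \<Lambda>) * (8 * \<Lambda> ^ 70) / \<Lambda> ^ 110"
    unfolding \<eta>_def using sqrt_y \<Lambda>_ge_1 by (intro frac_le) auto
  also have "22 * (102 * \<Lambda>) * (8 * \<Lambda> ^ 70) = (17952 * \<Lambda> ^ 70) * \<Lambda>" by simp
  also have "(17952 * \<Lambda> ^ 70) * \<Lambda> / \<Lambda> ^ 110 \<le> (\<Lambda> * \<Lambda> ^ 70) * \<Lambda> / \<Lambda> ^ 110"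
    using \<Lambda> by (intro divide_right_mono mult_right_mono) auto
  also have "\<dots> = 1 / \<Lambda> ^ 38" using \<Lambda>_ge_1 by (simp add: field_simps flip: power_Suc power_add)
  finally have "card T * \<eta> \<le> \<Lambda> * (1 / \<Lambda> ^ 38)" using card_T_le \<eta>_nonneg \<Lambda>_ge_1 by (intro mult_mono) auto
  also have "\<dots> = 1 / \<Lambda> ^ 37" using \<Lambda>_ge_1 by (simp add: field_simps flip: power_Suc)
  finally have T\<eta>: "card T * \<eta> \<le> 1 / \<Lambda> ^ 37" .
  then have "card T * \<eta> \<le> 1" using inverse_power_mono[OF \<Lambda>_ge_1, of 0 37] by simp
  then have "pattern_error K \<le> 2 * (card T * \<eta>)"
    unfolding pattern_error_def \<eta>_def[symmetric] using \<eta>_nonneg by (intro one_plus_power_minus_one_le)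
  also have "\<dots> \<le> 2 / \<Lambda> ^ (36 + 1)" using T\<eta> by simp
  also have "\<dots> \<le> 1 / \<Lambda> ^ 36" using \<Lambda> by (intro inverse_power_absorb) auto
  finally show ?thesis .
qed

lemma pattern_error_1_le: "pattern_error 1 \<le> 1 / \<Lambda> ^ 36"
proof (rule pattern_error_le)
  show "real 1 \<le> 100 * ln \<Lambda> + 2" using ln_\<Lambda>_pos by simp
  have "2 * 1 \<le> exp 2 * \<Lambda> ^ 70"
    using \<Lambda>_ge_1 exp_ge_add_one_self[of "2::real"] by (intro mult_mono) (auto simp: one_le_power)
  then show "2 ^ 1 \<le> exp 2 * \<Lambda> ^ 70" by simp
qed

definition truncation :: nat where "truncation = 2 * nat \<lceil>50 * ln \<Lambda>\<rceil>"

lemma even_truncation: "even truncation"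
  by (simp add: truncation_def)

lemma truncation_bounds: "100 * ln \<Lambda> \<le> real truncation" "real truncation \<le> 100 * ln \<Lambda> + 2"
  using ln_\<Lambda>_pos unfolding truncation_def by linarith+

lemma two_power_truncation_bounds: "\<Lambda> ^ 66 \<le> 2 ^ truncation" "2 ^ truncation \<le> exp 2 * \<Lambda> ^ 70"
proof -
  have two_power: "(2::real) ^ truncation = exp (truncation * ln 2)" by (simp add: exp_of_nat_mult)
  have "real 66 * ln \<Lambda> \<le> 100 * ln \<Lambda> * ln 2" using ln2_ge_two_thirds ln_\<Lambda>_pos by simp
  also have "\<dots> \<le> real truncation * ln 2" using truncation_bounds by (intro mult_right_mono) auto
  finally show "\<Lambda> ^ 66 \<le> 2 ^ truncation"
    unfolding two_power exp_nat_mult_ln[OF \<Lambda>_pos, symmetric] by simp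
  have "real truncation * ln 2 \<le> (100 * ln \<Lambda> + 2) * (25 / 36)"
    using truncation_bounds ln2_le_25_over_36 ln_\<Lambda>_pos by (intro mult_mono) auto
  also have "\<dots> \<le> 2 + real 70 * ln \<Lambda>" using ln_\<Lambda>_pos by simp
  finally show "2 ^ truncation \<le> exp 2 * \<Lambda> ^ 70"
    unfolding two_power exp_nat_mult_ln[OF \<Lambda>_pos, symmetric] exp_add[symmetric] by simp
qed

lemma window_error_truncation_le: "window_error truncation (16 * ln \<Lambda> + 1) \<le> 1 / \<Lambda> ^ 18"
proof -
  have "exp (2 * (16 * ln \<Lambda> + 1)) = exp (real 32 * ln \<Lambda>) * exp 2" by (simp flip: exp_add)
  also have "\<dots> = \<Lambda> ^ 32 * exp 2" by (simp only: exp_nat_mult_ln[OF \<Lambda>_pos])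
  also have "\<dots> \<le> \<Lambda> ^ 32 * 8" using exp_2_le_8 \<Lambda>_ge_1 by (intro mult_left_mono) auto
  finally have "exp (2 * (16 * ln \<Lambda> + 1)) / 2 ^ truncation \<le> \<Lambda> ^ 32 * 8 / \<Lambda> ^ 66"
    using two_power_truncation_bounds(1) \<Lambda>_ge_1 by (intro frac_le) auto
  also have "\<dots> = 8 / \<Lambda> ^ (33 + 1)" using \<Lambda>_ge_1 by (simp add: field_simps flip: power_add)
  also have "\<dots> \<le> 1 / \<Lambda> ^ 33" using \<Lambda> by (intro inverse_power_absorb) auto
  also have "\<dots> \<le> 1 / \<Lambda> ^ 19" by (intro inverse_power_mono \<Lambda>_ge_1) auto
  finally have tail: "exp (2 * (16 * ln \<Lambda> + 1)) / 2 ^ truncation \<le> 1 / \<Lambda> ^ 19" .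
  have "exp (16 * ln \<Lambda> + 1) = exp (real 16 * ln \<Lambda>) * exp 1" by (simp add: exp_add)
  also have "\<dots> = \<Lambda> ^ 16 * exp 1" by (simp only: exp_nat_mult_ln[OF \<Lambda>_pos])
  also have "\<dots> \<le> \<Lambda> ^ 16 * 8" using e_less_272 \<Lambda>_ge_1 by (intro mult_left_mono) auto
  finally have "pattern_error truncation * exp (16 * ln \<Lambda> + 1) \<le> 1 / \<Lambda> ^ 36 * (\<Lambda> ^ 16 * 8)"
    using pattern_error_le[OF truncation_bounds(2) two_power_truncation_bounds(2)] \<Lambda>_ge_1 by (intro mult_mono) auto
  also have "\<dots> = 8 / \<Lambda> ^ (19 + 1)" using \<Lambda>_ge_1 by (simp add: field_simps flip: power_add)
  also have "\<dots> \<le> 1 / \<Lambda> ^ 19" using \<Lambda> by (intro inverse_power_absorb) auto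
  finally have "window_error truncation (16 * ln \<Lambda> + 1) \<le> 2 / \<Lambda> ^ (18 + 1)" using tail by (simp add: window_error_def)
  also have "\<dots> \<le> 1 / \<Lambda> ^ 18" using \<Lambda> by (intro inverse_power_absorb) auto
  finally show ?thesis .
qed

text \<open>Windows of \<open>head_periods\<close> periods are long enough to be empty with probability at most \<open>\<Lambda>\<^sup>-\<^sup>1\<^sup>6\<close> in the random model.\<close>

definition head_periods :: nat where "head_periods = nat \<lceil>16 * ln \<Lambda> / (base_card * \<alpha>)\<rceil>"

definition head_length :: nat where "head_length = q * head_periods"

lemma head_periods_bounds:
  "16 * ln \<Lambda> \<le> base_card * head_periods * \<alpha>" "base_card * head_periods * \<alpha> \<le> 16 * ln \<Lambda> + 1" "1 \<le> head_periods"
proof -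
  define x where "x = 16 * ln \<Lambda> / (base_card * \<alpha>)"
  have x_pos: "x > 0" using ln_\<Lambda>_pos density_pos by (simp add: x_def)
  have round: "x \<le> head_periods" "head_periods \<le> x + 1"
    using x_pos unfolding head_periods_def x_def[symmetric] by linarith+
  have x_eq: "x * (base_card * \<alpha>) = 16 * ln \<Lambda>"
    using density_pos nonzero_eq_divide_eq[of "base_card * \<alpha>" x "16 * ln \<Lambda>"] x_def by linarith
  have "x * (base_card * \<alpha>) \<le> head_periods * (base_card * \<alpha>)" using round density_pos by (intro mult_right_mono) auto
  then show "16 * ln \<Lambda> \<le> base_card * head_periods * \<alpha>" using x_eq by (simp add: mult.commute mult.left_commute)
  have "head_periods * (base_card * \<alpha>) \<le> (x + 1) * (base_card * \<alpha>)" using round density_pos by (intro mult_right_mono) auto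
  also have "\<dots> \<le> 16 * ln \<Lambda> + 1" using x_eq density_le_1 by (simp add: ring_distribs)
  finally show "base_card * head_periods * \<alpha> \<le> 16 * ln \<Lambda> + 1" by (simp add: mult.commute mult.left_commute)
  show "1 \<le> head_periods" using round x_pos by (cases head_periods) auto
qed

lemma head_length_pos: "1 \<le> head_length"
  using head_periods_bounds(3) q_pos by (simp add: head_length_def Suc_le_eq)

lemma head_length_le: "real head_length \<le> \<Lambda> ^ 5"
proof -
  have "real head_periods * (1 / \<Lambda> ^ 2) \<le> real head_periods * (base_card * \<alpha>)"
    using density_lower by (intro mult_left_mono) auto
  also have "\<dots> \<le> 16 * ln \<Lambda> + 1" using head_periods_bounds(2) by (simp add: mult.commute mult.left_commute)
  also have "\<dots> \<le> 17 * \<Lambda>" using ln_\<Lambda>_le \<Lambda> by simp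
  also have "\<dots> \<le> \<Lambda> * \<Lambda>" using \<Lambda> by (intro mult_right_mono) auto
  finally have "real head_periods \<le> \<Lambda> * \<Lambda> * \<Lambda> ^ 2" using \<Lambda>_pos by (simp add: field_simps)
  then have "real q * real head_periods \<le> \<Lambda> * (\<Lambda> * \<Lambda> * \<Lambda> ^ 2)" using q_le_\<Lambda> \<Lambda>_ge_1 by (intro mult_mono) auto
  then show ?thesis by (simp add: head_length_def eval_nat_numeral mult.assoc)
qed

lemma head_length_le_y: "head_length \<le> y"
proof -
  have "real head_length \<le> \<Lambda> ^ 5" by (rule head_length_le)
  also have "\<Lambda> ^ 5 \<le> \<Lambda> ^ 220" using \<Lambda>_ge_1 by (intro power_increasing) auto
  also note y_ge
  finally show ?thesis by simp
qed

definition sparseness :: real (\<open>\<delta>\<close>) where "\<delta> = 1 / \<Lambda> ^ 15"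

lemma sparseness_pos: "\<delta> > 0"
  using \<Lambda>_pos by (simp add: sparseness_def)

lemma card_empty_windows_head_length_le:
  assumes "coprime b (int modulus)"
  shows "real (card (empty_windows b head_length)) \<le> \<delta> * modulus"
proof -
  have "(1 - \<alpha>) ^ (base_card * head_periods) \<le> exp (- \<alpha>) ^ (base_card * head_periods)"
    using exp_ge_add_one_self[of "- \<alpha>"] thinning_bounds by (intro power_mono) auto
  also have "\<dots> = exp (- (base_card * head_periods * \<alpha>))" by (simp add: exp_of_nat_mult[symmetric])
  also have "\<dots> \<le> exp (- (real 16 * ln \<Lambda>))" using head_periods_bounds(1) by simp
  also have "\<dots> = 1 / \<Lambda> ^ 16" unfolding exp_minus exp_nat_mult_ln[OF \<Lambda>_pos] by (simp add: divide_inverse)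
  finally have model: "(1 - \<alpha>) ^ (base_card * head_periods) \<le> 1 / \<Lambda> ^ 16" .
  have "window_error truncation (16 * ln \<Lambda> + 1) \<le> 1 / \<Lambda> ^ 18" by (rule window_error_truncation_le)
  also have "\<dots> \<le> 1 / \<Lambda> ^ 16" by (intro inverse_power_mono \<Lambda>_ge_1) auto
  finally have "(1 - \<alpha>) ^ (base_card * head_periods) + window_error truncation (16 * ln \<Lambda> + 1) \<le> 2 / \<Lambda> ^ (15 + 1)"
    using model by simp
  also have "\<dots> \<le> \<delta>" unfolding sparseness_def using \<Lambda> by (intro inverse_power_absorb) auto
  finally have "modulus * ((1 - \<alpha>) ^ (base_card * head_periods) + window_error truncation (16 * ln \<Lambda> + 1)) \<le> modulus * \<delta>"
    by (intro mult_left_mono) auto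
  moreover have "real (card (empty_windows b (q * head_periods)))
      \<le> modulus * ((1 - \<alpha>) ^ (base_card * head_periods) + window_error truncation (16 * ln \<Lambda> + 1))"
    using head_length_le_y head_periods_bounds(2)
    by (intro card_empty_windows_full_periods assms even_truncation) (auto simp: head_length_def)
  ultimately show ?thesis by (simp add: head_length_def mult.commute)
qed

lemma sum_card_empty_windows_head_length_le:
  "(\<Sum>L<head_length. real (card (empty_windows 1 L))) \<le> modulus * (q / (base_card * \<alpha>) - 1 / (4 * q) + 1 / \<Lambda> ^ 2)"
proof -
  have "(\<Sum>L<head_length. real (card (empty_windows 1 L)))
      \<le> modulus * (q / (base_card * \<alpha>) - 1 / (4 * q) + q * head_periods * window_error truncation (16 * ln \<Lambda> + 1))"
    unfolding head_length_def using head_length_le_y head_periods_bounds(2)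
    by (intro sum_card_empty_windows_head q_ge_3 q_cubed_thinning_le even_truncation) (auto simp: head_length_def)
  also have "\<dots> \<le> modulus * (q / (base_card * \<alpha>) - 1 / (4 * q) + 1 / \<Lambda> ^ 2)"
  proof (intro mult_left_mono add_left_mono)
    have "real head_length * window_error truncation (16 * ln \<Lambda> + 1) \<le> \<Lambda> ^ 5 * (1 / \<Lambda> ^ 18)"
      using head_length_le window_error_truncation_le window_error_nonneg \<Lambda>_ge_1 by (intro mult_mono) auto
    also have "\<dots> = 1 / \<Lambda> ^ 13" using \<Lambda>_ge_1 by (simp add: field_simps flip: power_add)
    also have "\<dots> \<le> 1 / \<Lambda> ^ 2" by (intro inverse_power_mono \<Lambda>_ge_1) auto
    finally show "q * head_periods * window_error truncation (16 * ln \<Lambda> + 1) \<le> 1 / \<Lambda> ^ 2" by (simp add: head_length_def)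
  qed simp
  finally show ?thesis .
qed

lemma log2_modulus_le: "log 2 modulus \<le> 2 * \<Lambda>"
proof -
  have "log 2 modulus = ln modulus / ln 2" by (simp add: log_def)
  also have "\<dots> \<le> ln modulus / (1 / 2)"
    using modulus_pos ln2_ge_two_thirds by (intro divide_left_mono) auto
  also have "\<dots> \<le> 2 * \<Lambda>" using ln_modulus by simp
  finally show ?thesis .
qed

lemma card_coprime_primes_le_ge:
  assumes B: "real B \<ge> \<Lambda> ^ 6" "B < modulus"
  shows "B / (16 * \<Lambda>) \<le> card (coprime_primes_le B)"
proof -
  have "2 \<le> real B" using le_\<Lambda>_power[of 6] B(1) \<Lambda> by simp
  then have B_ge_2: "B \<ge> 2" by simp
  have "prime_factors modulus = {b. prime b \<and> b dvd modulus}" using modulus_pos by (simp add: prime_factors_dvd)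
  then have "primes_le B \<subseteq> coprime_primes_le B \<union> prime_factors modulus"
    by (auto simp: coprime_primes_le_def intro: prime_imp_coprime)
  then have "card (primes_le B) \<le> card (coprime_primes_le B \<union> prime_factors modulus)"
    by (intro card_mono) (auto simp: finite_coprime_primes_le)
  also have "\<dots> \<le> card (coprime_primes_le B) + card (prime_factors modulus)" by (rule card_Un_le)
  finally have "real (card (primes_le B)) \<le> card (coprime_primes_le B) + real (card (prime_factors modulus))"
    by linarith
  also have "real (card (prime_factors modulus)) \<le> 2 * \<Lambda>"
    using card_prime_factors_le_log[OF modulus_pos] log2_modulus_le by linarith
  finally have upper: "real (card (primes_le B)) \<le> card (coprime_primes_le B) + 2 * \<Lambda>" by simp
  have "ln (real B) \<le> ln (real modulus)" using B(2) B_ge_2 by simp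
  then have "ln (real B) \<le> \<Lambda>" using ln_modulus by linarith
  then have "card (primes_le B) * ln B \<le> card (primes_le B) * \<Lambda>" by (intro mult_left_mono) auto
  then have "real B / 8 \<le> card (primes_le B) * \<Lambda>" using prime_counting_lower_bound[OF B_ge_2] by linarith
  then have lower: "2 * (real B / (16 * \<Lambda>)) \<le> card (primes_le B)" using \<Lambda>_pos by (simp add: field_simps)
  have "32 * \<Lambda> ^ 2 \<le> \<Lambda> ^ 4 * \<Lambda> ^ 2" using le_\<Lambda>_power[of 4] \<Lambda> by (intro mult_right_mono) auto
  then have "32 * \<Lambda> ^ 2 \<le> real B" using B(1) by (simp flip: power_add)
  then have "2 * \<Lambda> \<le> real B / (16 * \<Lambda>)" using \<Lambda>_pos by (simp add: field_simps power2_eq_square)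
  then show ?thesis using upper lower by linarith
qed

lemma sieve_log_modulus_le:
  assumes "B < modulus"
  shows "sieve_log B modulus \<le> 4 * \<Lambda>"
proof -
  have "sieve_log B modulus \<le> log 2 (real modulus * modulus)"
    unfolding sieve_log_def using assms modulus_pos by (intro log_mono mult_mono) auto
  also have "\<dots> = 2 * log 2 modulus" using modulus_pos by (simp add: log_mult)
  finally show ?thesis using log2_modulus_le by simp
qed

lemma card_empty_windows_times_primes_le:
  assumes L: "L < modulus" and B: "B = L div (2 * head_length)" "B \<ge> 1"
  shows "real (card (empty_windows 1 L)) * card (coprime_primes_le B) \<le> 80 * \<Lambda> ^ 4 * \<delta> * modulus"
proof -
  have B_le: "B \<le> L div 2" unfolding B(1) using head_length_pos by (intro div_le_mono2) auto
  have "2 * (B * head_length) \<le> L" unfolding B(1) by (metis div_times_less_eq_dividend mult.assoc mult.commute)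
  then have room: "L div 2 + B * head_length \<le> L" by linarith
  have "\<delta> \<le> 1 / 2"
    unfolding sparseness_def using le_\<Lambda>_power[of 15] \<Lambda> by (intro divide_left_mono) auto
  then have "real (card (empty_windows 1 L)) * card (coprime_primes_le B)
      \<le> q * 2 ^ card T * (20 * sieve_log B modulus * \<delta> * modulus)"
    using B(2) B_le room by (intro card_empty_windows_large_sieve[OF card_empty_windows_head_length_le, of _ "L div 2"]) auto
  also have "\<dots> \<le> \<Lambda> * \<Lambda> ^ 2 * (20 * (4 * \<Lambda>) * \<delta> * modulus)"
  proof (rule mult_mono)
    have "real q * 2 ^ card T \<le> \<Lambda> * \<Lambda> ^ 2" using q_le_\<Lambda> few_primes \<Lambda>_ge_1 by (intro mult_mono) auto
    then show "q * 2 ^ card T \<le> \<Lambda> * \<Lambda> ^ 2" by simp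
    have "B < modulus" using B_le L by linarith
    then show "20 * sieve_log B modulus * \<delta> * modulus \<le> 20 * (4 * \<Lambda>) * \<delta> * modulus"
      using sieve_log_modulus_le sparseness_pos by (intro mult_right_mono mult_left_mono) auto
    show "0 \<le> 20 * sieve_log B modulus * \<delta> * modulus"
      using sieve_log_nonneg[of "int modulus" B] modulus_pos sparseness_pos by simp
  qed (use \<Lambda>_ge_1 in auto)
  also have "\<dots> = 80 * \<Lambda> ^ 4 * \<delta> * modulus" by (simp add: power_def eval_nat_numeral)
  finally show ?thesis .
qed

lemma card_empty_windows_very_long_le:
  assumes L: "L < modulus" and B: "real (L div (2 * head_length)) \<ge> \<Lambda> ^ 6"
  shows "real (card (empty_windows 1 L)) * L \<le> modulus * (\<Lambda> ^ 12 * \<delta>)"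
proof -
  define B where "B = L div (2 * head_length)"
  let ?Z = "real (card (empty_windows 1 L))"
  have B_ge: "real B \<ge> \<Lambda> ^ 6" using assms(2) by (simp add: B_def)
  then have B_ge_1: "B \<ge> 1" using le_\<Lambda>_power[of 6] \<Lambda> by simp
  have "B \<le> L" by (simp add: B_def)
  then have B_less: "B < modulus" using L by simp
  have "L / (4 * \<Lambda> ^ 5) \<le> L / (2 * real (2 * head_length))"
    using head_length_pos head_length_le \<Lambda>_pos by (intro divide_left_mono) auto
  also have "\<dots> \<le> B" unfolding B_def using B_ge_1 by (intro half_le_div) (simp add: B_def)
  finally have "?Z * (L / (4 * \<Lambda> ^ 5) / (16 * \<Lambda>)) \<le> ?Z * (B / (16 * \<Lambda>))"
    using \<Lambda>_pos by (intro mult_left_mono divide_right_mono) auto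
  also have "\<dots> \<le> ?Z * card (coprime_primes_le B)"
    using card_coprime_primes_le_ge[OF B_ge B_less] by (intro mult_left_mono) auto
  also have "\<dots> \<le> 80 * \<Lambda> ^ 4 * \<delta> * modulus"
    by (rule card_empty_windows_times_primes_le[OF L B_def B_ge_1])
  finally have "?Z * L \<le> 80 * \<Lambda> ^ 4 * \<delta> * modulus * (4 * \<Lambda> ^ 5 * (16 * \<Lambda>))"
    using \<Lambda>_pos by (simp add: field_simps)
  also have "\<dots> = 5120 * (\<Lambda> ^ 4 * \<Lambda> ^ 5 * \<Lambda> ^ 1) * (\<delta> * modulus)" by simp
  also have "\<dots> = 5120 * \<Lambda> ^ 10 * (\<delta> * modulus)" by (simp only: power_add[symmetric]) simp
  also have "\<dots> \<le> \<Lambda> ^ 2 * \<Lambda> ^ 10 * (\<delta> * modulus)"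
    using le_\<Lambda>_power[of 2] \<Lambda> sparseness_pos by (intro mult_right_mono) auto
  also have "\<Lambda> ^ 2 * \<Lambda> ^ 10 = \<Lambda> ^ 12" by (simp flip: power_add)
  finally show ?thesis by (simp add: mult.commute mult.left_commute)
qed

lemma card_empty_windows_moderately_long_le:
  assumes L: "head_length \<le> L" and B: "real (L div (2 * head_length)) \<le> \<Lambda> ^ 6"
  shows "real (card (empty_windows 1 L)) * L \<le> modulus * (\<Lambda> ^ 12 * \<delta>)"
proof -
  have "L \<le> (L div (2 * head_length) + 1) * (2 * head_length)"
    using dividend_less_div_times[of "2 * head_length" L] head_length_pos by (simp add: algebra_simps)
  then have "real L \<le> real ((L div (2 * head_length) + 1) * (2 * head_length))" by (simp only: of_nat_le_iff)
  also have "\<dots> = (real (L div (2 * head_length)) + 1) * (2 * real head_length)" by (simp add: algebra_simps)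
  also have "\<dots> \<le> (\<Lambda> ^ 6 + \<Lambda> ^ 6) * (2 * \<Lambda> ^ 5)"
    using B head_length_le \<Lambda>_ge_1 by (intro mult_mono add_mono) auto
  also have "\<dots> = 4 * (\<Lambda> ^ 6 * \<Lambda> ^ 5)" by simp
  also have "\<dots> = 4 * \<Lambda> ^ 11" by (simp only: power_add[symmetric]) simp
  also have "\<dots> \<le> \<Lambda> * \<Lambda> ^ 11" using \<Lambda> by (intro mult_right_mono) auto
  finally have "real L \<le> \<Lambda> ^ 12" by (simp flip: power_Suc)
  moreover have "real (card (empty_windows 1 L)) \<le> \<delta> * modulus"
    using card_empty_windows_head_length_le[of 1] card_empty_windows_antimono[OF L, of 1] by simp
  ultimately have "real (card (empty_windows 1 L)) * real L \<le> (\<delta> * modulus) * \<Lambda> ^ 12"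
    using sparseness_pos by (intro mult_mono) auto
  then show ?thesis by (simp add: mult.commute mult.left_commute)
qed

lemma card_empty_windows_tail_le:
  assumes L: "head_length \<le> L" "L < modulus"
  shows "real (card (empty_windows 1 L)) \<le> modulus * (\<Lambda> ^ 12 * \<delta>) / L"
proof -
  have "real (card (empty_windows 1 L)) * L \<le> modulus * (\<Lambda> ^ 12 * \<delta>)"
    using card_empty_windows_very_long_le[OF L(2)] card_empty_windows_moderately_long_le[OF L(1)] by linarith
  moreover have "L > 0" using L head_length_pos by simp
  ultimately show ?thesis by (simp add: le_divide_eq)
qed

lemma sum_card_empty_windows_le:
  "(\<Sum>L<modulus. real (card (empty_windows 1 L))) \<le> modulus * (q / (base_card * \<alpha>) - 1 / (4 * q) + 3 / \<Lambda> ^ 2)"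
proof -
  let ?Z = "\<lambda>L. real (card (empty_windows 1 L))"
  have "(\<Sum>L<modulus. ?Z L) \<le> (\<Sum>L\<in>{..<head_length} \<union> {head_length..<modulus}. ?Z L)"
    by (intro sum_mono2) auto
  also have "\<dots> = (\<Sum>L<head_length. ?Z L) + (\<Sum>L\<in>{head_length..<modulus}. ?Z L)"
    by (intro sum.union_disjoint) auto
  also have "(\<Sum>L\<in>{head_length..<modulus}. ?Z L) \<le> (\<Sum>L\<in>{head_length..<modulus}. modulus * (\<Lambda> ^ 12 * \<delta>) / L)"
    by (intro sum_mono card_empty_windows_tail_le) auto
  also have "\<dots> \<le> (\<Sum>L\<in>{1..modulus}. modulus * (\<Lambda> ^ 12 * \<delta>) / L)"
    using head_length_pos sparseness_pos \<Lambda>_ge_1 by (intro sum_mono2) auto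
  also have "\<dots> = modulus * (\<Lambda> ^ 12 * \<delta>) * harm modulus" by (simp add: harm_def sum_distrib_left divide_inverse)
  also have "\<dots> \<le> modulus * (\<Lambda> ^ 12 * \<delta>) * (2 * \<Lambda>)"
  proof (rule mult_left_mono)
    show "harm modulus \<le> 2 * \<Lambda>" using harm_le_one_plus_ln[OF modulus_pos] ln_modulus \<Lambda> by linarith
  qed (use sparseness_pos \<Lambda>_ge_1 in auto)
  also have "\<dots> = modulus * (2 / \<Lambda> ^ 2)" using \<Lambda>_ge_1 by (simp add: sparseness_def field_simps flip: power_add power_Suc)
  also note sum_card_empty_windows_head_length_le
  finally show ?thesis by (simp add: algebra_simps)
qed

lemma prod_T_ge: "\<Lambda> ^ 220 \<le> real (\<Prod>T)"
proof -
  have "T \<noteq> {}" using many_primes \<Lambda> by auto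
  then obtain p where p: "p \<in> T" by blast
  have "p dvd \<Prod>T" using p finite_T by (intro dvd_prodI) auto
  then have "p \<le> \<Prod>T" using prod_T_pos by (rule dvd_imp_le)
  then have "y \<le> \<Prod>T" using T[OF p] by simp
  then have "real y \<le> real (\<Prod>T)" by (simp only: of_nat_le_iff)
  then show ?thesis using y_ge by linarith
qed

lemma num_squares_ge: "base_card * \<alpha> * real (\<Prod>T) / 2 \<le> real num_squares"
proof -
  have "1 / \<Lambda> ^ 36 \<le> 1 / 2" using le_\<Lambda>_power[of 36] \<Lambda> by (intro divide_left_mono) auto
  then have "base_card * \<alpha> * real (\<Prod>T) * (1 / 2) \<le> base_card * \<alpha> * real (\<Prod>T) * (1 - pattern_error 1)"
    using pattern_error_1_le density_pos by (intro mult_left_mono) (auto simp: prod_nonneg)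
  also have "\<dots> \<le> real num_squares" using num_squares_bounds(2) by (simp only: mult_ac of_nat_mult)
  finally show ?thesis by simp
qed

lemma num_squares_pos: "real num_squares > 0"
proof -
  have "0 < real (\<Prod>T)" using prod_T_pos by (simp only: of_nat_0_less_iff)
  then have "0 < base_card * \<alpha> * real (\<Prod>T) / 2" using density_pos by (intro divide_pos_pos mult_pos_pos[OF density_pos]) auto
  then show ?thesis using num_squares_ge by linarith
qed

lemma modulus_div_num_squares_ge: "q / (base_card * \<alpha>) - 1 / \<Lambda> ^ 2 \<le> modulus / num_squares"
proof -
  define E where "E = base_card * \<alpha>"
  define t where "t = real (\<Prod>T)"
  define \<eta> where "\<eta> = pattern_error 1"
  have t: "t > 0" "real modulus = q * t"
    using prod_T_pos unfolding t_def modulus_def by (simp_all only: of_nat_0_less_iff of_nat_mult)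
  have \<eta>: "0 \<le> \<eta>" "\<eta> \<le> 1 / \<Lambda> ^ 36" using pattern_error_nonneg pattern_error_1_le by (simp_all add: \<eta>_def)
  have E: "0 < E" "1 / \<Lambda> ^ 2 \<le> E" using density_pos density_lower by (simp_all add: E_def)
  have "(1 - \<eta>) * (1 + \<eta>) \<le> 1" using \<eta> by (simp add: algebra_simps)
  then have "1 - \<eta> \<le> 1 / (1 + \<eta>)" using \<eta> by (simp add: le_divide_eq)
  then have "q / E * (1 - \<eta>) \<le> q / E * (1 / (1 + \<eta>))" using E by (intro mult_left_mono) auto
  also have "\<dots> = modulus / (E * t * (1 + \<eta>))" using t by simp
  also have "\<dots> \<le> modulus / num_squares"
  proof (rule divide_left_mono)
    show "real num_squares \<le> E * t * (1 + \<eta>)"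
      using num_squares_bounds(1) by (simp only: E_def t_def \<eta>_def mult_ac of_nat_mult)
    show "0 < E * t * (1 + \<eta>) * real num_squares" using E t \<eta> num_squares_pos by simp
  qed simp
  finally have "q / E - q / E * \<eta> \<le> modulus / num_squares" by (simp add: right_diff_distrib)
  moreover have "q / E * \<eta> \<le> 1 / \<Lambda> ^ 2"
  proof -
    have "1 / E \<le> \<Lambda> ^ 2" using E \<Lambda>_ge_1 by (simp add: field_simps)
    then have "q * (1 / E) * \<eta> \<le> \<Lambda> * \<Lambda> ^ 2 * (1 / \<Lambda> ^ 36)"
      using q_le_\<Lambda> \<eta> E \<Lambda>_ge_1 by (intro mult_mono) auto
    also have "\<dots> = 1 / \<Lambda> ^ 33" using \<Lambda>_ge_1 by (simp add: field_simps flip: power_add power_Suc)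
    also have "\<dots> \<le> 1 / \<Lambda> ^ 2" by (intro inverse_power_mono \<Lambda>_ge_1) auto
    finally show ?thesis by simp
  qed
  ultimately show ?thesis unfolding E_def by linarith
qed

lemma modulus_div_num_squares_square_le: "modulus / (real num_squares)\<^sup>2 \<le> 1 / \<Lambda> ^ 2"
proof -
  define t where "t = real (\<Prod>T)"
  have t: "t > 0" "\<Lambda> ^ 220 \<le> t" using prod_T_pos prod_T_ge unfolding t_def by (simp_all only: of_nat_0_less_iff)
  have "1 / \<Lambda> ^ 2 * t / 2 \<le> base_card * \<alpha> * t / 2"
    using density_lower t by (intro divide_right_mono mult_right_mono) auto
  then have "1 / \<Lambda> ^ 2 * t / 2 \<le> real num_squares" using num_squares_ge unfolding t_def by linarith
  then have "(1 / \<Lambda> ^ 2 * t / 2)\<^sup>2 \<le> (real num_squares)\<^sup>2" using t by (intro power_mono) auto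
  moreover have "real modulus \<le> \<Lambda> * t" using q_le_\<Lambda> t by (simp add: modulus_def t_def mult_right_mono prod_nonneg)
  ultimately have "modulus / (real num_squares)\<^sup>2 \<le> (\<Lambda> * t) / (1 / \<Lambda> ^ 2 * t / 2)\<^sup>2"
    using t \<Lambda>_pos by (intro frac_le) auto
  also have "\<dots> = 4 * \<Lambda> ^ 5 / t"
    using t \<Lambda>_pos by (simp add: power2_eq_square eval_nat_numeral)
  also have "\<dots> \<le> 4 * \<Lambda> ^ 5 / \<Lambda> ^ 220" using t \<Lambda>_ge_1 by (intro divide_left_mono) auto
  also have "\<dots> = 4 / \<Lambda> ^ (214 + 1)" using \<Lambda>_ge_1 by (simp add: field_simps flip: power_add)
  also have "\<dots> \<le> 1 / \<Lambda> ^ 214" using \<Lambda> by (intro inverse_power_absorb) auto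
  also have "\<dots> \<le> 1 / \<Lambda> ^ 2" by (intro inverse_power_mono \<Lambda>_ge_1) auto
  finally show ?thesis .
qed

theorem sum_card_empty_windows_less:
  "(\<Sum>L<modulus. real (card (empty_windows 1 L))) < real modulus * (real modulus + 1) / (real num_squares + 1)"
proof -
  have "5 / \<Lambda> ^ 2 < 1 / (4 * \<Lambda>)" using \<Lambda> by (simp add: field_simps power2_eq_square)
  also have "\<dots> \<le> 1 / (4 * q)" using q_le_\<Lambda> q_pos \<Lambda>_pos by (intro divide_left_mono) auto
  finally have "5 / \<Lambda> ^ 2 < 1 / (4 * q)" .
  moreover have "modulus / num_squares - modulus / (real num_squares)\<^sup>2 \<le> (real modulus + 1) / (real num_squares + 1)"
    using num_squares_pos by (intro divide_minus_divide_square_le) auto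
  ultimately have "q / (base_card * \<alpha>) - 1 / (4 * q) + 3 / \<Lambda> ^ 2 < (real modulus + 1) / (real num_squares + 1)"
    using modulus_div_num_squares_ge modulus_div_num_squares_square_le by simp
  then have "real modulus * (q / (base_card * \<alpha>) - 1 / (4 * q) + 3 / \<Lambda> ^ 2)
      < real modulus * ((real modulus + 1) / (real num_squares + 1))"
    using modulus_pos by (intro mult_strict_left_mono) auto
  then show ?thesis using sum_card_empty_windows_le by simp
qed

end

lemma QuadRes_int_iff:
  assumes "M > 0"
  shows "QuadRes (int M) (int x) \<longleftrightarrow> x mod M \<in> quad_residues M"
proof
  assume "QuadRes (int M) (int x)"
  then obtain w where w: "[w\<^sup>2 = int x] (mod int M)" by (auto simp: QuadRes_def)
  define a where "a = nat (w mod int M)"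
  have a: "int a = w mod int M" "a < M" using assms by (auto simp: a_def nat_less_iff)
  have "[(int a)\<^sup>2 = w\<^sup>2] (mod int M)" unfolding a(1) by (intro cong_pow) (simp add: cong_def)
  then have "[(int a)\<^sup>2 = int x] (mod int M)" using w cong_trans by blast
  then have "[a\<^sup>2 = x] (mod M)" by (metis cong_int_iff of_nat_power)
  then show "x mod M \<in> quad_residues M"
    unfolding quad_residues_def using a(2) by (intro image_eqI[of _ _ a]) (auto simp: cong_def)
next
  assume "x mod M \<in> quad_residues M"
  then obtain a where "x mod M = a\<^sup>2 mod M" by (auto simp: quad_residues_def)
  then have "[a\<^sup>2 = x] (mod M)" by (simp add: cong_def)
  then have "[(int a)\<^sup>2 = int x] (mod int M)" by (metis cong_int_iff of_nat_power)
  then show "QuadRes (int M) (int x)" by (auto simp: QuadRes_def)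
qed

lemma quad_residues_subset: "M > 0 \<Longrightarrow> quad_residues M \<subseteq> {0..<M}"
  by (auto simp: quad_residues_def)

lemma bij_betw_int_filter: "bij_betw int {x\<in>{0..<M}. P (int x)} {x\<in>{0..<int M}. P x}"
  by (rule bij_betwI[where g = nat]) auto

definition beats_average :: "nat \<Rightarrow> bool" where
  "beats_average M \<longleftrightarrow> real_of_int (gap_square_sum M (quad_residues M)) < avg_gap_square_sum M (card (quad_residues M))"

context good_modulus
begin

lemma card_quad_residues_modulus: "card (quad_residues modulus) = num_squares"
proof -
  have "{x\<in>{0..<modulus}. QuadRes (int modulus) (int x)} = quad_residues modulus"
    using quad_residues_subset[OF modulus_pos] by (auto simp: QuadRes_int_iff[OF modulus_pos])
  then show ?thesis
    unfolding num_squares_def using bij_betw_same_card[OF bij_betw_int_filter[of modulus "QuadRes (int modulus)"]] by simp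
qed

lemma free_windows_quad_residues: "free_windows modulus (quad_residues modulus) L = card (empty_windows 1 L)"
proof -
  have "{1..int L} = int ` {1..L}" by (simp add: image_int_atLeastAtMost)
  then have "(\<forall>i\<in>{1..L}. (x + i) mod modulus \<notin> quad_residues modulus) \<longleftrightarrow>
      (\<forall>i\<in>{1..int L}. \<not> QuadRes (int modulus) (1 * (int x + i)))" for x
    by (simp add: QuadRes_int_iff[OF modulus_pos, symmetric])
  then have "free_windows modulus (quad_residues modulus) L =
      card {x\<in>{0..<modulus}. \<forall>i\<in>{1..int L}. \<not> QuadRes (int modulus) (1 * (int x + i))}"
    unfolding free_windows_def by simp
  also have "\<dots> = card (empty_windows 1 L)"
    unfolding empty_windows_def by (rule bij_betw_same_card[OF bij_betw_int_filter])
  finally show ?thesis .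
qed

lemma beats_average_modulus: "beats_average modulus"
proof -
  have "quad_residues modulus \<noteq> {}" using modulus_pos by (auto simp: quad_residues_def)
  from gap_square_sum_less_avg_iff[OF quad_residues_subset[OF modulus_pos] this]
  show ?thesis
    using sum_card_empty_windows_less
    by (simp add: beats_average_def free_windows_quad_residues card_quad_residues_modulus)
qed

end

section \<open>Density of the family\<close>

definition good_rough_sets :: "nat \<Rightarrow> nat \<Rightarrow> real \<Rightarrow> nat set set" where
  "good_rough_sets y z \<Lambda> = {S\<in>rough_prime_sets y z. \<Lambda> \<le> (2 ^ card S) ^ 4 \<and> 2 ^ (card S + 1) \<le> \<Lambda> ^ 2}"

lemma finite_good_rough_sets: "finite (good_rough_sets y z \<Lambda>)"
  unfolding good_rough_sets_def by (rule finite_subset[OF _ finite_rough_prime_sets[of y z]]) auto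

lemma sum_rough_prime_sets_filter_le:
  fixes A c \<Lambda> :: real
  assumes "0 \<le> A" "0 \<le> c" "2 \<le> z" "ln (real z) \<le> \<Lambda>"
    and weight: "\<And>T. T \<in> rough_prime_sets y z \<Longrightarrow> P T \<Longrightarrow> 1 \<le> A * c ^ card T"
  shows "(\<Sum>T\<in>{T\<in>rough_prime_sets y z. P T}. 1 / real (\<Prod>T)) \<le> A * (\<Lambda> powr c * exp (c * mertens_const))"
proof -
  have nonneg: "0 \<le> A * (c ^ card T / real (\<Prod>T))" for T
    using assms(1,2) by (intro mult_nonneg_nonneg divide_nonneg_nonneg of_nat_0_le_iff) auto
  have "(\<Sum>T\<in>{T\<in>rough_prime_sets y z. P T}. 1 / real (\<Prod>T))
      \<le> (\<Sum>T\<in>{T\<in>rough_prime_sets y z. P T}. A * (c ^ card T / real (\<Prod>T)))"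
  proof (rule sum_mono)
    fix T assume "T \<in> {T\<in>rough_prime_sets y z. P T}"
    then have "1 / real (\<Prod>T) \<le> A * c ^ card T / real (\<Prod>T)"
      using weight by (intro divide_right_mono of_nat_0_le_iff) auto
    then show "1 / real (\<Prod>T) \<le> A * (c ^ card T / real (\<Prod>T))" by simp
  qed
  also have "\<dots> \<le> (\<Sum>T\<in>rough_prime_sets y z. A * (c ^ card T / real (\<Prod>T)))"
    using finite_rough_prime_sets nonneg by (intro sum_mono2) auto
  also have "\<dots> = A * (\<Sum>T\<in>rough_prime_sets y z. c ^ card T / real (\<Prod>T))" by (simp only: sum_distrib_left)
  also have "\<dots> \<le> A * exp (c * (ln (ln z) + mertens_const))"
    using assms by (intro mult_left_mono rough_prime_sets_rankin) auto
  also have "\<dots> \<le> A * (\<Lambda> powr c * exp (c * mertens_const))"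
  proof (rule mult_left_mono)
    have ln_z_pos: "0 < ln (real z)" using assms(3) by simp
    then have "ln (ln (real z)) \<le> ln \<Lambda>" using assms(4) by simp
    then have "exp (c * (ln (ln z) + mertens_const)) \<le> exp (c * ln \<Lambda> + c * mertens_const)"
      using assms(2) by (simp add: mult_left_mono distrib_left)
    also have "\<dots> = \<Lambda> powr c * exp (c * mertens_const)"
      using ln_z_pos assms(4) by (simp add: exp_add powr_def)
    finally show "exp (c * (ln (ln z) + mertens_const)) \<le> \<Lambda> powr c * exp (c * mertens_const)" .
  qed (rule assms(1))
  finally show ?thesis .
qed

lemma sum_small_rough_prime_sets_le:
  assumes "2 \<le> z" "ln (real z) \<le> \<Lambda>"
  shows "(\<Sum>T\<in>{T\<in>rough_prime_sets y z. (2 ^ card T) ^ 4 < \<Lambda>}. 1 / real (\<Prod>T)) \<le> \<Lambda> powr (3 / 4) * exp (mertens_const / 2)"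
proof -
  have "(\<Sum>T\<in>{T\<in>rough_prime_sets y z. (2 ^ card T) ^ 4 < \<Lambda>}. 1 / real (\<Prod>T))
      \<le> \<Lambda> powr (1/4) * (\<Lambda> powr (1/2) * exp (1/2 * mertens_const))"
  proof (rule sum_rough_prime_sets_filter_le)
    fix T :: "nat set" assume "(2 ^ card T) ^ 4 < \<Lambda>"
    then have "(((2::real) ^ card T) ^ 4) powr (1/4) \<le> \<Lambda> powr (1/4)" by (intro powr_mono2) auto
    moreover have "(((2::real) ^ card T) ^ 4) powr (1/4) = 2 ^ card T"
      by (simp add: powr_realpow[symmetric] powr_powr)
    ultimately show "1 \<le> \<Lambda> powr (1/4) * (1/2) ^ card T" by (simp add: power_divide field_simps)
  qed (use assms in auto)
  also have "\<dots> = \<Lambda> powr (1/4 + 1/2) * exp (mertens_const / 2)" by (simp only: powr_add) simp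
  finally show ?thesis by simp
qed

lemma sum_large_rough_prime_sets_le:
  assumes "2 \<le> z" "ln (real z) \<le> \<Lambda>"
  shows "(\<Sum>T\<in>{T\<in>rough_prime_sets y z. \<Lambda> ^ 2 < 2 ^ (card T + 1)}. 1 / real (\<Prod>T)) \<le> 2 * exp (2 * mertens_const)"
proof -
  have \<Lambda>_pos: "\<Lambda> > 0" using assms ln_gt_zero[of "real z"] by linarith
  have "(\<Sum>T\<in>{T\<in>rough_prime_sets y z. \<Lambda> ^ 2 < 2 ^ (card T + 1)}. 1 / real (\<Prod>T))
      \<le> 2 / \<Lambda> ^ 2 * (\<Lambda> powr 2 * exp (2 * mertens_const))"
  proof (rule sum_rough_prime_sets_filter_le)
    fix T :: "nat set" assume "\<Lambda> ^ 2 < 2 ^ (card T + 1)"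
    then show "1 \<le> 2 / \<Lambda> ^ 2 * 2 ^ card T" using \<Lambda>_pos by (simp add: field_simps)
  qed (use assms in auto)
  also have "\<dots> = 2 * exp (2 * mertens_const)" using \<Lambda>_pos by simp
  finally show ?thesis .
qed

lemma sum_good_rough_sets_ge:
  assumes "2 \<le> y" "2 \<le> z" "ln (real z) \<le> \<Lambda>"
  shows "rough_const * ln z / ln y - \<Lambda> powr (3 / 4) * exp (mertens_const / 2) - 2 * exp (2 * mertens_const)
    \<le> (\<Sum>S\<in>good_rough_sets y z \<Lambda>. 1 / real (\<Prod>S))"
proof -
  define small where "small = {T\<in>rough_prime_sets y z. (2 ^ card T) ^ 4 < \<Lambda>}"
  define large where "large = {T\<in>rough_prime_sets y z. \<Lambda> ^ 2 < 2 ^ (card T + 1)}"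
  define w :: "nat set \<Rightarrow> real" where "w T = 1 / real (\<Prod>T)" for T
  have w_nonneg: "0 \<le> w T" for T unfolding w_def by (intro divide_nonneg_nonneg of_nat_0_le_iff) simp
  have finite: "finite small" "finite large" "finite (good_rough_sets y z \<Lambda>)"
    using finite_rough_prime_sets finite_good_rough_sets by (auto simp: small_def large_def)
  have sum_Un_le: "sum w (A \<union> B) \<le> sum w A + sum w B" if "finite A" "finite B" for A B
    using sum.union_inter[OF that, of w] sum_nonneg[of "A \<inter> B" w] w_nonneg by simp
  have "rough_const * ln z / ln y \<le> sum w (rough_prime_sets y z)"
    unfolding w_def using assms by (intro rough_prime_sets_lower_bound) auto
  also have "rough_prime_sets y z = good_rough_sets y z \<Lambda> \<union> (small \<union> large)"
    by (auto simp: good_rough_sets_def small_def large_def)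
  also have "sum w \<dots> \<le> sum w (good_rough_sets y z \<Lambda>) + (sum w small + sum w large)"
    using sum_Un_le[of "good_rough_sets y z \<Lambda>" "small \<union> large"] sum_Un_le[of small large] finite by simp
  finally show ?thesis
    using sum_small_rough_prime_sets_le[OF assms(2,3), of y] sum_large_rough_prime_sets_le[OF assms(2,3), of y]
    unfolding w_def small_def large_def by linarith
qed

lemma rough_prime_sets_subset_of_prod_eq:
  assumes A: "A \<in> rough_prime_sets y z" and B: "B \<in> rough_prime_sets y z"
    and eq: "a * \<Prod>A = b * \<Prod>B" and b: "0 < b" "b \<le> y"
  shows "A \<subseteq> B"
proof
  fix p assume "p \<in> A"
  then have p: "prime p" "y < p" and "p dvd \<Prod>A" using rough_prime_setsD[OF A] by (auto intro: dvd_prodI)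
  then have "p dvd b * \<Prod>B" using eq by (metis dvd_mult)
  moreover have "\<not> p dvd b" using b p by (auto dest: dvd_imp_le)
  ultimately have "p dvd \<Prod>B" using p by (simp add: prime_dvd_mult_iff)
  then obtain r where "r \<in> B" "p dvd r" using p rough_prime_setsD(1)[OF B] by (auto simp: prime_dvd_prod_iff)
  then show "p \<in> B" using rough_prime_setsD(2)[OF B] p primes_dvd_imp_eq by metis
qed

lemma rough_factorization_unique:
  assumes S: "S \<in> rough_prime_sets y z" "S' \<in> rough_prime_sets y z"
    and q: "0 < q" "q \<le> y" "0 < q'" "q' \<le> y" and "y \<le> z"
    and P: "prime P" "z < P" "prime P'" "z < P'"
    and eq: "q * \<Prod>S * P = q' * \<Prod>S' * P'"
  shows "q = q' \<and> S = S' \<and> P = P'"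
proof -
  have "P dvd q' * \<Prod>S' * P'" by (metis eq dvd_triv_right)
  then have "P dvd q' \<or> P dvd \<Prod>S' \<or> P dvd P'" using P(1) by (simp add: prime_dvd_mult_iff)
  moreover have "\<not> P dvd q'" using q P(2) \<open>y \<le> z\<close> by (auto dest: dvd_imp_le)
  moreover have "\<not> P dvd \<Prod>S'" using rough_prime_setsD(3,4)[OF S(2)] P(2) dvd_imp_le[of P "\<Prod>S'"] by auto
  ultimately have "P = P'" using P(1,3) primes_dvd_imp_eq by blast
  then have eq': "q * \<Prod>S = q' * \<Prod>S'" using eq P(1) by (simp add: prime_gt_0_nat)
  have "S = S'"
    using rough_prime_sets_subset_of_prod_eq[OF S eq' q(3,4)]
      rough_prime_sets_subset_of_prod_eq[OF S(2,1) eq'[symmetric] q(1,2)] by blast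
  moreover have "q = q'" using eq' \<open>S = S'\<close> rough_prime_setsD(4)[OF S(1)] by simp
  ultimately show ?thesis using \<open>P = P'\<close> by blast
qed

locale moduli_family =
  fixes N y z Q :: nat and \<Lambda> :: real
  assumes ln_N: "ln (real N) = \<Lambda>" and \<Lambda>: "\<Lambda> \<ge> 20000" and y_ge: "\<Lambda> ^ 220 \<le> real y" and Q_power: "real Q ^ 20 \<le> \<Lambda>"
    and y_le_z: "y \<le> z" and room: "32 * (real z)\<^sup>2 * Q * \<Lambda> \<le> N"
begin

definition indices :: "(nat \<times> nat set) set" where
  "indices = {3..Q} \<times> good_rough_sets y z \<Lambda>"

definition cofactor :: "nat \<times> nat set \<Rightarrow> nat" where
  "cofactor v = fst v * \<Prod>(snd v)"

definition large_primes :: "nat \<Rightarrow> nat set" where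
  "large_primes m = {P. prime P \<and> z < P \<and> P \<le> N div m}"

lemma N_pos: "N > 0"
  using ln_N \<Lambda> by (cases N) auto

lemma \<Lambda>_le_y: "\<Lambda> \<le> real y"
proof -
  have "\<Lambda> \<le> \<Lambda> ^ 220" using \<Lambda> by (intro self_le_power) auto
  then show ?thesis using y_ge by linarith
qed

lemma y_ge_2: "2 \<le> y"
  using \<Lambda>_le_y \<Lambda> by linarith

lemma Q_le_y: "Q \<le> y"
proof (cases "Q = 0")
  case False
  then have "real Q \<le> real Q ^ 20" by (intro self_le_power) auto
  then show ?thesis using Q_power \<Lambda>_le_y by linarith
qed simp

lemma finite_indices: "finite indices"
  using finite_good_rough_sets by (simp add: indices_def)

lemma finite_large_primes: "finite (large_primes m)"
  unfolding large_primes_def by (rule finite_subset[of _ "{..N div m}"]) auto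

lemma indicesD:
  assumes "(q, S) \<in> indices"
  shows "3 \<le> q" "q \<le> Q" "q \<le> y" "S \<in> rough_prime_sets y z" "\<Lambda> \<le> (2 ^ card S) ^ 4" "2 ^ (card S + 1) \<le> \<Lambda> ^ 2"
  using assms Q_le_y by (auto simp: indices_def good_rough_sets_def)

lemma large_primesD:
  assumes "P \<in> large_primes m"
  shows "prime P" "z < P" "m * P \<le> N"
proof -
  show "prime P" "z < P" using assms by (auto simp: large_primes_def)
  have "m * P \<le> m * (N div m)" using assms by (simp add: large_primes_def)
  also have "\<dots> \<le> N" by (rule times_div_less_eq_dividend)
  finally show "m * P \<le> N" .
qed

lemma prod_insert_large_prime:
  assumes "(q, S) \<in> indices" "P \<in> large_primes (cofactor (q, S))"
  shows "card (insert P S) = card S + 1" "q * \<Prod>(insert P S) = cofactor (q, S) * P"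
proof -
  note S = rough_prime_setsD[OF indicesD(4)[OF assms(1)]]
  have "P \<notin> S" using S(2)[of P] large_primesD(2)[OF assms(2)] by auto
  then show "card (insert P S) = card S + 1" "q * \<Prod>(insert P S) = cofactor (q, S) * P"
    using S(1) by (simp_all add: cofactor_def mult.commute)
qed

lemma good_modulus_member:
  assumes i: "(q, S) \<in> indices" and P: "P \<in> large_primes (cofactor (q, S))"
  shows "good_modulus q y (insert P S) \<Lambda>"
proof -
  note q = indicesD(1-3)[OF i] and S = rough_prime_setsD[OF indicesD(4)[OF i]] and P_prime = large_primesD[OF P]
  note insert = prod_insert_large_prime[OF i P]
  interpret residue_setting q y "insert P S"
  proof
    show "0 < q" "0 < y" using q y_ge_2 by auto
    show "finite (insert P S)" using S(1) by simp
    fix p assume "p \<in> insert P S"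
    then have p: "prime p" "y < p" using S(2)[of p] P_prime y_le_z by auto
    then have "\<not> p dvd q" using q by (auto dest: dvd_imp_le)
    then show "prime p \<and> 2 < p \<and> coprime p q \<and> y < p" using p y_ge_2 prime_imp_coprime by auto
  qed
  show ?thesis
  proof
    show "20000 \<le> \<Lambda>" "3 \<le> q" "\<Lambda> ^ 220 \<le> real y" using \<Lambda> q y_ge by auto
    have "real q ^ 20 \<le> real Q ^ 20" using q by (intro power_mono) auto
    then show "real q ^ 20 \<le> \<Lambda>" using Q_power by linarith
    have "((2::real) ^ card S) ^ 4 \<le> (2 ^ (card S + 1)) ^ 4" by (intro power_mono power_increasing) auto
    then show "\<Lambda> \<le> (2 ^ card (insert P S)) ^ 4" using indicesD(5)[OF i] unfolding insert(1) by linarith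
    show "2 ^ card (insert P S) \<le> \<Lambda> ^ 2" using indicesD(6)[OF i] unfolding insert(1) .
    have "modulus \<le> N" using P_prime(3) unfolding modulus_def insert(2) .
    then show "ln (real modulus) \<le> \<Lambda>" using modulus_pos N_pos unfolding ln_N[symmetric] by simp
  qed
qed

lemma beats_average_member:
  assumes "(q, S) \<in> indices" "P \<in> large_primes (cofactor (q, S))"
  shows "cofactor (q, S) * P \<in> {M\<in>{1..N}. beats_average M}"
proof -
  interpret good_modulus q y "insert P S" \<Lambda> by (rule good_modulus_member[OF assms])
  have "modulus = cofactor (q, S) * P" unfolding modulus_def by (rule prod_insert_large_prime[OF assms])
  then show ?thesis using beats_average_modulus modulus_pos large_primesD(3)[OF assms(2)] by simp
qed

lemma inj_on_members:
  "inj_on (\<lambda>(v, P). cofactor v * P) (SIGMA v:indices. large_primes (cofactor v))"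
proof (rule inj_onI, clarsimp)
  fix q S P q' S' P'
  assume i: "(q, S) \<in> indices" "(q', S') \<in> indices"
    and P: "P \<in> large_primes (cofactor (q, S))" "P' \<in> large_primes (cofactor (q', S'))"
    and eq: "cofactor (q, S) * P = cofactor (q', S') * P'"
  show "q = q' \<and> S = S' \<and> P = P'"
    using rough_factorization_unique[OF indicesD(4)[OF i(1)] indicesD(4)[OF i(2)]
        _ indicesD(3)[OF i(1)] _ indicesD(3)[OF i(2)] y_le_z
        large_primesD(1,2)[OF P(1)] large_primesD(1,2)[OF P(2)]]
      eq indicesD(1)[OF i(1)] indicesD(1)[OF i(2)] by (simp add: cofactor_def)
qed

lemma room_for_large_primes:
  assumes m: "real m \<le> Q * real z"
  shows "32 * real z * m * \<Lambda> \<le> N"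
proof -
  have "32 * real z * m * \<Lambda> \<le> 32 * real z * (Q * real z) * \<Lambda>"
    using m \<Lambda> by (intro mult_right_mono mult_left_mono) auto
  then show ?thesis using room by (simp add: power2_eq_square mult.commute mult.left_commute)
qed

lemma two_le_N_div:
  assumes "0 < m" "real m \<le> Q * real z"
  shows "2 \<le> N div m"
proof -
  have "1 * 1 \<le> real z * \<Lambda>" using y_ge_2 y_le_z \<Lambda> by (intro mult_mono) auto
  then have "2 \<le> 32 * (real z * \<Lambda>)" by linarith
  then have "2 * real m \<le> 32 * (real z * \<Lambda>) * real m" by (intro mult_right_mono) auto
  also have "\<dots> \<le> N" using room_for_large_primes[OF assms(2)] by (simp only: mult_ac)
  finally have "real (2 * m) \<le> real N" by simp
  then have "2 * m \<le> N" by (simp only: of_nat_le_iff)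
  then show ?thesis using assms(1) by (simp add: less_eq_div_iff_mult_less_eq)
qed

lemma card_large_primes_ge:
  assumes m: "0 < m" "real m \<le> Q * real z"
  shows "real N / (32 * \<Lambda>) * (1 / m) \<le> card (large_primes m)"
proof -
  define X where "X = N div m"
  have X: "2 \<le> X" "X \<le> N" using two_le_N_div[OF m] by (auto simp: X_def)
  have "real N / (2 * real m) \<le> X" unfolding X_def using X(1) by (intro half_le_div) (simp add: X_def)
  then have "real N / (2 * real m) / 8 \<le> real X / 8" by simp
  also have "\<dots> \<le> card (primes_le X) * ln X" by (rule prime_counting_lower_bound[OF X(1)])
  also have "\<dots> \<le> card (primes_le X) * \<Lambda>"
    unfolding ln_N[symmetric] using X by (intro mult_left_mono) auto
  finally have total: "2 * (real N / (32 * \<Lambda>) * (1 / m)) \<le> card (primes_le X)"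
    using \<Lambda> m(1) by (simp add: field_simps)
  have "primes_le X \<subseteq> large_primes m \<union> {1..z}"
    by (auto simp: large_primes_def X_def Suc_le_eq prime_gt_0_nat not_less)
  then have "card (primes_le X) \<le> card (large_primes m \<union> {1..z})" using finite_large_primes by (intro card_mono) auto
  also have "\<dots> \<le> card (large_primes m) + z" using card_Un_le[of "large_primes m" "{1..z}"] by simp
  finally have "real (card (primes_le X)) \<le> card (large_primes m) + real z" by linarith
  moreover have "real z \<le> real N / (32 * \<Lambda>) * (1 / m)"
    using room_for_large_primes[OF m(2)] m(1) \<Lambda> by (simp add: field_simps)
  ultimately show ?thesis using total by linarith
qed

lemma cofactor_bounds:
  assumes "v \<in> indices"
  shows "0 < cofactor v" "real (cofactor v) \<le> Q * real z"
proof -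
  obtain q S where v: "v = (q, S)" by (cases v)
  note i = indicesD[OF assms[unfolded v]]
  show "0 < cofactor v" using i(1) rough_prime_setsD(4)[OF i(4)] by (simp add: v cofactor_def)
  have "cofactor v \<le> Q * z" unfolding v cofactor_def using i(2) rough_prime_setsD(3)[OF i(4)] by (auto intro: mult_mono)
  then show "real (cofactor v) \<le> Q * real z" by (metis of_nat_le_iff of_nat_mult)
qed

theorem card_beats_average_ge:
  "real N / (32 * \<Lambda>) * ((\<Sum>q\<in>{3..Q}. 1 / real q) * (\<Sum>S\<in>good_rough_sets y z \<Lambda>. 1 / real (\<Prod>S)))
    \<le> card {M\<in>{1..N}. beats_average M}"
proof -
  let ?members = "SIGMA v:indices. large_primes (cofactor v)"
  have "(\<Sum>q\<in>{3..Q}. 1 / real q) * (\<Sum>S\<in>good_rough_sets y z \<Lambda>. 1 / real (\<Prod>S)) = (\<Sum>v\<in>indices. 1 / real (cofactor v))"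
    unfolding indices_def cofactor_def sum_product sum.cartesian_product case_prod_unfold by (intro sum.cong) simp_all
  then have "real N / (32 * \<Lambda>) * ((\<Sum>q\<in>{3..Q}. 1 / real q) * (\<Sum>S\<in>good_rough_sets y z \<Lambda>. 1 / real (\<Prod>S)))
      = (\<Sum>v\<in>indices. real N / (32 * \<Lambda>) * (1 / real (cofactor v)))"
    by (simp only: sum_distrib_left)
  also have "\<dots> \<le> (\<Sum>v\<in>indices. real (card (large_primes (cofactor v))))"
    by (intro sum_mono card_large_primes_ge cofactor_bounds)
  also have "\<dots> = card ?members" using finite_indices finite_large_primes by simp
  also have "\<dots> = card ((\<lambda>(v, P). cofactor v * P) ` ?members)" by (simp add: card_image inj_on_members)
  also have "\<dots> \<le> card {M\<in>{1..N}. beats_average M}"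
    using beats_average_member by (intro of_nat_mono card_mono) auto
  finally show ?thesis .
qed

end

definition rough_bound :: "real \<Rightarrow> nat" where "rough_bound x = nat \<lceil>x ^ 220\<rceil>"

definition cofactor_bound :: "real \<Rightarrow> nat" where "cofactor_bound x = nat \<lfloor>exp (x / 3)\<rfloor>"

definition period_bound :: "real \<Rightarrow> nat" where "period_bound x = nat \<lfloor>x powr (1 / 20)\<rfloor>"

lemma rough_bound_le_cofactor_bound: "eventually (\<lambda>x. rough_bound x \<le> cofactor_bound x) at_top"
proof -
  have "eventually (\<lambda>x::real. x ^ 220 + 1 \<le> exp (x / 3)) at_top" by real_asymp
  then show ?thesis
  proof eventually_elim
    case (elim x)
    then have "\<lceil>x ^ 220\<rceil> \<le> \<lfloor>exp (x / 3)\<rfloor>" by linarith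
    then show ?case unfolding rough_bound_def cofactor_bound_def by (rule nat_mono)
  qed
qed

lemma period_bound_power_le:
  assumes "x > 0" shows "real (period_bound x) ^ 20 \<le> x"
proof -
  have "real (period_bound x) \<le> x powr (1 / 20)" unfolding period_bound_def by (simp add: of_nat_floor)
  then have "real (period_bound x) ^ 20 \<le> (x powr (1 / 20)) ^ 20" by (intro power_mono) auto
  also have "\<dots> = x" using assms by (simp add: powr_realpow[symmetric] powr_powr)
  finally show ?thesis .
qed

lemma eventually_moduli_family:
  "eventually (\<lambda>N. moduli_family N (rough_bound (ln N)) (cofactor_bound (ln N)) (period_bound (ln N)) (ln N)) sequentially"
proof -
  have "eventually (\<lambda>x::real. 20000 \<le> x \<and> 32 * (exp (x / 3))\<^sup>2 * x powr (1 / 20) * x \<le> exp x) at_top"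
    by (intro eventually_conj) real_asymp+
  with rough_bound_le_cofactor_bound
  have bounds: "eventually (\<lambda>x. rough_bound x \<le> cofactor_bound x \<and>
      20000 \<le> x \<and> 32 * (exp (x / 3))\<^sup>2 * x powr (1 / 20) * x \<le> exp x) at_top"
    by (rule eventually_conj)
  have "filterlim (\<lambda>N::nat. ln (real N)) at_top sequentially" by real_asymp
  from eventually_compose_filterlim[OF bounds this] eventually_gt_at_top[of 0] show ?thesis
  proof eventually_elim
    case (elim N)
    define x where "x = ln (real N)"
    have "real (cofactor_bound x) \<le> exp (x / 3)" "real (period_bound x) \<le> x powr (1 / 20)"
      by (simp_all add: cofactor_bound_def period_bound_def of_nat_floor)
    then have "32 * (real (cofactor_bound x))\<^sup>2 * period_bound x * x \<le> 32 * (exp (x / 3))\<^sup>2 * x powr (1 / 20) * x"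
      using elim unfolding x_def[symmetric] by (intro mult_right_mono mult_mono power_mono) auto
    also have "\<dots> \<le> exp x" using elim by (simp add: x_def)
    also have "exp x = real N" using elim by (simp add: x_def)
    finally have "32 * (real (cofactor_bound x))\<^sup>2 * period_bound x * x \<le> real N" .
    moreover have "real (period_bound x) ^ 20 \<le> x"
      using elim unfolding x_def[symmetric] by (intro period_bound_power_le) linarith
    moreover have "x ^ 220 \<le> real (rough_bound x)" by (simp add: rough_bound_def real_nat_ceiling_ge)
    ultimately show ?case
      using elim unfolding x_def by unfold_locales auto
  qed
qed

lemma sum_inverse_periods_ge:
  "eventually (\<lambda>x. ln x / 40 \<le> (\<Sum>q\<in>{3..period_bound x}. 1 / real q)) at_top"
proof -
  have "eventually (\<lambda>x::real. 1 \<le> x \<and> 60 \<le> ln x) at_top" by (intro eventually_conj) real_asymp+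
  then show ?thesis
  proof eventually_elim
    case (elim x)
    have "ln x / 20 = ln (x powr (1 / 20))" using elim by (simp add: ln_powr)
    also have "\<dots> \<le> ln (real (period_bound x) + 1)"
    proof (subst ln_le_cancel_iff)
      show "x powr (1 / 20) \<le> real (period_bound x) + 1" unfolding period_bound_def by linarith
    qed (use elim in auto)
    also have "\<dots> \<le> harm (period_bound x)" by (rule ln_le_harm)
    also have "\<dots> = (\<Sum>q\<in>{1..period_bound x}. 1 / real q)" by (simp add: harm_def divide_inverse)
    also have "\<dots> \<le> (\<Sum>q\<in>{1, 2} \<union> {3..period_bound x}. 1 / real q)" by (intro sum_mono2) auto
    also have "\<dots> = 3 / 2 + (\<Sum>q\<in>{3..period_bound x}. 1 / real q)" by (subst sum.union_disjoint) auto
    finally show ?case using elim by simp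
  qed
qed

lemma sum_inverse_good_rough_sets_ge:
  "eventually (\<lambda>x. rough_const / 1768 * x / ln x
     \<le> (\<Sum>S\<in>good_rough_sets (rough_bound x) (cofactor_bound x) x. 1 / real (\<Prod>S))) at_top"
proof -
  have "eventually (\<lambda>x::real. 2 \<le> rough_bound x \<and> 2 \<le> cofactor_bound x \<and> ln (cofactor_bound x) \<le> x) at_top"
    unfolding rough_bound_def cofactor_bound_def by (intro eventually_conj) real_asymp+
  moreover have "eventually (\<lambda>x::real. rough_const / 1768 * x / ln x
      \<le> rough_const * ln (cofactor_bound x) / ln (rough_bound x)
        - x powr (3 / 4) * exp (mertens_const / 2) - 2 * exp (2 * mertens_const)) at_top"
    unfolding rough_bound_def cofactor_bound_def using rough_const_pos by real_asymp
  ultimately show ?thesis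
  proof eventually_elim
    case (elim x)
    then show ?case using sum_good_rough_sets_ge[of "rough_bound x" "cofactor_bound x" x] by linarith
  qed
qed

definition density_const :: real where
  "density_const = rough_const / 1768 / 1280"

lemma density_const_pos: "density_const > 0"
  using rough_const_pos by (simp add: density_const_def)

lemma eventually_card_beats_average_ge:
  "eventually (\<lambda>N. density_const * real N \<le> card {M\<in>{1..N}. beats_average M}) sequentially"
proof -
  have "filterlim (\<lambda>N::nat. ln (real N)) at_top sequentially" by real_asymp
  from eventually_compose_filterlim[OF sum_inverse_periods_ge this]
    eventually_compose_filterlim[OF sum_inverse_good_rough_sets_ge this]
    eventually_moduli_family
  show ?thesis
  proof eventually_elim
    case (elim N)
    define x where "x = ln (real N)"
    interpret moduli_family N "rough_bound x" "cofactor_bound x" "period_bound x" x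
      using elim(3) by (simp add: x_def)
    have "density_const * real N = real N / (32 * x) * (ln x / 40 * (rough_const / 1768 * x / ln x))"
      using \<Lambda> by (simp add: density_const_def field_simps)
    also have "\<dots> \<le> real N / (32 * x) * ((\<Sum>q\<in>{3..period_bound x}. 1 / real q)
        * (\<Sum>S\<in>good_rough_sets (rough_bound x) (cofactor_bound x) x. 1 / real (\<Prod>S)))"
      using elim(1,2) \<Lambda> rough_const_pos unfolding x_def[symmetric] by (intro mult_left_mono mult_mono sum_nonneg) auto
    also have "\<dots> \<le> card {M\<in>{1..N}. beats_average M}" by (rule card_beats_average_ge)
    finally show ?case .
  qed
qed

theorem theorem1p2:
  shows "lower_density {M :: nat. 1 \<le> M \<and>
           real_of_int (gap_square_sum M (quad_residues M))
             < avg_gap_square_sum M (card (quad_residues M))} > 0"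
proof -
  define A where "A = {M :: nat. 1 \<le> M \<and> beats_average M}"
  have "eventually (\<lambda>N. ereal density_const \<le> ereal (real (card {M \<in> A. 1 \<le> M \<and> M \<le> N}) / real N)) sequentially"
    using eventually_card_beats_average_ge eventually_gt_at_top[of 0]
  proof eventually_elim
    case (elim N)
    have "{M \<in> A. 1 \<le> M \<and> M \<le> N} = {M\<in>{1..N}. beats_average M}" by (auto simp: A_def)
    then show ?case using elim by (simp add: le_divide_eq)
  qed
  then have "ereal density_const \<le> lower_density A" unfolding lower_density_def by (rule Liminf_bounded)
  then have "0 < lower_density A" using density_const_pos by (auto intro: less_le_trans[rotated])
  then show ?thesis by (simp add: A_def beats_average_def)
qed

end
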